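(* Let $\{a_n\}_{n\ge 0}$ be a sequence of non-negative real numbers with $a_0=0$, let $\{\xi_n\}_{n\ge0}$ be i.i.d. standard complex Gaussian random variables, and let $G(z)=\sum_{n=0}^\infty a_n\xi_n z^n$. For $k\in\{0,1,2,\dots\}$ let $\sigma_k\ge 0$ be defined by $\sigma_k^2=\sum_{n=2^k}^{2^{k+1}-1}a_n^2$. Suppose that $G$ is dyadic-regular, i.e. the sequence $\{\sigma_k\}_{k\ge0}$ is decreasing, and that $\{\sigma_k\}\in\ell^2$. Then almost surely $G\in\mathrm{VMOA}$.
   Context: A standard complex Gaussian has density $\frac1\pi e^{-|z|^2}$ with respect to Lebesgue measure on $\mathbb{C}$. Write $e(\theta)=e^{2\pi i\theta}$. $H^1$ is the Hardy space of the unit disk; its elements are identified with their boundary values in $L^1$ of the unit circle. For an interval (arc) $I\subset\mathbb{R}/\mathbb{Z}$ of length $|I|>0$ and $F\in H^1$ put $$M_I(F)=\frac1{|I|}\int_I\Big|F(e(\theta))-\frac1{|I|}\int_I F(e(\phi))\,d\phi\Big|\,d\theta,\qquad \|F\|_*=\sup_I M_I(F).$$ $\mathrm{BMOA}=\{F\in H^1:\|F\|_*<\infty\}$. $\mathrm{VMOA}$ is the closure of the polynomials in $\mathrm{BMOA}$ with respect to $\|\cdot\|_*$; equivalently, the set of $F\in H^1$ with $\lim_{\delta\to0}\sup_{|I|\le\delta}M_I(F)=0$. "Decreasing" means non-increasing. *)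

theory Defs
  imports "HOL-Probability.Probability" "HOL-Complex_Analysis.Complex_Analysis"
begin

definition std_complex_gaussian :: "'w measure \<Rightarrow> ('w \<Rightarrow> complex) \<Rightarrow> bool" where
  "std_complex_gaussian M X \<longleftrightarrow>
     distributed M lborel X (\<lambda>z. ennreal (1 / pi * exp (- (norm z)\<^sup>2)))"

definition circ :: "real \<Rightarrow> complex" where
  "circ \<theta> = exp (2 * of_real pi * \<i> * of_real \<theta>)"

text \<open>Elements of \<open>H\<^sup>1\<close>, \<open>BMOA\<close> and \<open>VMOA\<close> are represented by functions on the whole
  plane of which only the values on the open unit disk matter.\<close>

definition hardy1 :: "(complex \<Rightarrow> complex) set" where
  "hardy1 = {F. F holomorphic_on ball 0 1 \<and>
     bdd_above ((\<lambda>r. LINT \<theta>:{0..1}|lborel. norm (F (of_real r * circ \<theta>))) ` {0..<1})}"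

text \<open>The boundary value of \<open>F\<close> at a point \<open>w\<close> of the circle is the radial limit.  For \<open>F \<in> H\<^sup>1\<close>
  it exists at almost every \<open>w\<close>; where it does not exist, \<^const>\<open>Lim\<close> has a fixed unspecified value.\<close>

definition boundary_value :: "(complex \<Rightarrow> complex) \<Rightarrow> complex \<Rightarrow> complex" where
  "boundary_value F w = Lim (at_left (1::real)) (\<lambda>r. F (of_real r * w))"

definition arc_mean :: "(complex \<Rightarrow> complex) \<Rightarrow> real \<Rightarrow> real \<Rightarrow> complex" where
  "arc_mean F s t =
     of_real (1 / (t - s)) * (LINT \<phi>:{s..t}|lborel. boundary_value F (circ \<phi>))"

definition mean_osc :: "(complex \<Rightarrow> complex) \<Rightarrow> real \<Rightarrow> real \<Rightarrow> real" where
  "mean_osc F s t = 1 / (t - s) *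
     (LINT \<theta>:{s..t}|lborel. norm (boundary_value F (circ \<theta>) - arc_mean F s t))"

text \<open>The arcs of \<open>\<real>/\<int>\<close> of positive length are the images of the intervals \<open>[s, t]\<close> with
  \<open>s < t \<le> s + 1\<close>.\<close>

definition bmo_norm :: "(complex \<Rightarrow> complex) \<Rightarrow> ennreal" where
  "bmo_norm F = (SUP (s, t) \<in> {(s, t). s < t \<and> t \<le> s + 1}. ennreal (mean_osc F s t))"

definition BMOA :: "(complex \<Rightarrow> complex) set" where
  "BMOA = {F \<in> hardy1. bmo_norm F < \<infinity>}"

definition VMOA :: "(complex \<Rightarrow> complex) set" where
  "VMOA = {F \<in> BMOA. \<forall>\<epsilon>>0. \<exists>p :: complex poly. bmo_norm (\<lambda>z. F z - poly p z) < \<epsilon>}"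

definition gaussian_series ::
  "(nat \<Rightarrow> real) \<Rightarrow> (nat \<Rightarrow> 'w \<Rightarrow> complex) \<Rightarrow> 'w \<Rightarrow> complex \<Rightarrow> complex" where
  "gaussian_series a \<xi> \<omega> z = (\<Sum>n. of_real (a n) * \<xi> n \<omega> * z ^ n)"

definition dyadic_sigma :: "(nat \<Rightarrow> real) \<Rightarrow> nat \<Rightarrow> real" where
  "dyadic_sigma a k = sqrt (\<Sum>n = 2 ^ k..2 ^ (k + 1) - 1. (a n)\<^sup>2)"

definition dyadic_regular :: "(nat \<Rightarrow> real) \<Rightarrow> bool" where
  "dyadic_regular a \<longleftrightarrow> decseq (dyadic_sigma a)"

end

theory Submission
  imports Defs "HOL-Real_Asymp.Real_Asymp"
begin

text \<open>Fix a scale \<open>N = 2 ^ j\<close>. Multiplying a trigonometric polynomial by a Dirichlet kernel of length \<open>N\<close>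
  and using Parseval, its mean square over an interval of length \<open>1 / (4 N)\<close> is at most a constant times the
  average \<open>Q\<close> of the squares of its coefficient sums over windows of length \<open>N\<close>. For Gaussian coefficients,
  windows in one residue class modulo \<open>N\<close> are independent, so \<open>Q\<close> has exponential moments with a parameter
  of the order of the inverse of the largest window variance. For the frequencies above \<open>N\<close> this variance
  is at most \<open>2 \<sigma>\<^sub>j\<^sup>2\<close>, because the \<open>\<sigma>\<^sub>k\<close> decrease; the frequencies below \<open>N\<close> enter through the derivative
  and are weighted by \<open>k / N\<close>. Since \<open>j \<sigma>\<^sub>j\<^sup>2 \<longrightarrow> 0\<close> for a decreasing square-summable sequence, a union bound over
  the \<open>4 N\<close> intervals of each scale makes all local oscillations small almost surely. The boundary values
  are identified with the Fourier series by Kolmogorov's one-series theorem, Fubini and Abel's theorem.\<close>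

subsection \<open>Kolmogorov's one-series theorem\<close>

text \<open>For each sample, one sequence \<open>s j\<close> tending to 0 bounds, on every cell of
  length \<open>1 / 2 ^ (j + 2)\<close>, both the high part and the normalised derivative of the low
  part. Removing the partial sum below \<open>2 ^ m\<close> leaves only the scales
  \<open>j \<ge> m\<close>, which gives the polynomial approximation. The obstacle is that all cells
  of a scale must be good at once, which costs an amount of order \<open>j\<close> in the exponent.
  With parameter \<open>1 / V\<close>, where \<open>V\<close> is of the order of the largest window
  variance, the energy exceeds a multiple of the total variance by about \<open>j * V\<close>. So
  the variance of a single window must be \<open>o(1 / j)\<close>, while for the total variance of
  the scale convergence to 0 suffices. The high part is an infinite sum; a liminf over its
  truncations, taken inside the expectation, replaces a uniform bound, so that only infinitely many
  truncations are known to be good and Fatou's lemma carries their bound to the limit. Cells have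
  length \<open>1 / (4 N)\<close> because within distance \<open>1 / (8 N)\<close> of the centre all
  terms of the Dirichlet kernel have argument at most pi / 4, hence real part at least 1 /
  2.\<close>

lemma borel_measurable_cnj: "cnj \<in> borel_measurable borel"
  by (intro borel_measurable_continuous_onI continuous_intros)

lemma norm_add_square_complex:
  "(norm (a + b))\<^sup>2 = (norm a)\<^sup>2 + 2 * Re (cnj a * b) + (norm (b::complex))\<^sup>2"
  by (simp add: cmod_power2 power2_sum algebra_simps)

context prob_space
begin

lemma integrable_of_square_integrable:
  fixes Y :: "'a \<Rightarrow> complex"
  assumes Y: "Y \<in> borel_measurable M" and sq: "integrable M (\<lambda>\<omega>. (norm (Y \<omega>))\<^sup>2)"
  shows "integrable M Y"
proof (rule Bochner_Integration.integrable_bound [where f = "\<lambda>\<omega>. 1 + (norm (Y \<omega>))\<^sup>2"])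
  have "t \<le> 1 + t\<^sup>2" for t :: real
    using zero_le_power2 [of "t - 1 / 2"] by (simp add: power2_eq_square algebra_simps)
  then show "AE \<omega> in M. norm (Y \<omega>) \<le> norm (1 + (norm (Y \<omega>))\<^sup>2)"
    by simp
qed (auto intro: Y sq)

context
  notes borel_measurable_cnj [measurable]
  fixes X :: "nat \<Rightarrow> 'a \<Rightarrow> complex"
  assumes ind: "indep_vars (\<lambda>_. borel) X UNIV"
    and sq: "\<And>n. integrable M (\<lambda>\<omega>. (norm (X n \<omega>))\<^sup>2)"
    and mean: "\<And>n. expectation (X n) = 0"
begin

lemma indep_borel_measurable: "X n \<in> borel_measurable M"
  using ind by (auto simp: indep_vars_def)

lemma integrable_summand: "integrable M (X n)"
  using indep_borel_measurable sq by (rule integrable_of_square_integrable)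

text \<open>Disjoint blocks of indices are independent, so the expectation factors, and the future
  factor has mean zero. \<open>\<phi>\<close> is an arbitrary functional of the past, so that it can
  be a conjugated partial sum or its restriction to a first-passage event.\<close>

lemma expectation_past_times_future:
  assumes \<phi>: "\<phi> \<in> borel_measurable (PiM {m..<k} (\<lambda>_. borel))"
    and int: "integrable M (\<lambda>\<omega>. \<phi> (restrict (\<lambda>i. X i \<omega>) {m..<k}))"
  shows "integrable M (\<lambda>\<omega>. \<phi> (restrict (\<lambda>i. X i \<omega>) {m..<k}) * (\<Sum>i=k..<n. X i \<omega>))"
    and "expectation (\<lambda>\<omega>. \<phi> (restrict (\<lambda>i. X i \<omega>) {m..<k}) * (\<Sum>i=k..<n. X i \<omega>)) = (0::complex)"
proof -
  note indep_borel_measurable [measurable]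
  have "indep_var (PiM {m..<k} (\<lambda>_. borel)) (\<lambda>\<omega>. restrict (\<lambda>i. X i \<omega>) {m..<k})
                  (PiM {k..<n} (\<lambda>_. borel)) (\<lambda>\<omega>. restrict (\<lambda>i. X i \<omega>) {k..<n})"
    by (rule indep_var_restrict [OF ind]) auto
  then have "indep_var borel (\<phi> \<circ> (\<lambda>\<omega>. restrict (\<lambda>i. X i \<omega>) {m..<k}))
      borel ((\<lambda>f. \<Sum>i=k..<n. f i) \<circ> (\<lambda>\<omega>. restrict (\<lambda>i. X i \<omega>) {k..<n}))"
    by (rule indep_var_compose) (use \<phi> in auto)
  moreover have "((\<lambda>f. \<Sum>i=k..<n. f i) \<circ> (\<lambda>\<omega>. restrict (\<lambda>i. X i \<omega>) {k..<n})) = (\<lambda>\<omega>. \<Sum>i=k..<n. X i \<omega>)"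
    by (auto simp: fun_eq_iff)
  ultimately have iv: "indep_var borel (\<lambda>\<omega>. \<phi> (restrict (\<lambda>i. X i \<omega>) {m..<k})) borel (\<lambda>\<omega>. \<Sum>i=k..<n. X i \<omega>)"
    by (simp add: comp_def)
  have int2: "integrable M (\<lambda>\<omega>. \<Sum>i=k..<n. X i \<omega>)"
    by (intro Bochner_Integration.integrable_sum integrable_summand)
  show "integrable M (\<lambda>\<omega>. \<phi> (restrict (\<lambda>i. X i \<omega>) {m..<k}) * (\<Sum>i=k..<n. X i \<omega>))"
    by (rule indep_var_integrable [OF iv int int2])
  have "expectation (\<lambda>\<omega>. \<Sum>i=k..<n. X i \<omega>) = 0"
    by (simp add: integrable_summand mean)
  then show "expectation (\<lambda>\<omega>. \<phi> (restrict (\<lambda>i. X i \<omega>) {m..<k}) * (\<Sum>i=k..<n. X i \<omega>)) = (0::complex)"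
    by (subst indep_var_lebesgue_integral [OF iv int int2]) simp
qed

text \<open>Pythagoras: the cross term between a partial sum and the next summand has mean zero by
  \<open>expectation_past_times_future\<close>.\<close>

lemma second_moment_sum:
  assumes "m \<le> n"
  shows "integrable M (\<lambda>\<omega>. (norm (\<Sum>i=m..<n. X i \<omega>))\<^sup>2) \<and>
    expectation (\<lambda>\<omega>. (norm (\<Sum>i=m..<n. X i \<omega>))\<^sup>2) = (\<Sum>i=m..<n. expectation (\<lambda>\<omega>. (norm (X i \<omega>))\<^sup>2))"
  using assms
supply indep_borel_measurable [measurable]
proof (induction n rule: dec_induct)
  case base
  then show ?case by simp
next
  case (step n)
  let ?S = "\<lambda>\<omega>. \<Sum>i=m..<n. X i \<omega>"
  have eq: "(norm (\<Sum>i=m..<Suc n. X i \<omega>))\<^sup>2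
      = (norm (?S \<omega>))\<^sup>2 + 2 * Re (cnj (?S \<omega>) * X n \<omega>) + (norm (X n \<omega>))\<^sup>2" for \<omega>
    using step by (simp add: norm_add_square_complex)
  define \<phi> where "\<phi> = (\<lambda>f :: nat \<Rightarrow> complex. cnj (\<Sum>i=m..<n. f i))"
  have \<phi>m: "\<phi> \<in> borel_measurable (PiM {m..<n} (\<lambda>_. borel))"
    unfolding \<phi>_def by measurable
  have \<phi>eq: "\<phi> (restrict (\<lambda>i. X i \<omega>) {m..<n}) = cnj (?S \<omega>)" for \<omega>
    by (simp add: \<phi>_def)
  have int: "integrable M (\<lambda>\<omega>. \<phi> (restrict (\<lambda>i. X i \<omega>) {m..<n}))"
    unfolding \<phi>eq
    by (intro integrable_cnj Bochner_Integration.integrable_sum integrable_summand)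
  note c = expectation_past_times_future [OF \<phi>m int, of "Suc n", unfolded \<phi>eq]
  have c1: "integrable M (\<lambda>\<omega>. cnj (?S \<omega>) * X n \<omega>)"
    and c2: "expectation (\<lambda>\<omega>. cnj (?S \<omega>) * X n \<omega>) = 0"
    using c by simp_all
  have "expectation (\<lambda>\<omega>. Re (cnj (?S \<omega>) * X n \<omega>)) = 0" 
    using c2 integral_Re [OF c1] by simp
  moreover have "integrable M (\<lambda>\<omega>. Re (cnj (?S \<omega>) * X n \<omega>))"
    by (rule integrable_Re [OF c1])
  ultimately show ?case
    using step.IH step.hyps sq unfolding eq by (simp del: times_complex.sel)
qed

text \<open>First-passage decomposition: \<open>A k\<close> is the event that \<open>k\<close> is
  the earliest index at which the partial sum reaches \<open>\<epsilon>\<close>. The increment from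
  \<open>k\<close> to \<open>n\<close> is orthogonal to \<open>S k\<close> restricted to
  \<open>A k\<close>, so \<open>A k\<close> contributes at least
  \<open>\<epsilon>\<^sup>2 * prob (A k)\<close> to the second moment of \<open>S n\<close>, and
  these events are disjoint.\<close>

lemma kolmogorov_maximal_inequality:
  assumes "\<epsilon> > 0" "m \<le> n"
  shows "prob {\<omega> \<in> space M. \<exists>k\<in>{m..n}. \<epsilon> \<le> norm (\<Sum>i=m..<k. X i \<omega>)}
    \<le> (\<Sum>i=m..<n. expectation (\<lambda>\<omega>. (norm (X i \<omega>))\<^sup>2)) / \<epsilon>\<^sup>2"
proof -
  note indep_borel_measurable [measurable]
  define S where "S k \<omega> = (\<Sum>i=m..<k. X i \<omega>)" for k \<omega>
  have [measurable]: "S k \<in> borel_measurable M" for k unfolding S_def by measurable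
  define A where "A k = {\<omega> \<in> space M. \<epsilon> \<le> norm (S k \<omega>) \<and> (\<forall>j\<in>{m..<k}. norm (S j \<omega>) < \<epsilon>)}" for k
  have [measurable]: "A k \<in> sets M" for k unfolding A_def by measurable
  have intS: "integrable M (\<lambda>\<omega>. (norm (S n \<omega>))\<^sup>2)"
    and ES: "expectation (\<lambda>\<omega>. (norm (S n \<omega>))\<^sup>2) = (\<Sum>i=m..<n. expectation (\<lambda>\<omega>. (norm (X i \<omega>))\<^sup>2))"
    using second_moment_sum [OF assms(2)] by (auto simp: S_def)
  have disj: "disjoint_family_on A {m..n}"
  proof -
    have "\<omega> \<notin> A j" if "\<omega> \<in> A i" "i < j" "i \<in> {m..n}" for i j \<omega>
      using that by (auto simp: A_def not_less)
    then show ?thesis unfolding disjoint_family_on_def by (metis disjoint_iff nat_neq_iff)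
  qed
  have first: "\<epsilon>\<^sup>2 * prob (A k) \<le> expectation (\<lambda>\<omega>. indicator (A k) \<omega> * (norm (S n \<omega>))\<^sup>2)" if k: "k \<in> {m..n}" for k
  proof -
    \<comment> \<open>\<open>A'\<close> and \<open>\<phi>\<close> express \<open>A k\<close> and
      \<open>cnj (S k)\<close> through the coordinates \<open>m..<k\<close>. Since
      \<open>S k\<close> stops before \<open>X k\<close>, the past ends at \<open>k - 1\<close> and
      the increment starts at \<open>k\<close>.\<close>
    define A' where "A' = {f :: nat \<Rightarrow> complex. \<epsilon> \<le> norm (\<Sum>i=m..<k. f i) \<and> (\<forall>j\<in>{m..<k}. norm (\<Sum>i=m..<j. f i) < \<epsilon>)}"
    define \<phi> where "\<phi> f = (if f \<in> A' then cnj (\<Sum>i=m..<k. f i) else 0)" for f :: "nat \<Rightarrow> complex"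
    have meas: "(\<lambda>f. \<Sum>i=m..<j. f i) \<in> borel_measurable (PiM {m..<k} (\<lambda>_. borel :: complex measure))" if "j \<le> k" for j
      using that by (intro borel_measurable_sum measurable_component_singleton) auto
    have \<phi>m: "\<phi> \<in> borel_measurable (PiM {m..<k} (\<lambda>_. borel))"
    proof -
      have [measurable]: "Measurable.pred (PiM {m..<k} (\<lambda>_. borel :: complex measure)) (\<lambda>f. f \<in> A')"
      proof -
        have "Measurable.pred N (\<lambda>f. norm (g f) < \<epsilon>)" "Measurable.pred N (\<lambda>f. \<epsilon> \<le> norm (g f))"
          if "g \<in> borel_measurable N" for N and g :: "(nat \<Rightarrow> complex) \<Rightarrow> complex"
          using that by measurable
        then show ?thesis
          unfolding A'_def mem_Collect_eq
          by (intro pred_intros_logic pred_intros_finite meas) auto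
      qed
      note [measurable] = meas [OF order_refl]
      show ?thesis unfolding \<phi>_def by measurable
    qed
    have restr: "(restrict (\<lambda>i. X i \<omega>) {m..<k} \<in> A') = (\<omega> \<in> A k)" if "\<omega> \<in> space M" for \<omega>
      using that by (auto simp: A'_def A_def S_def)
    have \<phi>eq: "\<phi> (restrict (\<lambda>i. X i \<omega>) {m..<k}) = indicator (A k) \<omega> * cnj (S k \<omega>)" if "\<omega> \<in> space M" for \<omega>
      using restr [OF that] by (simp add: \<phi>_def S_def)
    have "integrable M (\<lambda>\<omega>. indicator (A k) \<omega> *\<^sub>R cnj (S k \<omega>))"
      unfolding S_def
      by (intro integrable_mult_indicator integrable_cnj Bochner_Integration.integrable_sum
            integrable_summand) auto
    then have int: "integrable M (\<lambda>\<omega>. \<phi> (restrict (\<lambda>i. X i \<omega>) {m..<k}))"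
      by (subst Bochner_Integration.integrable_cong [OF refl \<phi>eq]) (auto simp: scaleR_conv_of_real of_real_indicator)
    define Z where "Z \<omega> = \<phi> (restrict (\<lambda>i. X i \<omega>) {m..<k}) * (\<Sum>i=k..<n. X i \<omega>)" for \<omega>
    have Z: "integrable M Z" "expectation Z = 0"
      unfolding Z_def [abs_def] by (rule expectation_past_times_future [OF \<phi>m int])+
    have split: "S n \<omega> = S k \<omega> + (\<Sum>i=k..<n. X i \<omega>)" for \<omega>
      unfolding S_def using k by (simp add: sum.atLeastLessThan_concat)
    \<comment> \<open>The squared increment is nonnegative and is dropped; besides
      \<open>\<epsilon>\<^sup>2\<close> only the mean-zero cross term \<open>Z\<close>
      remains.\<close>
    have low: "\<epsilon>\<^sup>2 * indicator (A k) \<omega> + 2 * Re (Z \<omega>) \<le> indicator (A k) \<omega> * (norm (S n \<omega>))\<^sup>2" if "\<omega> \<in> space M" for \<omega>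
    proof (cases "\<omega> \<in> A k")
      case True
      then have "\<epsilon>\<^sup>2 \<le> (norm (S k \<omega>))\<^sup>2"
        using assms by (intro power_mono) (auto simp: A_def)
      moreover have "Z \<omega> = cnj (S k \<omega>) * (\<Sum>i=k..<n. X i \<omega>)"
        unfolding Z_def \<phi>eq [OF that] using True by simp
      ultimately show ?thesis
        using True unfolding split norm_add_square_complex by (simp add: add_increasing2 del: times_complex.sel)
    next
      case False
      then show ?thesis by (simp add: Z_def \<phi>eq [OF that])
    qed
    have "\<epsilon>\<^sup>2 * prob (A k) = expectation (\<lambda>\<omega>. \<epsilon>\<^sup>2 * indicator (A k) \<omega> + 2 * Re (Z \<omega>))"
      using Z integral_Re [OF Z(1)] integrable_Re [OF Z(1)] by (subst Bochner_Integration.integral_add) (auto simp: emeasure_eq_measure)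
    also have "\<dots> \<le> expectation (\<lambda>\<omega>. indicator (A k) \<omega> * (norm (S n \<omega>))\<^sup>2)"
      using Z integrable_Re [OF Z(1)] intS low integrable_mult_indicator [OF _ intS, of "A k"]
      by (intro integral_mono) (auto simp: emeasure_eq_measure)
    finally show ?thesis .
  qed
  have "{\<omega> \<in> space M. \<exists>k\<in>{m..n}. \<epsilon> \<le> norm (S k \<omega>)} \<subseteq> (\<Union>k\<in>{m..n}. A k)"
  proof safe
    fix \<omega> k assume \<omega>: "\<omega> \<in> space M" "k \<in> {m..n}" "\<epsilon> \<le> norm (S k \<omega>)"
    define k0 where "k0 = (LEAST k. m \<le> k \<and> \<epsilon> \<le> norm (S k \<omega>))"
    have "m \<le> k0 \<and> \<epsilon> \<le> norm (S k0 \<omega>)" "k0 \<le> k"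
      unfolding k0_def using \<omega> LeastI [of "\<lambda>k. m \<le> k \<and> \<epsilon> \<le> norm (S k \<omega>)" k] by (auto intro: Least_le)
    moreover have "norm (S j \<omega>) < \<epsilon>" if "j \<in> {m..<k0}" for j
      using that not_less_Least [of j "\<lambda>k. m \<le> k \<and> \<epsilon> \<le> norm (S k \<omega>)"] unfolding k0_def by auto
    ultimately show "\<omega> \<in> (\<Union>k\<in>{m..n}. A k)" using \<omega> by (auto simp: A_def intro!: bexI [of _ k0])
  qed
  then have "prob {\<omega> \<in> space M. \<exists>k\<in>{m..n}. \<epsilon> \<le> norm (S k \<omega>)} \<le> prob (\<Union>k\<in>{m..n}. A k)"
    by (intro finite_measure_mono) auto
  also have "\<dots> = (\<Sum>k\<in>{m..n}. prob (A k))"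
    by (rule finite_measure_finite_Union) (auto simp: disj)
  finally have "\<epsilon>\<^sup>2 * prob {\<omega> \<in> space M. \<exists>k\<in>{m..n}. \<epsilon> \<le> norm (S k \<omega>)} \<le> (\<Sum>k\<in>{m..n}. \<epsilon>\<^sup>2 * prob (A k))"
    using assms by (simp add: sum_distrib_left [symmetric])
  also have "\<dots> \<le> (\<Sum>k\<in>{m..n}. expectation (\<lambda>\<omega>. indicator (A k) \<omega> * (norm (S n \<omega>))\<^sup>2))"
    by (intro sum_mono first)
  also have "\<dots> = expectation (\<lambda>\<omega>. \<Sum>k\<in>{m..n}. indicator (A k) \<omega> * (norm (S n \<omega>))\<^sup>2)"
    using integrable_mult_indicator [OF _ intS]
    by (intro Bochner_Integration.integral_sum [symmetric]) auto
  also have "\<dots> \<le> expectation (\<lambda>\<omega>. (norm (S n \<omega>))\<^sup>2)"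
  proof (intro integral_mono intS)
    show "integrable M (\<lambda>\<omega>. \<Sum>k\<in>{m..n}. indicator (A k) \<omega> * (norm (S n \<omega>))\<^sup>2)"
      using integrable_mult_indicator [OF _ intS] by (intro Bochner_Integration.integrable_sum) auto
    fix \<omega>
    have "(\<Sum>k\<in>{m..n}. indicator (A k) \<omega>) = (indicator (\<Union>k\<in>{m..n}. A k) \<omega> :: real)"
      by (rule indicator_UN_disjoint [symmetric]) (auto simp: disj)
    then have "(\<Sum>k\<in>{m..n}. indicator (A k) \<omega> * (norm (S n \<omega>))\<^sup>2)
        = indicator (\<Union>k\<in>{m..n}. A k) \<omega> * (norm (S n \<omega>))\<^sup>2"
      by (simp only: sum_distrib_right [symmetric])
    also have "\<dots> \<le> (norm (S n \<omega>))\<^sup>2" by (simp add: indicator_def)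
    finally show "(\<Sum>k\<in>{m..n}. indicator (A k) \<omega> * (norm (S n \<omega>))\<^sup>2) \<le> (norm (S n \<omega>))\<^sup>2" .
  qed
  finally show ?thesis
    unfolding ES unfolding S_def using assms by (simp add: field_simps)
qed

text \<open>The maximal inequality bounds the probability that some block sum started at
  \<open>m\<close> reaches a fixed threshold by a tail of the variance series. As this tends to 0,
  the partial sums are almost surely Cauchy.\<close>

theorem kolmogorov_one_series:
  assumes summ: "summable (\<lambda>n. expectation (\<lambda>\<omega>. (norm (X n \<omega>))\<^sup>2))"
  shows "AE \<omega> in M. summable (\<lambda>n. X n \<omega>)"
proof -
  note indep_borel_measurable [measurable]
  define v where "v n = expectation (\<lambda>\<omega>. (norm (X n \<omega>))\<^sup>2)" for n
  have v0: "v n \<ge> 0" for n by (simp add: v_def)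
  define E where "E \<epsilon> m = {\<omega> \<in> space M. \<exists>k\<ge>m. \<epsilon> \<le> norm (\<Sum>i=m..<k. X i \<omega>)}" for \<epsilon> :: real and m
  have [measurable]: "E \<epsilon> m \<in> sets M" for \<epsilon> m unfolding E_def by measurable
  have Ebound: "prob (E \<epsilon> m) \<le> (\<Sum>i. v (i + m)) / \<epsilon>\<^sup>2" if "\<epsilon> > 0" for \<epsilon> m
  proof -
    \<comment> \<open>Finite-horizon events increase to \<open>E \<epsilon> m\<close>; bounding
      their variances by the full tail makes the estimate independent of the horizon.\<close>
    define D where "D n = {\<omega> \<in> space M. \<exists>k\<in>{m..m + n}. \<epsilon> \<le> norm (\<Sum>i=m..<k. X i \<omega>)}" for n
    have [measurable]: "D n \<in> sets M" for n unfolding D_def by measurable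
    have "incseq D" by (auto simp: incseq_def D_def)
    moreover have "(\<Union>n. D n) = E \<epsilon> m"
    proof safe
      fix \<omega> assume "\<omega> \<in> E \<epsilon> m"
      then obtain k where "\<omega> \<in> space M" "k \<ge> m" "\<epsilon> \<le> norm (\<Sum>i=m..<k. X i \<omega>)"
        by (auto simp: E_def)
      then have "\<omega> \<in> D (k - m)" by (auto simp: D_def)
      then show "\<omega> \<in> (\<Union>n. D n)" by blast
    qed (auto simp: D_def E_def)
    ultimately have "(\<lambda>n. prob (D n)) \<longlonglongrightarrow> prob (E \<epsilon> m)"
      using finite_Lim_measure_incseq [of D] by (auto simp: image_subset_iff)
    moreover have "prob (D n) \<le> (\<Sum>i. v (i + m)) / \<epsilon>\<^sup>2" for n
    proof -
      have "prob (D n) \<le> (\<Sum>i=m..<m + n. v i) / \<epsilon>\<^sup>2"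
        unfolding D_def v_def by (rule kolmogorov_maximal_inequality) (use that in auto)
      also have "(\<Sum>i=m..<m + n. v i) = (\<Sum>i<n. v (i + m))"
        using sum.shift_bounds_nat_ivl [of v 0 m n] by (simp add: add.commute atLeast0LessThan)
      also have "\<dots> \<le> (\<Sum>i. v (i + m))"
        using summ v0 summable_iff_shift [of v m] by (intro sum_le_suminf) (auto simp: v_def [abs_def])
      finally show ?thesis by (simp add: divide_right_mono)
    qed
    ultimately show ?thesis by (intro LIMSEQ_le_const2) auto
  qed
  have "AE \<omega> in M. \<exists>m. \<omega> \<notin> E (1 / Suc q) m" for q
  proof -
    let ?\<epsilon> = "1 / real (Suc q)"
    have "(\<lambda>m. (\<Sum>i. v (i + m)) / ?\<epsilon>\<^sup>2) \<longlonglongrightarrow> 0 / ?\<epsilon>\<^sup>2"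
      using summ by (intro tendsto_divide suminf_exist_split2) (auto simp: v_def)
    moreover have "prob (\<Inter>m. E ?\<epsilon> m) \<le> (\<Sum>i. v (i + m)) / ?\<epsilon>\<^sup>2" for m
      by (rule order_trans [OF finite_measure_mono Ebound]) auto
    ultimately have "prob (\<Inter>m. E ?\<epsilon> m) \<le> 0"
      by (intro LIMSEQ_le_const [where X = "\<lambda>m. (\<Sum>i. v (i + m)) / ?\<epsilon>\<^sup>2"]) auto
    then have "prob (\<Inter>m. E ?\<epsilon> m) = 0" by (simp add: measure_le_0_iff)
    then have "AE \<omega> in M. \<omega> \<notin> (\<Inter>m. E ?\<epsilon> m)"
      by (intro AE_not_in) (auto simp: null_sets_def emeasure_eq_measure)
    then show ?thesis by simp
  qed
  then have "AE \<omega> in M. \<forall>q. \<exists>m. \<omega> \<notin> E (1 / Suc q) m"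
    by (simp add: AE_all_countable)
  with AE_space show ?thesis
  proof (eventually_elim, goal_cases)
    case (1 \<omega>)
    have "Cauchy (\<lambda>n. \<Sum>i<n. X i \<omega>)"
      unfolding Cauchy_altdef2
    proof safe
      fix e :: real assume "e > 0"
      then obtain q where q: "1 / real (Suc q) < e"
        using nat_approx_posE by metis
      obtain m where m: "\<omega> \<notin> E (1 / Suc q) m" using 1(2) by blast
      have "dist (\<Sum>i<k. X i \<omega>) (\<Sum>i<m. X i \<omega>) < e" if "k \<ge> m" for k
      proof -
        have "norm (\<Sum>i=m..<k. X i \<omega>) < 1 / Suc q"
          using m that 1(1) by (auto simp: E_def not_le dest: spec [of _ k])
        moreover have "(\<Sum>i<k. X i \<omega>) - (\<Sum>i<m. X i \<omega>) = (\<Sum>i=m..<k. X i \<omega>)"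
          using that sum_diff_nat_ivl [of 0 m k "\<lambda>i. X i \<omega>"] by (simp add: atLeast0LessThan)
        ultimately show ?thesis using q by (simp add: dist_norm)
      qed
      then show "\<exists>N. \<forall>n\<ge>N. dist (\<Sum>i<n. X i \<omega>) (\<Sum>i<N. X i \<omega>) < e" by blast
    qed
    then show ?case
      by (simp add: summable_iff_convergent Cauchy_convergent_iff)
  qed
qed

end
end

subsection \<open>Exponential moments of Gaussian sums\<close>

text \<open>Completing the square leaves a normal density with mean \<open>q / p\<close> and
  variance \<open>1 / (2 * p)\<close>.\<close>

lemma nn_integral_exp_quadratic:
  fixes p q :: real
  assumes "p > 0"
  shows "(\<integral>\<^sup>+x. ennreal (exp (- (p * x\<^sup>2) + 2 * q * x)) \<partial>lborel) = ennreal (sqrt (pi / p) * exp (q\<^sup>2 / p))"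
proof -
  define \<sigma> where "\<sigma> = 1 / sqrt (2 * p)"
  have \<sigma>: "\<sigma> > 0" "\<sigma>\<^sup>2 = 1 / (2 * p)"
    using assms by (simp_all add: \<sigma>_def power_divide)
  have eq: "exp (- (p * x\<^sup>2) + 2 * q * x)
      = (sqrt (pi / p) * exp (q\<^sup>2 / p)) * normal_density (q / p) \<sigma> x" for x
  proof -
    have "- (p * x\<^sup>2) + 2 * q * x = q\<^sup>2 / p - p * (x - q / p)\<^sup>2"
      using assms by (simp add: power2_eq_square field_simps)
    then have "exp (- (p * x\<^sup>2) + 2 * q * x) = exp (q\<^sup>2 / p) * exp (- (p * (x - q / p)\<^sup>2))"
      by (simp add: exp_add [symmetric])
    moreover have "normal_density (q / p) \<sigma> x = 1 / sqrt (pi / p) * exp (- (p * (x - q / p)\<^sup>2))"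
      using assms by (simp add: normal_density_def \<sigma> field_simps)
    ultimately show ?thesis using assms by simp
  qed
  have "(\<integral>\<^sup>+x. ennreal (normal_density (q / p) \<sigma> x) \<partial>lborel) = 1"
    using \<sigma> by (subst nn_integral_eq_integral) auto
  then show ?thesis
    using assms unfolding eq
    by (subst ennreal_mult) (auto simp: nn_integral_cmult)
qed

lemma nn_integral_exp_quadratic_complex:
  fixes p :: real and w :: complex
  assumes "p > 0"
  shows "(\<integral>\<^sup>+z. ennreal (exp (- (p * (norm z)\<^sup>2) + 2 * Re (cnj w * z))) \<partial>lborel)
    = ennreal (pi / p * exp ((norm w)\<^sup>2 / p))"
proof -
  define f where "f b x = ennreal (exp (- (p * x\<^sup>2) + 2 * (w \<bullet> b) * x))" for b :: complex and x :: real
  have "ennreal (exp (- (p * (norm z)\<^sup>2) + 2 * Re (cnj w * z))) = (\<Prod>b\<in>Basis. f b (z \<bullet> b))" for z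
    by (simp add: Basis_complex_def f_def inner_complex_def ennreal_mult [symmetric] exp_add [symmetric]
        cmod_power2 algebra_simps)
  then have "(\<integral>\<^sup>+z. ennreal (exp (- (p * (norm z)\<^sup>2) + 2 * Re (cnj w * z))) \<partial>lborel)
     = (\<integral>\<^sup>+z. (\<Prod>b\<in>Basis. f b (z \<bullet> b)) \<partial>lborel)" by simp
  also have "\<dots> = (\<Prod>b\<in>Basis. (\<integral>\<^sup>+x. f b x \<partial>lborel))"
    by (rule nn_integral_lborel_prod) (auto simp: f_def)
  also have "\<dots> = ennreal (\<Prod>b\<in>Basis. sqrt (pi / p) * exp ((w \<bullet> b)\<^sup>2 / p))"
    unfolding f_def nn_integral_exp_quadratic [OF assms]
    using assms by (intro prod_ennreal) auto
  also have "(\<Prod>b\<in>Basis. sqrt (pi / p) * exp ((w \<bullet> b)\<^sup>2 / p)) = pi / p * exp ((norm w)\<^sup>2 / p)"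
  proof -
    have "(\<Prod>b\<in>Basis. r * exp ((w \<bullet> b)\<^sup>2 / p))
        = (r * r) * (exp ((Re w)\<^sup>2 / p) * exp ((Im w)\<^sup>2 / p))" for r
      by (simp add: Basis_complex_def inner_complex_def mult_ac)
    also have "sqrt (pi / p) * sqrt (pi / p) = pi / p" using assms by simp
    finally have "(\<Prod>b\<in>Basis. sqrt (pi / p) * exp ((w \<bullet> b)\<^sup>2 / p))
        = pi / p * (exp ((Re w)\<^sup>2 / p) * exp ((Im w)\<^sup>2 / p))" .
    also have "exp ((Re w)\<^sup>2 / p) * exp ((Im w)\<^sup>2 / p) = exp ((norm w)\<^sup>2 / p)"
      by (simp add: exp_add [symmetric] cmod_power2 add_divide_distrib)
    finally show ?thesis .
  qed
  finally show ?thesis .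
qed

text \<open>Laplace transform of the standard complex Gaussian. Read from right to left, it writes
  \<open>exp\<close> of a square as an average of exponentials of real-linear functions of
  \<open>w\<close>.\<close>

lemma nn_integral_gaussian_density_exp:
  "(\<integral>\<^sup>+z. ennreal (1 / pi * exp (- (norm z)\<^sup>2)) * ennreal (exp (2 * Re (cnj w * z))) \<partial>lborel)
    = ennreal (exp ((norm w)\<^sup>2))"
proof -
  have "(\<integral>\<^sup>+z. ennreal (1 / pi * exp (- (norm z)\<^sup>2)) * ennreal (exp (2 * Re (cnj w * z))) \<partial>lborel)
     = (\<integral>\<^sup>+z. ennreal (1 / pi) * ennreal (exp (- (1 * (norm z)\<^sup>2) + 2 * Re (cnj w * z))) \<partial>lborel)"
    by (intro nn_integral_cong) (simp add: ennreal_mult [symmetric] exp_add [symmetric])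
  also have "\<dots> = ennreal (1 / pi) * ennreal (pi / 1 * exp ((norm w)\<^sup>2 / 1))"
    by (subst nn_integral_cmult) (measurable, simp only: nn_integral_exp_quadratic_complex zero_less_one)
  finally show ?thesis by (simp add: ennreal_mult [symmetric])
qed

lemma std_complex_gaussian_borel_measurable:
  "std_complex_gaussian M X \<Longrightarrow> X \<in> borel_measurable M"
  unfolding std_complex_gaussian_def by (simp add: distributed_def measurable_lborel1)

lemma std_complex_gaussian_mgf:
  assumes "std_complex_gaussian M X"
  shows "(\<integral>\<^sup>+\<omega>. ennreal (exp (2 * Re (cnj w * X \<omega>))) \<partial>M) = ennreal (exp ((norm w)\<^sup>2))"
proof -
  have "(\<integral>\<^sup>+\<omega>. ennreal (exp (2 * Re (cnj w * X \<omega>))) \<partial>M)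
      = (\<integral>\<^sup>+z. ennreal (1 / pi * exp (- (norm z)\<^sup>2)) * ennreal (exp (2 * Re (cnj w * z))) \<partial>lborel)"
    using assms unfolding std_complex_gaussian_def
    by (subst distributed_nn_integral [symmetric]) auto
also have "\<dots> = ennreal (exp ((norm w)\<^sup>2))"
    by (rule nn_integral_gaussian_density_exp)
  finally show ?thesis .
qed

text \<open>The square in the exponent is linearised by averaging over an auxiliary independent Gaussian
  variable (Hubbard-Stratonovich transformation).\<close>

lemma (in prob_space) nn_integral_exp_gaussian_square:
  fixes \<xi> :: "nat \<Rightarrow> 'a \<Rightarrow> complex" and b :: "nat \<Rightarrow> complex"
  assumes ind: "indep_vars (\<lambda>_. borel) \<xi> UNIV"
    and gauss: "\<And>n. std_complex_gaussian M (\<xi> n)"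
    and W: "finite W" and l: "l \<ge> 0" "l * (\<Sum>k\<in>W. (norm (b k))\<^sup>2) < 1"
  shows "(\<integral>\<^sup>+\<omega>. ennreal (exp (l * (norm (\<Sum>k\<in>W. b k * \<xi> k \<omega>))\<^sup>2)) \<partial>M)
    = ennreal (1 / (1 - l * (\<Sum>k\<in>W. (norm (b k))\<^sup>2)))"
proof -
  have [measurable]: "\<xi> n \<in> borel_measurable M" for n
    using std_complex_gaussian_borel_measurable gauss by blast
  define B where "B \<omega> = (\<Sum>k\<in>W. b k * \<xi> k \<omega>)" for \<omega>
  have [measurable]: "B \<in> borel_measurable M" unfolding B_def by measurable
  \<comment> \<open>With \<open>s\<close> of modulus \<open>sqrt l\<close>, the quantity
    \<open>l * (norm (B \<omega>))\<^sup>2\<close> becomes the squared norm of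
    \<open>s * B \<omega>\<close>, as the Laplace transform requires.\<close>
  define s where "s = complex_of_real (sqrt l)"
  have s: "norm s ^ 2 = l" using l by (simp add: s_def)
  define V where "V = (\<Sum>k\<in>W. (norm (b k))\<^sup>2)"
  interpret P: pair_sigma_finite M "lborel :: complex measure" ..
  note borel_measurable_cnj [measurable]
  have [measurable]: "snd \<in> borel_measurable (M \<Otimes>\<^sub>M (lborel :: complex measure))"
    using measurable_snd [of M "lborel :: complex measure"] by simp
  have lin: "ennreal (exp (l * (norm (B \<omega>))\<^sup>2))
      = (\<integral>\<^sup>+z. ennreal (1 / pi * exp (- (norm z)\<^sup>2)) * ennreal (exp (2 * Re (cnj (s * B \<omega>) * z))) \<partial>lborel)" for \<omega>
    by (subst nn_integral_gaussian_density_exp) (use s in \<open>simp add: norm_mult power_mult_distrib\<close>)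
  \<comment> \<open>For fixed \<open>z\<close> the exponent is real-linear in the variables
    \<open>\<xi> k\<close>, so the expectation is a product of Laplace transforms over
    \<open>W\<close>.\<close>
  have inner: "(\<integral>\<^sup>+\<omega>. ennreal (exp (2 * Re (cnj (s * B \<omega>) * z))) \<partial>M) = ennreal (exp (l * V * (norm z)\<^sup>2))" for z
  proof -
    have "ennreal (exp (2 * Re (cnj (s * B \<omega>) * z)))
        = (\<Prod>k\<in>W. ennreal (exp (2 * Re (cnj (cnj s * cnj (b k) * z) * \<xi> k \<omega>))))" for \<omega>
    proof -
      have "Re u = Re (cnj u)" for u by simp
      then have "Re (cnj (s * B \<omega>) * z) = Re (cnj (cnj (s * B \<omega>) * z))" .
      also have "\<dots> = (\<Sum>k\<in>W. Re (cnj (cnj s * cnj (b k) * z) * \<xi> k \<omega>))"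
        by (simp only: Re_sum [symmetric]) (simp add: B_def sum_distrib_left sum_distrib_right mult_ac)
      finally show ?thesis
        by (subst prod_ennreal) (auto simp: exp_sum [OF W, symmetric] sum_distrib_left)
    qed
    then have "(\<integral>\<^sup>+\<omega>. ennreal (exp (2 * Re (cnj (s * B \<omega>) * z))) \<partial>M)
       = (\<integral>\<^sup>+\<omega>. (\<Prod>k\<in>W. ennreal (exp (2 * Re (cnj (cnj s * cnj (b k) * z) * \<xi> k \<omega>)))) \<partial>M)" by simp
    also have "\<dots> = (\<Prod>k\<in>W. \<integral>\<^sup>+\<omega>. ennreal (exp (2 * Re (cnj (cnj s * cnj (b k) * z) * \<xi> k \<omega>))) \<partial>M)"
      by (rule indep_vars_nn_integral [OF W indep_vars_compose2 [OF indep_vars_subset [OF ind]]]) auto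
    also have "\<dots> = (\<Prod>k\<in>W. ennreal (exp (l * (norm (b k))\<^sup>2 * (norm z)\<^sup>2)))"
      by (subst std_complex_gaussian_mgf [OF gauss]) (simp add: norm_mult power_mult_distrib s)
    also have "\<dots> = ennreal (exp (l * V * (norm z)\<^sup>2))"
      by (subst prod_ennreal) (auto simp: exp_sum [OF W, symmetric] V_def sum_distrib_left sum_distrib_right)
    finally show ?thesis .
  qed
  have "(\<integral>\<^sup>+\<omega>. ennreal (exp (l * (norm (B \<omega>))\<^sup>2)) \<partial>M)
     = (\<integral>\<^sup>+z. (\<integral>\<^sup>+\<omega>. ennreal (1 / pi * exp (- (norm z)\<^sup>2)) * ennreal (exp (2 * Re (cnj (s * B \<omega>) * z))) \<partial>M) \<partial>lborel)"
    unfolding lin by (rule P.Fubini' [symmetric]) measurable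
  also have "\<dots> = (\<integral>\<^sup>+z. ennreal (1 / pi * exp (- (norm (z::complex))\<^sup>2)) * ennreal (exp (l * V * (norm z)\<^sup>2)) \<partial>lborel)"
    by (subst nn_integral_cmult) (measurable, simp only: inner)
  \<comment> \<open>The quadratic coefficient of the remaining Gaussian integral is
    \<open>1 - l * V\<close>, which the restriction on \<open>l\<close> makes positive.\<close>
  also have "\<dots> = (\<integral>\<^sup>+z. ennreal (1 / pi) * ennreal (exp (- ((1 - l * V) * (norm z)\<^sup>2) + 2 * Re (cnj 0 * z))) \<partial>lborel)"
    by (intro nn_integral_cong) (simp add: ennreal_mult [symmetric] exp_add [symmetric] algebra_simps)
  also have "\<dots> = ennreal (1 / pi) * ennreal (pi / (1 - l * V) * exp ((norm (0::complex))\<^sup>2 / (1 - l * V)))"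
    using l by (subst nn_integral_cmult) (measurable, subst nn_integral_exp_quadratic_complex, simp_all add: V_def)
  also have "\<dots> = ennreal (1 / (1 - l * V))"
    using l by (simp add: ennreal_mult [symmetric] V_def)
  finally show ?thesis unfolding B_def V_def .
qed

text \<open>On this range \<open>1 / (1 - x) \<le> 1 + 2 * x\<close>. In exponential form, the
  moments of independent windows multiply to at most \<open>exp\<close> of a multiple of their
  summed variances.\<close>

lemma inverse_one_minus_le_exp:
  fixes x :: real
  assumes "0 \<le> x" "x \<le> 1 / 2"
  shows "1 / (1 - x) \<le> exp (2 * x)"
proof -
  have "x * (1 - 2 * x) \<ge> 0" using assms by (intro mult_nonneg_nonneg) auto
  then have "1 \<le> (1 - x) * (1 + 2 * x)" by (simp add: algebra_simps)
  then have "1 / (1 - x) \<le> 1 + 2 * x" using assms by (simp add: field_simps)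
  also have "\<dots> \<le> exp (2 * x)" by (rule exp_ge_add_one_self)
  finally show ?thesis .
qed

text \<open>These are the \<open>k\<close> with \<open>l - k\<close> in \<open>{0..<N}\<close>, that
  is, those contributing to coefficient \<open>l\<close> of the product of a polynomial of degree
  below \<open>n\<close> with the Dirichlet kernel of length \<open>N\<close>. The window is empty
  for \<open>l \<ge> n + N\<close>.\<close>

definition window :: "nat \<Rightarrow> nat \<Rightarrow> nat \<Rightarrow> nat set" where
  "window N n l = {k. k < n \<and> k \<le> l \<and> l < k + N}"

lemma finite_window [simp]: "finite (window N n l)"
  by (rule finite_subset [of _ "{..<n}"]) (auto simp: window_def)

text \<open>Distinct positions congruent modulo \<open>N\<close> are at least \<open>N\<close>
  apart, whereas a common index \<open>k\<close> would place both in
  \<open>{k..<k + N}\<close>.\<close>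

lemma window_disjoint:
  assumes "l \<noteq> l'" "l mod N = l' mod N"
  shows "window N n l \<inter> window N n l' = {}"
proof -
  have False if "l < l'" "k \<in> window N n l" "k \<in> window N n l'" "l mod N = l' mod N" for k l l'
  proof -
    have "N dvd l' - l" using that(1,4) mod_eq_dvd_iff_nat [of l l' N] by simp
    moreover have "0 < l' - l" "l' - l < N" using that by (auto simp: window_def)
    ultimately show False using nat_dvd_not_less by blast
  qed
  then show ?thesis using assms by (metis disjoint_iff nat_neq_iff)
qed

text \<open>The windows whose positions lie in a fixed residue class modulo \<open>N\<close> are disjoint, hence give
  independent sums; Jensen's inequality reduces the average over all windows to these classes.\<close>

lemma (in prob_space) nn_integral_exp_window_squares:
  fixes \<xi> :: "nat \<Rightarrow> 'a \<Rightarrow> complex" and b :: "nat \<Rightarrow> complex"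
  assumes ind: "indep_vars (\<lambda>_. borel) \<xi> UNIV"
    and gauss: "\<And>n. std_complex_gaussian M (\<xi> n)"
    and N: "N \<ge> 1" and \<mu>: "\<mu> \<ge> 0"
    and small: "\<And>l. \<mu> * (\<Sum>k\<in>window N n l. (norm (b k))\<^sup>2) \<le> 1 / 2"
  shows "(\<integral>\<^sup>+\<omega>. ennreal (exp (\<mu> / N * (\<Sum>l<n + N. (norm (\<Sum>k\<in>window N n l. b k * \<xi> k \<omega>))\<^sup>2))) \<partial>M)
    \<le> ennreal (exp (2 * \<mu> * (\<Sum>k<n. (norm (b k))\<^sup>2)))"
proof -
  have [measurable]: "\<xi> n \<in> borel_measurable M" for n
    using std_complex_gaussian_borel_measurable gauss by blast
  define B where "B l \<omega> = (\<Sum>k\<in>window N n l. b k * \<xi> k \<omega>)" for l \<omega>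
  define w where "w l = (\<Sum>k\<in>window N n l. (norm (b k))\<^sup>2)" for l
  define L where "L r = {l \<in> {..<n + N}. l mod N = r}" for r
  have [measurable]: "B l \<in> borel_measurable M" for l unfolding B_def by measurable
  have finL: "finite (L r)" for r by (simp add: L_def)
  have w0: "w l \<ge> 0" for l by (simp add: w_def sum_nonneg)
  have sumL: "(\<Sum>l\<in>L r. w l) \<le> (\<Sum>k<n. (norm (b k))\<^sup>2)" for r
  proof -
    have "(\<Sum>l\<in>L r. w l) = (\<Sum>k\<in>(\<Union>l\<in>L r. window N n l). (norm (b k))\<^sup>2)"
      unfolding w_def by (subst sum.UNION_disjoint) (auto simp: finL L_def window_disjoint)
    also have "\<dots> \<le> (\<Sum>k<n. (norm (b k))\<^sup>2)"
      by (rule sum_mono2) (auto simp: window_def)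
    finally show ?thesis .
  qed
  have residue_class: "(\<integral>\<^sup>+\<omega>. ennreal (exp (\<mu> * (\<Sum>l\<in>L r. (norm (B l \<omega>))\<^sup>2))) \<partial>M)
      \<le> ennreal (exp (2 * \<mu> * (\<Sum>k<n. (norm (b k))\<^sup>2)))" for r
  proof -
    \<comment> \<open>\<open>Y l\<close> is a function of the coordinates in its window alone, so
      independence of disjoint blocks of \<open>\<xi>\<close> passes to these variables.\<close>
    define Y where "Y l f = ennreal (exp (\<mu> * (norm (\<Sum>k\<in>window N n l. b k * f k))\<^sup>2))" for l and f :: "nat \<Rightarrow> complex"
    have Ym: "Y l \<in> borel_measurable (PiM (window N n l) (\<lambda>_. borel))" for l
      unfolding Y_def by measurable
    have "indep_vars (\<lambda>l. PiM (window N n l) (\<lambda>_. borel)) (\<lambda>l \<omega>. restrict (\<lambda>i. \<xi> i \<omega>) (window N n l)) (L r)"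
      by (rule indep_vars_restrict [OF ind]) (auto simp: disjoint_family_on_def L_def window_disjoint)
    from indep_vars_compose2 [OF this, of Y "\<lambda>_. borel"] Ym
    have "indep_vars (\<lambda>_. borel) (\<lambda>l \<omega>. Y l (restrict (\<lambda>i. \<xi> i \<omega>) (window N n l))) (L r)"
      by blast
    moreover have "Y l (restrict (\<lambda>i. \<xi> i \<omega>) (window N n l)) = ennreal (exp (\<mu> * (norm (B l \<omega>))\<^sup>2))" for l \<omega>
      by (simp add: Y_def B_def)
    ultimately have indY: "indep_vars (\<lambda>_. borel) (\<lambda>l \<omega>. ennreal (exp (\<mu> * (norm (B l \<omega>))\<^sup>2))) (L r)"
      by simp
    have "(\<integral>\<^sup>+\<omega>. ennreal (exp (\<mu> * (\<Sum>l\<in>L r. (norm (B l \<omega>))\<^sup>2))) \<partial>M)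
        = (\<integral>\<^sup>+\<omega>. (\<Prod>l\<in>L r. ennreal (exp (\<mu> * (norm (B l \<omega>))\<^sup>2))) \<partial>M)"
      by (intro nn_integral_cong, subst prod_ennreal) (auto simp: exp_sum finL sum_distrib_left)
    also have "\<dots> = (\<Prod>l\<in>L r. \<integral>\<^sup>+\<omega>. ennreal (exp (\<mu> * (norm (B l \<omega>))\<^sup>2)) \<partial>M)"
      by (rule indep_vars_nn_integral [OF finL indY]) auto
    also have "\<dots> \<le> (\<Prod>l\<in>L r. ennreal (exp (2 * \<mu> * w l)))"
    proof (intro prod_mono_ennreal)
      fix l
      have "\<mu> * w l \<le> 1 / 2" using small w_def by simp
      then have "(\<integral>\<^sup>+\<omega>. ennreal (exp (\<mu> * (norm (B l \<omega>))\<^sup>2)) \<partial>M) = ennreal (1 / (1 - \<mu> * w l))"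
        unfolding B_def w_def by (intro nn_integral_exp_gaussian_square [OF ind gauss _ \<mu>]) auto
      also have "\<dots> \<le> ennreal (exp (2 * \<mu> * w l))"
        using inverse_one_minus_le_exp [of "\<mu> * w l"] \<open>\<mu> * w l \<le> 1 / 2\<close> \<mu> w0 [of l]
        by (intro ennreal_leI) (simp add: mult.assoc)
      finally show "(\<integral>\<^sup>+\<omega>. ennreal (exp (\<mu> * (norm (B l \<omega>))\<^sup>2)) \<partial>M) \<le> ennreal (exp (2 * \<mu> * w l))" .
    qed
    also have "\<dots> = ennreal (exp (2 * \<mu> * (\<Sum>l\<in>L r. w l)))"
      by (subst prod_ennreal) (auto simp: exp_sum finL sum_distrib_left)
    also have "\<dots> \<le> ennreal (exp (2 * \<mu> * (\<Sum>k<n. (norm (b k))\<^sup>2)))"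
      using sumL [of r] \<mu> by (intro ennreal_leI) (simp add: mult_left_mono)
    finally show ?thesis .
  qed
  \<comment> \<open>The factor \<open>1 / N\<close> in the exponent supplies the weights of Jensen's
    inequality: \<open>N\<close> residue classes of weight \<open>1 / N\<close> each.\<close>
  have jensen: "exp (\<mu> / N * (\<Sum>l<n + N. (norm (B l \<omega>))\<^sup>2))
      \<le> (\<Sum>r<N. (1 / N) * exp (\<mu> * (\<Sum>l\<in>L r. (norm (B l \<omega>))\<^sup>2)))" for \<omega>
  proof -
    have "(\<Sum>l<n + N. (norm (B l \<omega>))\<^sup>2) = (\<Sum>r<N. \<Sum>l\<in>L r. (norm (B l \<omega>))\<^sup>2)"
      unfolding L_def using N by (intro sum.group [symmetric]) auto
    then have "\<mu> / N * (\<Sum>l<n + N. (norm (B l \<omega>))\<^sup>2)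
        = (\<Sum>r<N. (1 / N) *\<^sub>R (\<mu> * (\<Sum>l\<in>L r. (norm (B l \<omega>))\<^sup>2)))"
      by (simp add: sum_distrib_left)
    moreover have "exp (\<Sum>r<N. (1 / N) *\<^sub>R (\<mu> * (\<Sum>l\<in>L r. (norm (B l \<omega>))\<^sup>2)))
        \<le> (\<Sum>r<N. (1 / N) * exp (\<mu> * (\<Sum>l\<in>L r. (norm (B l \<omega>))\<^sup>2)))"
      using N by (intro convex_on_sum [OF _ _ exp_convex]) (auto simp: lessThan_empty_iff)
    ultimately show ?thesis by simp
  qed
  have "(\<integral>\<^sup>+\<omega>. ennreal (exp (\<mu> / N * (\<Sum>l<n + N. (norm (B l \<omega>))\<^sup>2))) \<partial>M)
      \<le> (\<integral>\<^sup>+\<omega>. (\<Sum>r<N. ennreal (1 / N) * ennreal (exp (\<mu> * (\<Sum>l\<in>L r. (norm (B l \<omega>))\<^sup>2)))) \<partial>M)"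
  proof (intro nn_integral_mono)
    fix \<omega>
    have "ennreal (exp (\<mu> / N * (\<Sum>l<n + N. (norm (B l \<omega>))\<^sup>2)))
        \<le> ennreal (\<Sum>r<N. (1 / N) * exp (\<mu> * (\<Sum>l\<in>L r. (norm (B l \<omega>))\<^sup>2)))"
      by (rule ennreal_leI [OF jensen])
    also have "\<dots> = (\<Sum>r<N. ennreal (1 / N) * ennreal (exp (\<mu> * (\<Sum>l\<in>L r. (norm (B l \<omega>))\<^sup>2))))"
      by (subst sum_ennreal [symmetric]) (auto simp: ennreal_mult [symmetric])
    finally show "ennreal (exp (\<mu> / N * (\<Sum>l<n + N. (norm (B l \<omega>))\<^sup>2)))
        \<le> (\<Sum>r<N. ennreal (1 / N) * ennreal (exp (\<mu> * (\<Sum>l\<in>L r. (norm (B l \<omega>))\<^sup>2))))" .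
  qed
  also have "\<dots> = (\<Sum>r<N. ennreal (1 / N) * (\<integral>\<^sup>+\<omega>. ennreal (exp (\<mu> * (\<Sum>l\<in>L r. (norm (B l \<omega>))\<^sup>2))) \<partial>M))"
    by (subst nn_integral_sum) (auto simp: nn_integral_cmult)
  also have "\<dots> \<le> (\<Sum>r<N. ennreal (1 / N) * ennreal (exp (2 * \<mu> * (\<Sum>k<n. (norm (b k))\<^sup>2))))"
    by (intro sum_mono mult_left_mono residue_class) auto
  also have "\<dots> = ennreal (exp (2 * \<mu> * (\<Sum>k<n. (norm (b k))\<^sup>2)))"
    using N by (simp add: ennreal_mult [symmetric] ennreal_of_nat_eq_real_of_nat)
  finally show ?thesis unfolding B_def .
qed

subsection \<open>Local estimates for trigonometric polynomials\<close>

lemma norm_circ [simp]: "norm (circ x) = 1"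
  by (simp add: circ_def norm_exp_eq_Re)

lemma circ_add: "circ (x + y) = circ x * circ y"
  by (simp add: circ_def exp_add [symmetric] algebra_simps)

lemma circ_of_int [simp]: "circ (of_int n) = 1"
  using exp_integer_2pi [of "of_int n"] by (simp add: circ_def mult_ac)

lemma circ_0 [simp]: "circ 0 = 1"
  by (simp add: circ_def)

lemma circ_minus: "circ (- x) = cnj (circ x)"
  by (simp add: circ_def exp_cnj)

lemma circ_mult_nat: "circ (of_nat n * x) = circ x ^ n"
  by (simp add: circ_def exp_of_nat_mult [symmetric] mult_ac)

lemma circ_diff: "circ (x - y) = circ x * cnj (circ y)"
  using circ_add [of x "- y"] by (simp add: circ_minus)

lemma continuous_on_circ [continuous_intros]:
  "continuous_on A f \<Longrightarrow> continuous_on A (\<lambda>x. circ (f x))"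
  unfolding circ_def by (intro continuous_intros)

lemma borel_measurable_circ [measurable (raw)]:
  "f \<in> borel_measurable M \<Longrightarrow> (\<lambda>x. circ (f x)) \<in> borel_measurable M"
  by (rule borel_measurable_continuous_on [where f = circ]) (intro continuous_intros)

lemma circ_has_vector_derivative [derivative_intros]:
  "((\<lambda>t. circ (c * t)) has_vector_derivative (2 * of_real pi * \<i> * of_real c * circ (c * t))) (at t within A)"
proof -
  have "((\<lambda>z. exp (2 * of_real pi * \<i> * of_real c * z)) has_field_derivative
      2 * of_real pi * \<i> * of_real c * exp (2 * of_real pi * \<i> * of_real c * of_real t)) (at (of_real t))"
    by (auto intro!: derivative_eq_intros)
  from has_vector_derivative_real_field [OF this] show ?thesis
    by (simp add: circ_def mult_ac has_vector_derivative_at_within)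
qed

lemma Re_circ_ge_half:
  assumes "\<bar>x\<bar> \<le> 1 / 8"
  shows "Re (circ x) \<ge> 1 / 2"
proof -
  have "Re (circ x) = cos (2 * pi * x)" by (simp add: circ_def Re_exp)
  also have "\<dots> = cos \<bar>2 * pi * x\<bar>" by simp
  also have "\<dots> \<ge> cos (pi / 3)"
    using assms pi_gt_zero mult_left_mono [OF assms, of "2 * pi"]
    by (intro cos_monotone_0_pi_le) (auto simp: abs_mult)
  finally show ?thesis by (simp add: cos_60)
qed

section \<open>Orthogonality of characters and localisation by the Dirichlet kernel\<close>

lemma integral_circ_multiple:
  "(LINT t:{a..a + 1}|lborel. circ (of_int d * t)) = (if d = 0 then 1 else 0)"
proof (cases "d = 0")
  case True
  then show ?thesis by (simp add: set_lebesgue_integral_def)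
next
  case False
  define u where "u = 2 * of_real pi * \<i> * (of_int d :: complex)"
  have u: "u \<noteq> 0" using False by (simp add: u_def)
  have "(LBINT t. indicator {a..a + 1} t *\<^sub>R circ (of_int d * t))
     = circ (of_int d * (a + 1)) / u - circ (of_int d * a) / u"
  proof (rule integral_FTC_Icc)
    show "((\<lambda>t. circ (of_int d * t) / u) has_vector_derivative circ (of_int d * t)) (at t within {a..a + 1})" for t
      using u by (auto intro!: derivative_eq_intros simp: u_def)
  qed (auto intro!: continuous_intros)
  also have "circ (of_int d * (a + 1)) = circ (of_int d * a)"
    by (simp add: algebra_simps circ_add)
  finally show ?thesis using False by (simp add: set_lebesgue_integral_def)
qed

lemma norm_square_sum_complex:
  "of_real ((norm (\<Sum>l<m. f l))\<^sup>2) = (\<Sum>l<m. \<Sum>l'<m. f l * cnj (f l' :: complex))"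
  unfolding complex_norm_square by (simp add: sum_product cnj_sum)

lemma nn_integral_Icc_continuous:
  fixes g :: "real \<Rightarrow> real"
  assumes "continuous_on {a..b} g" "\<And>t. g t \<ge> 0"
  shows "(\<integral>\<^sup>+t\<in>{a..b}. ennreal (g t) \<partial>lborel) = ennreal (LINT t:{a..b}|lborel. g t)"
proof -
  have "integrable lborel (\<lambda>t. indicator {a..b} t *\<^sub>R g t)"
    by (rule borel_integrable_compact) (use assms in auto)
  moreover have "(\<integral>\<^sup>+t\<in>{a..b}. ennreal (g t) \<partial>lborel) = (\<integral>\<^sup>+t. ennreal (indicator {a..b} t *\<^sub>R g t) \<partial>lborel)"
    by (intro nn_integral_cong) (auto split: split_indicator)
  ultimately show ?thesis
    unfolding set_lebesgue_integral_def by (simp add: nn_integral_eq_integral assms)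
qed

text \<open>The left endpoint is free so that the period can be centred at the point under
  study.\<close>

lemma parseval_trig_polynomial:
  "(\<integral>\<^sup>+t\<in>{a..a + 1}. ennreal ((norm (\<Sum>l<m. b l * circ (of_nat l * t)))\<^sup>2) \<partial>lborel)
    = ennreal (\<Sum>l<m. (norm (b l))\<^sup>2)"
proof -
  let ?P = "\<lambda>t. \<Sum>l<m. b l * circ (of_nat l * t)"
  have *: "b l * circ (of_nat l * t) * cnj (b l' * circ (of_nat l' * t)) = b l * cnj (b l') * circ (of_int (int l - int l') * t)" for l l' t
    by (simp add: circ_diff left_diff_distrib)
  have ci: "integrable lborel (\<lambda>t. indicator {a..a + 1} t *\<^sub>R (c * circ (r * t)))" for c :: complex and r
    by (rule borel_integrable_compact) (auto intro!: continuous_intros)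
  have "complex_of_real (LINT t:{a..a + 1}|lborel. (norm (?P t))\<^sup>2) = (LINT t:{a..a + 1}|lborel. of_real ((norm (?P t))\<^sup>2))"
    by (rule set_integral_complex_of_real [symmetric])
  also have "\<dots> = (LINT t:{a..a + 1}|lborel. (\<Sum>l<m. \<Sum>l'<m. b l * cnj (b l') * circ (of_int (int l - int l') * t)))"
    by (simp only: norm_square_sum_complex *)
  also have "\<dots> = (\<Sum>l<m. \<Sum>l'<m. (LINT t:{a..a + 1}|lborel. b l * cnj (b l') * circ (of_int (int l - int l') * t)))"
    unfolding set_lebesgue_integral_def scaleR_sum_right by (simp only: Bochner_Integration.integral_sum Bochner_Integration.integrable_sum ci)
  also have "\<dots> = (\<Sum>l<m. \<Sum>l'<m. b l * cnj (b l') * (if l = l' then 1 else 0))"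
    by (simp only: set_integral_mult_right integral_circ_multiple) simp
  also have "\<dots> = (\<Sum>l<m. b l * cnj (b l))"
    by (simp add: sum.delta if_distrib cong: if_cong)
  also have "\<dots> = of_real (\<Sum>l<m. (norm (b l))\<^sup>2)"
    by (simp only: complex_norm_square of_real_sum)
  finally have "(LINT t:{a..a + 1}|lborel. (norm (?P t))\<^sup>2) = (\<Sum>l<m. (norm (b l))\<^sup>2)"
    by (simp only: of_real_eq_iff)
  then show ?thesis
    by (subst nn_integral_Icc_continuous) (auto intro!: continuous_intros)
qed

text \<open>Multiplying by the Dirichlet kernel centred at \<open>x\<close>, which is at least \<open>N / 2\<close> near \<open>x\<close>,
  replaces the coefficients by their sums over windows of length \<open>N\<close>.\<close>

lemma local_integral_le_window_squares:
  fixes b :: "nat \<Rightarrow> complex" and x :: real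
  assumes N: "N \<ge> 1"
  shows "(\<integral>\<^sup>+t\<in>{x - 1 / (8 * N)..x + 1 / (8 * N)}. ennreal ((norm (\<Sum>k<n. b k * circ (k * t)))\<^sup>2) \<partial>lborel)
    \<le> ennreal (4 / N\<^sup>2 * (\<Sum>l<n + N. (norm (\<Sum>k\<in>window N n l. b k * circ (k * x)))\<^sup>2))"
proof -
  define B where "B l = (\<Sum>k\<in>window N n l. b k * circ (k * x))" for l
  define P where "P t = (\<Sum>k<n. b k * circ (k * t))" for t :: real
  define D where "D t = (\<Sum>d<N. circ (d * t))" for t :: real
  define I where "I = {x - 1 / (8 * N)..x + 1 / (8 * N)}"
  have prod: "D (t - x) * P t = (\<Sum>l<n + N. B l * circ (l * (t - x)))" for t
  proof -
    have "D (t - x) * P t = (\<Sum>k<n. \<Sum>d<N. b k * circ (k * x) * circ ((k + d) * (t - x)))"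
    proof -
      have "circ (d * (t - x)) * (b k * circ (k * t)) = b k * circ (k * x) * circ ((k + d) * (t - x))" for k d :: nat
        by (simp add: circ_add [symmetric] algebra_simps flip: circ_add)
      then show ?thesis
        unfolding D_def P_def sum_product by (subst sum.swap) (simp only:)
    qed
    \<comment> \<open>The substitution \<open>l = k + d\<close> turns the range of \<open>d\<close>
      into the window condition on \<open>l\<close>.\<close>
    also have "\<dots> = (\<Sum>k<n. \<Sum>l<n + N. if k \<le> l \<and> l < k + N then b k * circ (k * x) * circ (l * (t - x)) else 0)"
    proof (rule sum.cong [OF refl])
      fix k assume "k \<in> {..<n}"
      have "(\<Sum>d<N. b k * circ (k * x) * circ ((k + d) * (t - x)))
          = (\<Sum>l\<in>{l \<in> {..<n + N}. k \<le> l \<and> l < k + N}. b k * circ (k * x) * circ (l * (t - x)))"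
        by (rule sum.reindex_bij_witness [of _ "\<lambda>l. l - k" "\<lambda>d. k + d"]) (use \<open>k \<in> {..<n}\<close> in auto)
      then show "(\<Sum>d<N. b k * circ (k * x) * circ ((k + d) * (t - x)))
          = (\<Sum>l<n + N. if k \<le> l \<and> l < k + N then b k * circ (k * x) * circ (l * (t - x)) else 0)"
        by (simp only: sum.inter_filter finite_lessThan)
    qed
    also have "\<dots> = (\<Sum>l<n + N. \<Sum>k<n. if k \<le> l \<and> l < k + N then b k * circ (k * x) * circ (l * (t - x)) else 0)"
      by (rule sum.swap)
    also have "\<dots> = (\<Sum>l<n + N. B l * circ (l * (t - x)))"
    proof (rule sum.cong [OF refl])
      fix l assume "l \<in> {..<n + N}"
      have w: "window N n l = {k \<in> {..<n}. k \<le> l \<and> l < k + N}" by (auto simp: window_def)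
      show "(\<Sum>k<n. if k \<le> l \<and> l < k + N then b k * circ (k * x) * circ (l * (t - x)) else 0)
          = B l * circ (l * (t - x))"
        unfolding B_def sum_distrib_right w by (simp only: sum.inter_filter finite_lessThan)
    qed
    finally show ?thesis by simp
  qed
  \<comment> \<open>\<open>d < N\<close> and distance at most \<open>1 / (8 * N)\<close> from
    \<open>x\<close> keep every argument \<open>d * (t - x)\<close> within 1 / 8.\<close>
  have kernel: "real N / 2 \<le> norm (D (t - x))" if "t \<in> I" for t
  proof -
    have "real N / 2 = (\<Sum>d<N. 1 / 2)" by simp
    also have "\<dots> \<le> (\<Sum>d<N. Re (circ (d * (t - x))))"
    proof (intro sum_mono Re_circ_ge_half)
      fix d assume "d \<in> {..<N}"
      have "\<bar>real d * (t - x)\<bar> \<le> real N * (1 / (8 * N))"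
        unfolding abs_mult using \<open>d \<in> {..<N}\<close> \<open>t \<in> I\<close> by (intro mult_mono) (auto simp: I_def abs_le_iff)
      then show "\<bar>real d * (t - x)\<bar> \<le> 1 / 8" using N by simp
    qed
    also have "\<dots> \<le> norm (D (t - x))" unfolding D_def by (subst Re_sum [symmetric]) (rule complex_Re_le_cmod)
    finally show ?thesis .
  qed
  have Q: "4 / N\<^sup>2 * (norm (D (t - x) * P t))\<^sup>2 \<ge> (norm (P t))\<^sup>2" if "t \<in> I" for t
  proof -
    have "(real N / 2)\<^sup>2 * (norm (P t))\<^sup>2 \<le> (norm (D (t - x)))\<^sup>2 * (norm (P t))\<^sup>2"
      using kernel [OF that] by (intro mult_right_mono power_mono) auto
    then show ?thesis using N by (simp add: norm_mult power_mult_distrib field_simps)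
  qed
  have sub: "I \<subseteq> {x - 1 / 2..x - 1 / 2 + 1}" 
  proof -
    have "1 / (8 * real N) \<le> 1 / 2" using N by (simp add: field_simps)
    then show ?thesis by (auto simp: I_def)
  qed
  \<comment> \<open>The centring at \<open>x\<close> is moved into unimodular factors of the
    coefficients, because Parseval is stated for uncentred characters.\<close>
  define b' where "b' l = B l * circ (- (l * x))" for l :: nat
  have "(\<integral>\<^sup>+t\<in>I. ennreal ((norm (P t))\<^sup>2) \<partial>lborel)
      \<le> (\<integral>\<^sup>+t. ennreal (4 / N\<^sup>2) * (ennreal ((norm (\<Sum>l<n + N. b' l * circ (l * t)))\<^sup>2) * indicator {x - 1 / 2..x - 1 / 2 + 1} t) \<partial>lborel)"
  proof (rule nn_integral_mono)
    fix t :: real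
    show "ennreal ((norm (P t))\<^sup>2) * indicator I t
      \<le> ennreal (4 / N\<^sup>2) * (ennreal ((norm (\<Sum>l<n + N. b' l * circ (l * t)))\<^sup>2) * indicator {x - 1 / 2..x - 1 / 2 + 1} t)"
    proof (cases "t \<in> I")
      case True
      have "D (t - x) * P t = (\<Sum>l<n + N. b' l * circ (l * t))"
        unfolding prod b'_def by (simp add: circ_add [symmetric] algebra_simps mult.assoc flip: circ_add)
      then have "(norm (P t))\<^sup>2 \<le> 4 / N\<^sup>2 * (norm (\<Sum>l<n + N. b' l * circ (l * t)))\<^sup>2"
        using Q [OF True] by simp
      then have "ennreal ((norm (P t))\<^sup>2) \<le> ennreal (4 / N\<^sup>2) * ennreal ((norm (\<Sum>l<n + N. b' l * circ (l * t)))\<^sup>2)"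
        by (subst ennreal_mult [symmetric]) (auto intro: ennreal_leI)
      then show ?thesis using True subsetD [OF sub True] by simp
    qed simp
  qed
  also have "\<dots> = ennreal (4 / N\<^sup>2) * ennreal (\<Sum>l<n + N. (norm (b' l))\<^sup>2)"
    by (subst nn_integral_cmult) (measurable, simp only: parseval_trig_polynomial)
  also have "\<dots> = ennreal (4 / N\<^sup>2 * (\<Sum>l<n + N. (norm (B l))\<^sup>2))"
    by (simp add: ennreal_mult [symmetric] b'_def norm_mult sum_nonneg)
  finally show ?thesis unfolding I_def P_def B_def by simp
qed

section \<open>From mean squares on cells to mean oscillation on arcs\<close>

text \<open>Cauchy-Schwarz in linear form: integrate
  \<open>norm (g t) \<le> s / 2 + (norm (g t))\<^sup>2 / (2 * s)\<close> with \<open>s\<close> the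
  bound on the root mean square, so that each summand contributes at most half of the total.\<close>

lemma nn_integral_le_of_square:
  fixes g :: "real \<Rightarrow> complex"
  assumes [measurable]: "g \<in> borel_measurable borel" and "s > 0" "a \<le> b"
    and sq: "(\<integral>\<^sup>+t\<in>{a..b}. ennreal ((norm (g t))\<^sup>2) \<partial>lborel) \<le> ennreal (s\<^sup>2 * (b - a))"
  shows "(\<integral>\<^sup>+t\<in>{a..b}. ennreal (norm (g t)) \<partial>lborel) \<le> ennreal (s * (b - a))"
proof -
  have en: "ennreal (p + q * r) = ennreal p + ennreal q * ennreal r" if "p \<ge> 0" "q \<ge> 0" "r \<ge> 0" for p q r :: real
    using that by (simp add: ennreal_mult)
  have "(\<integral>\<^sup>+t\<in>{a..b}. ennreal (norm (g t)) \<partial>lborel)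
    \<le> (\<integral>\<^sup>+t. ennreal (s / 2) * indicator {a..b} t + ennreal (1 / (2 * s)) * (ennreal ((norm (g t))\<^sup>2) * indicator {a..b} t) \<partial>lborel)"
  proof (rule nn_integral_mono)
    fix t
    have "0 \<le> (norm (g t) - s)\<^sup>2 / (2 * s)" using \<open>s > 0\<close> by simp
    also have "\<dots> = (s / 2 + 1 / (2 * s) * (norm (g t))\<^sup>2) - norm (g t)"
      using \<open>s > 0\<close> by (simp add: power2_eq_square field_simps)
    finally have "norm (g t) \<le> s / 2 + 1 / (2 * s) * (norm (g t))\<^sup>2" by simp
    then have "ennreal (norm (g t)) \<le> ennreal (s / 2) + ennreal (1 / (2 * s)) * ennreal ((norm (g t))\<^sup>2)"
      using \<open>s > 0\<close> by (subst en [symmetric]) (auto intro: ennreal_leI simp del: ennreal_plus)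
    then show "ennreal (norm (g t)) * indicator {a..b} t
      \<le> ennreal (s / 2) * indicator {a..b} t + ennreal (1 / (2 * s)) * (ennreal ((norm (g t))\<^sup>2) * indicator {a..b} t)"
      by (auto split: split_indicator)
  qed
  also have "\<dots> = ennreal (s / 2) * ennreal (b - a) + ennreal (1 / (2 * s)) * (\<integral>\<^sup>+t\<in>{a..b}. ennreal ((norm (g t))\<^sup>2) \<partial>lborel)"
    using assms by (subst nn_integral_add) (auto simp: nn_integral_cmult)
  also have "\<dots> \<le> ennreal (s / 2) * ennreal (b - a) + ennreal (1 / (2 * s)) * ennreal (s\<^sup>2 * (b - a))"
    by (intro add_left_mono mult_left_mono sq) auto
  also have "\<dots> = ennreal (s / 2 * (b - a) + 1 / (2 * s) * (s\<^sup>2 * (b - a)))"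
    using assms by (subst (1 2) ennreal_mult [symmetric]) (auto simp: ennreal_plus [symmetric] simp del: ennreal_plus)
  also have "s / 2 * (b - a) + 1 / (2 * s) * (s\<^sup>2 * (b - a)) = s * (b - a)"
    using assms by (simp add: power2_eq_square field_simps)
  finally show ?thesis .
qed

text \<open>The cells of mesh \<open>1 / M\<close> with index from the floor of \<open>M * s\<close>
  to the floor of \<open>M * t\<close> cover \<open>{s..t}\<close>, and there are at most
  \<open>M * (t - s) + 2\<close> of them.\<close>

lemma nn_integral_cover_grid:
  fixes h :: "real \<Rightarrow> ennreal"
  assumes [measurable]: "h \<in> borel_measurable borel" and M: "M > (0::real)" and A: "A \<ge> 0" and st: "s \<le> t"
    and cell: "\<And>i::int. (\<integral>\<^sup>+x\<in>{of_int i / M..(of_int i + 1) / M}. h x \<partial>lborel) \<le> ennreal A"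
  shows "(\<integral>\<^sup>+x\<in>{s..t}. h x \<partial>lborel) \<le> ennreal ((M * (t - s) + 2) * A)"
proof -
  define J where "J = {\<lfloor>M * s\<rfloor>..\<lfloor>M * t\<rfloor>}"
  have "s * M \<le> t * M" using st M by simp
  then have fl: "\<lfloor>M * s\<rfloor> \<le> \<lfloor>M * t\<rfloor>" by (intro floor_mono) (simp add: mult.commute)
  have card: "real (card J) \<le> M * (t - s) + 2"
  proof -
    have "real (card J) = of_int \<lfloor>M * t\<rfloor> - of_int \<lfloor>M * s\<rfloor> + 1" using fl by (simp add: J_def)
    also have "\<dots> \<le> M * t - (M * s - 1) + 1" by linarith
    finally show ?thesis by (simp add: algebra_simps)
  qed
  have "(\<integral>\<^sup>+x\<in>{s..t}. h x \<partial>lborel) \<le> (\<integral>\<^sup>+x. (\<Sum>i\<in>J. h x * indicator {of_int i / M..(of_int i + 1) / M} x) \<partial>lborel)"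
  proof (rule nn_integral_mono)
    fix x
    show "h x * indicator {s..t} x \<le> (\<Sum>i\<in>J. h x * indicator {of_int i / M..(of_int i + 1) / M} x)"
    proof (cases "x \<in> {s..t}")
      case True
      then have "\<lfloor>M * x\<rfloor> \<in> J" using M by (auto simp: J_def intro!: floor_mono)
      moreover have "x \<in> {of_int \<lfloor>M * x\<rfloor> / M..(of_int \<lfloor>M * x\<rfloor> + 1) / M}"
        using M by (simp add: field_simps) linarith
      ultimately have "h x \<le> (\<Sum>i\<in>{\<lfloor>M * x\<rfloor>}. h x * indicator {of_int i / M..(of_int i + 1) / M} x)"
        by simp
      also have "\<dots> \<le> (\<Sum>i\<in>J. h x * indicator {of_int i / M..(of_int i + 1) / M} x)"
        using \<open>\<lfloor>M * x\<rfloor> \<in> J\<close> by (intro sum_mono2) (auto simp: J_def)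
      finally show ?thesis using True by simp
    qed simp
  qed
  also have "\<dots> = (\<Sum>i\<in>J. \<integral>\<^sup>+x\<in>{of_int i / M..(of_int i + 1) / M}. h x \<partial>lborel)"
    by (rule nn_integral_sum) auto
  also have "\<dots> \<le> (\<Sum>i\<in>J. ennreal A)" by (intro sum_mono cell)
  also have "\<dots> = ennreal (card J * A)" using A by (simp add: ennreal_mult ennreal_of_nat_eq_real_of_nat)
  also have "\<dots> \<le> ennreal ((M * (t - s) + 2) * A)" using card A by (intro ennreal_leI mult_right_mono)
  finally show ?thesis .
qed

text \<open>Fatou's lemma. A bound for infinitely many \<open>n\<close> already forces the liminf of
  the integrals below \<open>B\<close>; this weak form matches what the probabilistic estimate
  supplies.\<close>

lemma nn_integral_square_limit_le:
  fixes g :: "nat \<Rightarrow> real \<Rightarrow> complex"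
  assumes [measurable]: "\<And>n. g n \<in> borel_measurable borel" "A \<in> sets borel"
    and lim: "AE x in lborel. (\<lambda>n. g n x) \<longlonglongrightarrow> h x"
    and freq: "\<exists>\<^sub>F n in sequentially. (\<integral>\<^sup>+x\<in>A. ennreal ((norm (g n x))\<^sup>2) \<partial>lborel) \<le> B"
  shows "(\<integral>\<^sup>+x\<in>A. ennreal ((norm (h x))\<^sup>2) \<partial>lborel) \<le> B"
proof -
  have "(\<integral>\<^sup>+x\<in>A. ennreal ((norm (h x))\<^sup>2) \<partial>lborel)
      = (\<integral>\<^sup>+x. liminf (\<lambda>n. ennreal ((norm (g n x))\<^sup>2) * indicator A x) \<partial>lborel)"
  proof (rule nn_integral_cong_AE, use lim in eventually_elim)
    case (elim x)
    have "(\<lambda>n. ennreal ((norm (g n x))\<^sup>2) * indicator A x) \<longlonglongrightarrow> ennreal ((norm (h x))\<^sup>2) * indicator A x"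
      using elim by (cases "x \<in> A") (auto intro!: tendsto_intros)
    then show ?case by (intro lim_imp_Liminf [symmetric]) auto
  qed
  also have "\<dots> \<le> liminf (\<lambda>n. \<integral>\<^sup>+x. ennreal ((norm (g n x))\<^sup>2) * indicator A x \<partial>lborel)"
    by (rule nn_integral_liminf) measurable
  also have "\<dots> \<le> B"
  proof (rule ccontr)
    assume "\<not> liminf (\<lambda>n. \<integral>\<^sup>+x. ennreal ((norm (g n x))\<^sup>2) * indicator A x \<partial>lborel) \<le> B"
    then have "eventually (\<lambda>n. B < (\<integral>\<^sup>+x. ennreal ((norm (g n x))\<^sup>2) * indicator A x \<partial>lborel)) sequentially"
      by (intro less_LiminfD) simp
    then show False using freq by (auto simp: frequently_def not_le)
  qed
  finally show ?thesis .
qed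

text \<open>The arc mean differs from any constant \<open>c\<close> by at most the average distance
  of the boundary values to \<open>c\<close>. Working with a convenient constant therefore costs
  only the factor 2.\<close>

lemma mean_osc_le:
  assumes [measurable]: "(\<lambda>x. boundary_value F (circ x)) \<in> borel_measurable borel"
    and st: "s < t" and K: "K \<ge> 0"
    and le: "(\<integral>\<^sup>+x\<in>{s..t}. ennreal (norm (boundary_value F (circ x) - c)) \<partial>lborel) \<le> ennreal (K * (t - s))"
  shows "mean_osc F s t \<le> 2 * K"
proof -
  define f where "f x = boundary_value F (circ x)" for x
  define m where "m = arc_mean F s t"
  have [measurable]: "f \<in> borel_measurable borel" unfolding f_def [abs_def] by measurable
  define g where "g x = indicator {s..t} x *\<^sub>R (f x - c)" for x
  have gm [measurable]: "g \<in> borel_measurable borel" unfolding g_def by measurable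
  have g_nn: "(\<integral>\<^sup>+x. ennreal (norm (g x)) \<partial>lborel) \<le> ennreal (K * (t - s))"
  proof -
    have "ennreal (norm (g x)) = ennreal (norm (boundary_value F (circ x) - c)) * indicator {s..t} x" for x
      by (simp add: g_def f_def split: split_indicator)
    then show ?thesis using le by simp
  qed
  have g: "integrable lborel g"
    using g_nn by (intro integrableI_bounded) (auto intro: le_less_trans)
  have ng: "(LINT x|lborel. norm (g x)) \<le> K * (t - s)"
    using g_nn K st by (subst integral_eq_nn_integral) (auto intro!: enn2real_leI)
  have ci: "integrable lborel (\<lambda>x. indicator {s..t} x *\<^sub>R d)" for d :: complex
    by (rule borel_integrable_compact) auto
  have ci': "(LINT x|lborel. indicator {s..t} x *\<^sub>R d) = of_real (t - s) * d" for d :: complex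
    using st by (simp add: scaleR_conv_of_real)
  have "(LINT x:{s..t}|lborel. f x) = (LINT x|lborel. g x + indicator {s..t} x *\<^sub>R c)"
    unfolding set_lebesgue_integral_def g_def by (intro Bochner_Integration.integral_cong) (auto simp: algebra_simps)
  also have "\<dots> = (LINT x|lborel. g x) + of_real (t - s) * c"
    by (simp only: Bochner_Integration.integral_add [OF g ci] ci')
  finally have "m = of_real (1 / (t - s)) * ((LINT x|lborel. g x) + of_real (t - s) * c)"
    unfolding m_def arc_mean_def f_def by simp
  then have "of_real (t - s) * (m - c) = (LINT x|lborel. g x)"
    using st by (simp add: field_simps)
  then have "norm (LINT x|lborel. g x) = (t - s) * norm (m - c)"
    using st by (metis abs_of_pos diff_gt_0_iff_gt norm_mult norm_of_real)
  moreover have "norm (LINT x|lborel. g x) \<le> (LINT x|lborel. norm (g x))" by simp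
  ultimately have mc: "(t - s) * norm (m - c) \<le> K * (t - s)" using ng by linarith
  have "(LINT x:{s..t}|lborel. norm (f x - m)) \<le> (LINT x|lborel. norm (g x) + norm (indicator {s..t} x *\<^sub>R (m - c)))"
    unfolding set_lebesgue_integral_def
  proof (rule integral_mono')
    show "integrable lborel (\<lambda>x. norm (g x) + norm (indicator {s..t} x *\<^sub>R (m - c)))"
      by (intro Bochner_Integration.integrable_add integrable_norm g ci)
    fix x
    have "norm (f x - m) \<le> norm (f x - c) + norm (m - c)"
      using norm_triangle_ineq4 [of "f x - c" "m - c"] by simp
    then show "indicator {s..t} x *\<^sub>R norm (f x - m) \<le> norm (g x) + norm (indicator {s..t} x *\<^sub>R (m - c))"
      by (simp add: g_def split: split_indicator)
  qed auto
  also have "\<dots> = (LINT x|lborel. norm (g x)) + (t - s) * norm (m - c)"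
    using g ci st by (subst Bochner_Integration.integral_add) auto
  also have "\<dots> \<le> 2 * K * (t - s)" using ng mc by simp
  finally have "(LINT x:{s..t}|lborel. norm (f x - m)) \<le> 2 * K * (t - s)" .
  then show ?thesis
    using st unfolding mean_osc_def f_def m_def by (simp add: field_simps)
qed

subsection \<open>Boundary values\<close>

text \<open>Measurability has to be proved for the actual radial limit, since \<^const>\<open>mean_osc\<close> uses
  Borel integrals: changing the boundary values on a null set could destroy measurability.\<close>

lemma borel_measurable_boundary_value:
  assumes F: "continuous_on (ball 0 1) F"
  shows "(\<lambda>x. boundary_value F (circ x)) \<in> borel_measurable borel"
proof -
  \<comment> \<open>Along a fixed sequence of radii the limit \<open>L\<close> is measurable, and it
    equals the radial limit wherever that exists.\<close>
  define r where "r n = 1 - 1 / real (n + 2)" for n :: nat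
  have r01: "0 < r n" "r n < 1" for n by (auto simp: r_def field_simps)
  have rlim: "filterlim r (at_left 1) sequentially"
    unfolding filterlim_at
  proof
    show "eventually (\<lambda>n. r n \<in> {..<1} \<and> r n \<noteq> 1) sequentially"
      using r01 by (auto intro!: always_eventually simp: less_imp_neq)
    have "(\<lambda>n. 1 / real (n + 2)) \<longlonglongrightarrow> 0"
      using LIMSEQ_ignore_initial_segment [OF lim_1_over_n, of 2] by simp
    then show "r \<longlonglongrightarrow> 1" unfolding r_def using tendsto_diff [OF tendsto_const] by fastforce
  qed
  define h where "h q x = F (of_real q * circ x)" for q x :: real
  have hm [measurable]: "h q \<in> borel_measurable borel" if "q \<in> {0<..<1}" for q
  proof -
    have "continuous_on UNIV (h q)" unfolding h_def
      by (rule continuous_on_compose2 [OF F]) (use that in \<open>auto intro!: continuous_intros simp: norm_mult\<close>)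
    then show ?thesis by (rule borel_measurable_continuous_onI)
  qed
  have hc: "continuous_on {0<..<1} (\<lambda>q. h q x)" for x
    unfolding h_def by (rule continuous_on_compose2 [OF F]) (auto intro!: continuous_intros simp: norm_mult)
  define Q where "Q = \<rat> \<inter> {0<..<1::real}"
  have Qc: "countable Q" unfolding Q_def by (intro countable_Int1 countable_rat)
  define L where "L x = lim (\<lambda>n. h (r n) x)" for x
  have Lm [measurable]: "L \<in> borel_measurable borel"
    unfolding L_def by (rule borel_measurable_lim_metric) (use r01 in \<open>auto intro!: hm\<close>)
  have L_eq: "L x = l" if "((\<lambda>q. h q x) \<longlongrightarrow> l) (at_left 1)" for x l
    unfolding L_def by (rule limI) (rule filterlim_compose [OF that rlim])
  \<comment> \<open>Existence of the radial limit as a countable condition: rational radii suffice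
    because \<open>h q x\<close> is continuous in \<open>q\<close>.\<close>
  define C where "C x \<longleftrightarrow> (\<forall>n. \<exists>m. \<forall>q\<in>Q. norm (h q x - L x) \<le> 1 / Suc n \<or> q \<le> 1 - 1 / Suc m)" for x
  have Cm: "Measurable.pred borel C"
  proof -
    have "Measurable.pred borel (\<lambda>x. norm (h q x - L x) \<le> 1 / Suc n \<or> q \<le> 1 - 1 / Suc m)" if "q \<in> Q" for q and m n :: nat
    proof -
      have [measurable]: "h q \<in> borel_measurable borel"
        using that by (auto intro!: hm simp: Q_def)
      show ?thesis by measurable
    qed
    then have "Measurable.pred borel (\<lambda>x. \<forall>q\<in>Q. norm (h q x - L x) \<le> 1 / Suc n \<or> q \<le> 1 - 1 / Suc m)" for m n :: nat
      unfolding pred_def by (intro sets.sets_Collect_countable_All' Qc) auto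
    then show ?thesis unfolding C_def
      by (intro pred_intros_countable)
  qed
  have C_iff: "C x \<longleftrightarrow> (\<exists>l. ((\<lambda>q. h q x) \<longlongrightarrow> l) (at_left 1))" for x
  proof
    assume "\<exists>l. ((\<lambda>q. h q x) \<longlongrightarrow> l) (at_left 1)"
    then have l: "((\<lambda>q. h q x) \<longlongrightarrow> L x) (at_left 1)" using L_eq by metis
    show "C x" unfolding C_def
    proof
      fix n
      have "eventually (\<lambda>q. dist (h q x) (L x) < 1 / Suc n) (at_left 1)"
        using l by (rule tendstoD) simp
      then obtain b where b: "b < 1" "\<And>q. b < q \<Longrightarrow> q < 1 \<Longrightarrow> dist (h q x) (L x) < 1 / Suc n"
        unfolding eventually_at_left_field by auto
      obtain m where m: "1 / real (Suc m) < 1 - b" using nat_approx_posE [of "1 - b"] b(1) by auto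
      have "norm (h q x - L x) \<le> 1 / Suc n" if "q \<in> Q" "\<not> q \<le> 1 - 1 / Suc m" for q
        using b(2) [of q] m that by (auto simp: Q_def dist_norm)
      then show "\<exists>m. \<forall>q\<in>Q. norm (h q x - L x) \<le> 1 / Suc n \<or> q \<le> 1 - 1 / Suc m"
        by blast
    qed
  next
    assume C: "C x"
    have "((\<lambda>q. h q x) \<longlongrightarrow> L x) (at_left 1)"
    proof (rule tendstoI)
      fix e :: real assume "e > 0"
      then obtain n where n: "1 / real (Suc n) < e" using nat_approx_posE by metis
      obtain m where m: "\<And>q. q \<in> Q \<Longrightarrow> norm (h q x - L x) \<le> 1 / Suc n \<or> q \<le> 1 - 1 / Suc m"
        using C unfolding C_def by blast
      define U where "U = {1 - 1 / real (Suc m)<..<1}"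
      have "dist (h p x) (L x) < e" if p: "p \<in> U" for p
      proof -
        have "0 \<le> 1 - 1 / real (Suc m)" by (simp add: field_simps)
        then have U: "open U" "U \<subseteq> {0<..<1}"
          unfolding U_def by (simp_all only: open_greaterThanLessThan greaterThanLessThan_subseteq_greaterThanLessThan) simp
        have "p \<in> closure (U \<inter> \<rat>)"
          using open_Int_closure_subset [OF U(1), of "\<rat>"] p by (auto simp: Rats_closure_real)
        then obtain y where y: "\<And>k. y k \<in> U \<inter> \<rat>" "y \<longlonglongrightarrow> p"
          unfolding closure_sequential by blast
        have "p \<in> {0<..<1}" using p U by blast
        then have "isCont (\<lambda>q. h q x) p"
          using continuous_on_interior [OF hc] by simp
        then have "(\<lambda>k. norm (h (y k) x - L x)) \<longlonglongrightarrow> norm (h p x - L x)"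
          by (intro tendsto_intros isCont_tendsto_compose [OF _ y(2)])
        moreover have "norm (h (y k) x - L x) \<le> 1 / Suc n" for k
          using m [of "y k"] y(1) [of k] U by (auto simp: Q_def U_def)
        ultimately have "norm (h p x - L x) \<le> 1 / Suc n"
          by (intro LIMSEQ_le_const2) auto
        then show ?thesis using n by (simp add: dist_norm)
      qed
      then show "eventually (\<lambda>q. dist (h q x) (L x) < e) (at_left 1)"
        unfolding eventually_at_left_field U_def by (intro exI [of _ "1 - 1 / real (Suc m)"]) auto
    qed
    then show "\<exists>l. ((\<lambda>q. h q x) \<longlongrightarrow> l) (at_left 1)" by blast
  qed
  \<comment> \<open>Where no limit exists, \<open>Lim\<close> is a description by an unsatisfiable
    predicate, hence the same constant at all such points; this makes the piecewise formula
    measurable.\<close>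
  have "boundary_value F (circ x) = (if C x then L x else (THE l::complex. False))" for x
  proof (cases "C x")
    case True
    then obtain l where l: "((\<lambda>q. h q x) \<longlongrightarrow> l) (at_left 1)" using C_iff by blast
    then have "boundary_value F (circ x) = l"
      unfolding boundary_value_def h_def by (intro tendsto_Lim) auto
    then show ?thesis using True L_eq [OF l] by simp
  next
    case False
    then have "\<not> ((\<lambda>q. F (of_real q * circ x)) \<longlongrightarrow> l) (at_left 1)" for l
      using C_iff unfolding h_def by blast
    then show ?thesis using False by (simp add: boundary_value_def t2_space_class.Lim_def)
  qed
  then show ?thesis using Cm by simp
qed

text \<open>The Cauchy product with the geometric series writes the error as an average of the tails.\<close>

theorem Abel_radial_limit:
  fixes a :: "nat \<Rightarrow> complex"
  assumes "summable a"
  shows "((\<lambda>r. \<Sum>n. a n * of_real r ^ n) \<longlongrightarrow> (\<Sum>n. a n)) (at_left (1::real))"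
proof (rule tendstoI)
  fix e :: real assume "e > 0"
  define S where "S n = (\<Sum>i\<le>n. a i)" for n
  define A where "A r = (\<Sum>n. a n * of_real r ^ n)" for r :: real
  define s where "s = (\<Sum>n. a n)"
  have "S \<longlonglongrightarrow> s" unfolding S_def s_def using assms by (rule summable_LIMSEQ')
  then have "eventually (\<lambda>n. dist (S n) s < e / 2) sequentially"
    using \<open>e > 0\<close> by (intro tendstoD) auto
  then obtain N where N: "\<And>n. n \<ge> N \<Longrightarrow> norm (S n - s) \<le> e / 2"
    unfolding eventually_sequentially dist_norm by (meson less_imp_le)
  define K where "K = (\<Sum>n<N. norm (S n - s))"
  obtain B where B: "\<And>n. norm (a n) \<le> B"
    using summable_imp_bounded [OF assms] unfolding bounded_iff by auto
  have bound: "norm (A r - s) \<le> (1 - r) * K + e / 2" if r: "0 < r" "r < 1" for r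
  proof -
    define z where "z = complex_of_real r"
    have z: "norm z < 1" "norm z = r" using r by (simp_all add: z_def)
    have "summable (\<lambda>n. B * r ^ n)" using r by (intro summable_mult summable_geometric) auto
    then have sA: "summable (\<lambda>n. norm (a n * z ^ n))"
      by (rule summable_comparison_test' [where N = 0]) (use r in \<open>simp add: norm_mult norm_power z(2) B mult_right_mono\<close>)
    \<comment> \<open>Multiplication by the geometric series turns coefficients into partial sums,
      so \<open>A r - s\<close> is \<open>1 - z\<close> times the series of
      \<open>(S k - s) * z ^ k\<close>.\<close>
    have "(\<lambda>k. \<Sum>i\<le>k. (a i * z ^ i) * z ^ (k - i)) sums ((\<Sum>k. a k * z ^ k) * (\<Sum>k. z ^ k))"
      using z r by (intro Cauchy_product_sums sA) (simp add: norm_power summable_geometric)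
    moreover have "(\<Sum>i\<le>k. (a i * z ^ i) * z ^ (k - i)) = S k * z ^ k" for k
      unfolding S_def sum_distrib_right by (intro sum.cong) (auto simp: mult.assoc simp flip: power_add)
    ultimately have "(\<lambda>k. S k * z ^ k) sums (A r * (1 / (1 - z)))"
      using z by (simp add: suminf_geometric A_def z_def)
    moreover have "(\<lambda>k. s * z ^ k) sums (s * (1 / (1 - z)))"
      using z by (intro sums_mult geometric_sums)
    ultimately have "(\<lambda>k. S k * z ^ k - s * z ^ k) sums (A r * (1 / (1 - z)) - s * (1 / (1 - z)))"
      by (rule sums_diff)
    then have D: "(\<lambda>k. (S k - s) * z ^ k) sums ((A r - s) * (1 / (1 - z)))"
      by (simp add: left_diff_distrib diff_divide_distrib)
    have "(\<lambda>k. if k \<in> {..<N} then norm (S k - s) else 0) sums K"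
      unfolding K_def by (rule sums_If_finite_set) simp
    then have E: "(\<lambda>k. (if k \<in> {..<N} then norm (S k - s) else 0) + e / 2 * r ^ k) sums (K + e / 2 * (1 / (1 - r)))"
      using r by (intro sums_add sums_mult geometric_sums) auto
    \<comment> \<open>Below \<open>N\<close> the factor \<open>r ^ k\<close> is dropped; from
      \<open>N\<close> on the difference is at most \<open>e / 2\<close>. After multiplication by
      \<open>1 - r\<close> the first part vanishes as \<open>r\<close> tends to 1 and the second
      stays at \<open>e / 2\<close>.\<close>
    have le: "norm ((S k - s) * z ^ k) \<le> (if k \<in> {..<N} then norm (S k - s) else 0) + e / 2 * r ^ k" for k
    proof -
      have eq: "norm ((S k - s) * z ^ k) = norm (S k - s) * r ^ k"
        by (simp add: norm_mult norm_power z(2))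
      have "0 \<le> e / 2 * r ^ k" "norm (S k - s) * r ^ k \<le> norm (S k - s)"
        using r \<open>e > 0\<close> by (simp_all add: mult_right_le_one_le power_le_one)
      moreover have "norm (S k - s) * r ^ k \<le> e / 2 * r ^ k" if "\<not> k < N"
        using N [of k] that r by (intro mult_right_mono) auto
      ultimately show ?thesis unfolding eq by simp
    qed
    have "norm ((A r - s) * (1 / (1 - z))) \<le> K + e / 2 * (1 / (1 - r))"
      unfolding sums_unique [OF D] sums_unique [OF E] by (rule norm_suminf_le [OF le sums_summable [OF E]])
    moreover have "norm (1 - z) = 1 - r"
    proof -
      have "1 - z = of_real (1 - r)" by (simp add: z_def)
      then show ?thesis using r by (simp only: norm_of_real)
    qed
    ultimately have "norm (A r - s) / (1 - r) \<le> K + e / 2 * (1 / (1 - r))"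
      by (simp add: norm_mult norm_divide)
    moreover define q where "q = 1 - r"
    ultimately have "norm (A r - s) / q \<le> K + e / 2 * (1 / q)" by simp
    moreover have q: "q > 0" using r by (simp add: q_def)
    ultimately have "norm (A r - s) \<le> (K + e / 2 * (1 / q)) * q" by (simp only: pos_divide_le_eq)
    also have "\<dots> = q * K + e / 2" using q by (simp add: field_simps)
    finally show ?thesis by (simp add: q_def)
  qed
  have "((\<lambda>r. (1 - r) * K + e / 2) \<longlongrightarrow> (1 - 1) * K + e / 2) (at_left 1)"
    by (intro tendsto_intros)
  then have "eventually (\<lambda>r. (1 - r) * K + e / 2 < e) (at_left 1)"
    by (rule order_tendstoD(2)) (use \<open>e > 0\<close> in simp)
  moreover have "eventually (\<lambda>r. r \<in> {0<..<1::real}) (at_left 1)"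
    by (rule eventually_at_leftI [of 0]) auto
  ultimately show "eventually (\<lambda>r. dist (\<Sum>n. a n * of_real r ^ n) (\<Sum>n. a n) < e) (at_left 1)"
  proof eventually_elim
    case (elim r)
    then show ?case using bound [of r] by (simp add: dist_norm A_def s_def)
  qed
qed

subsection \<open>A criterion for vanishing mean oscillation\<close>

lemma square_summable_power_series_summable:
  fixes c :: "nat \<Rightarrow> complex"
  assumes "summable (\<lambda>n. (norm (c n))\<^sup>2)" "norm z < 1"
  shows "summable (\<lambda>n. c n * z ^ n)"
proof -
  have "(\<lambda>n. (norm (c n))\<^sup>2) \<longlonglongrightarrow> 0" using assms(1) by (rule summable_LIMSEQ_zero)
  then have "Bseq (\<lambda>n. (norm (c n))\<^sup>2)" by (intro convergent_imp_Bseq convergentI)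
  then obtain B where B: "\<And>n. (norm (c n))\<^sup>2 \<le> B" unfolding Bseq_def by auto
  have cB: "norm (c n) \<le> B + 1" for n
  proof -
    have "0 \<le> (norm (c n) - 1)\<^sup>2 + (norm (c n))\<^sup>2" by simp
    then have "2 * norm (c n) \<le> 2 * (norm (c n))\<^sup>2 + 1" by (simp add: power2_eq_square algebra_simps)
    then show ?thesis using B [of n] by simp
  qed
  have "summable (\<lambda>n. (B + 1) * norm z ^ n)" using assms(2) by (intro summable_mult summable_geometric) auto
  then show ?thesis
    by (rule summable_comparison_test' [where N = 0]) (simp add: norm_mult norm_power cB mult_right_mono)
qed

text \<open>Parseval on the circle of radius \<open>r\<close> bounds the mean squares of the partial
  sums independently of \<open>r\<close>. Fatou and Cauchy-Schwarz turn this into the uniform bound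
  on the integral means of \<open>F\<close>.\<close>

lemma hardy1_power_series:
  fixes c :: "nat \<Rightarrow> complex"
  assumes l2: "summable (\<lambda>n. (norm (c n))\<^sup>2)"
  shows "(\<lambda>z. \<Sum>n. c n * z ^ n) \<in> hardy1"
proof -
  define F where "F z = (\<Sum>n. c n * z ^ n)" for z
  have F: "(\<lambda>n. c n * z ^ n) sums F z" if "norm z < 1" for z
    unfolding F_def by (rule summable_sums [OF square_summable_power_series_summable [OF l2 that]])
  have hol: "F holomorphic_on ball 0 1"
    by (rule power_series_holomorphic [where a = c]) (use F in auto)
  \<comment> \<open>The added 1 makes \<open>sqrt V\<close> positive, as
    \<open>nn_integral_le_of_square\<close> demands.\<close>
  define V where "V = (\<Sum>n. (norm (c n))\<^sup>2) + 1"
  have V: "(\<Sum>k<n. (norm (c k))\<^sup>2) \<le> V" for n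
    unfolding V_def using sum_le_suminf [OF l2, of "{..<n}"] by simp
  have Vpos: "V > 0" unfolding V_def using suminf_nonneg [OF l2] by simp
  have le: "(LINT \<theta>:{0..1}|lborel. norm (F (of_real r * circ \<theta>))) \<le> sqrt V" if r: "r \<in> {0..<1}" for r
  proof -
    define g where "g n \<theta> = (\<Sum>k<n. (c k * of_real r ^ k) * circ (of_nat k * \<theta>))" for n \<theta>
    have lim: "(\<lambda>n. g n \<theta>) \<longlonglongrightarrow> F (of_real r * circ \<theta>)" for \<theta>
    proof -
      have "(\<lambda>n. \<Sum>k<n. c k * (of_real r * circ \<theta>) ^ k) \<longlonglongrightarrow> F (of_real r * circ \<theta>)"
        using F [of "of_real r * circ \<theta>"] r by (simp add: norm_mult sums_def)
      then show ?thesis by (simp add: g_def circ_mult_nat power_mult_distrib mult.assoc)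
    qed
    have [measurable]: "g n \<in> borel_measurable borel" for n unfolding g_def by measurable
    have Fm [measurable]: "(\<lambda>\<theta>. F (of_real r * circ \<theta>)) \<in> borel_measurable borel"
      by (rule borel_measurable_LIMSEQ_metric [OF _ lim]) measurable
    have "(\<integral>\<^sup>+\<theta>\<in>{0..1}. ennreal ((norm (g n \<theta>))\<^sup>2) \<partial>lborel) \<le> ennreal V" for n
    proof -
      have "(\<integral>\<^sup>+\<theta>\<in>{0..1}. ennreal ((norm (g n \<theta>))\<^sup>2) \<partial>lborel) = ennreal (\<Sum>k<n. (norm (c k * of_real r ^ k))\<^sup>2)"
        unfolding g_def using parseval_trig_polynomial [where a = 0 and b = "\<lambda>k. c k * of_real r ^ k" and m = n] by simp
      also have "\<dots> \<le> ennreal (\<Sum>k<n. (norm (c k))\<^sup>2)"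
        using r by (intro ennreal_leI sum_mono power_mono) (auto simp: norm_mult norm_power power_le_one mult_right_le_one_le)
      also have "\<dots> \<le> ennreal V" by (intro ennreal_leI V)
      finally show ?thesis .
    qed
    then have "(\<integral>\<^sup>+\<theta>\<in>{0..1}. ennreal ((norm (F (of_real r * circ \<theta>)))\<^sup>2) \<partial>lborel) \<le> ennreal V"
      by (intro nn_integral_square_limit_le [where g = g]) (auto simp: lim)
    then have "(\<integral>\<^sup>+\<theta>\<in>{0..1}. ennreal (norm (F (of_real r * circ \<theta>))) \<partial>lborel) \<le> ennreal (sqrt V * (1 - 0))"
      using Vpos by (intro nn_integral_le_of_square) auto
    moreover have "(\<integral>\<^sup>+\<theta>\<in>{0..1}. ennreal (norm (F (of_real r * circ \<theta>))) \<partial>lborel)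
        = (\<integral>\<^sup>+\<theta>. ennreal (indicator {0..1} \<theta> *\<^sub>R norm (F (of_real r * circ \<theta>))) \<partial>lborel)"
      by (intro nn_integral_cong) (auto split: split_indicator)
    ultimately show ?thesis
      unfolding set_lebesgue_integral_def using Vpos
      by (subst integral_eq_nn_integral) (auto intro!: enn2real_leI)
  qed
  show ?thesis
    unfolding hardy1_def F_def [symmetric] using hol le by (auto intro!: bdd_aboveI [of _ "sqrt V"])
qed

text \<open>The sum in the hypothesis is the derivative divided by \<open>2 * pi * \<i>\<close>. By
  the fundamental theorem of calculus an integral bound on it controls all increments from the left
  endpoint.\<close>

lemma norm_trig_polynomial_diff_le:
  fixes c :: "nat \<Rightarrow> complex"
  assumes xy: "s \<le> x" "x \<le> t"
    and V: "(\<integral>\<^sup>+u\<in>{s..t}. ennreal (norm (\<Sum>k<n. of_nat k * c k * circ (of_nat k * u))) \<partial>lborel) \<le> ennreal V" "V \<ge> 0"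
  shows "norm ((\<Sum>k<n. c k * circ (of_nat k * x)) - (\<Sum>k<n. c k * circ (of_nat k * s))) \<le> 2 * pi * V"
proof -
  define D where "D u = (\<Sum>k<n. of_nat k * c k * circ (of_nat k * u))" for u
  define P where "P u = (\<Sum>k<n. c k * circ (of_nat k * u))" for u
  have der: "(P has_vector_derivative (2 * of_real pi * \<i>) * D u) (at u within A)" for u A
  proof -
    have "(P has_vector_derivative (\<Sum>k<n. c k * (2 * of_real pi * \<i> * of_real (real k) * circ (real k * u)))) (at u within A)"
      unfolding P_def
      by (intro has_vector_derivative_sum has_vector_derivative_mult_right circ_has_vector_derivative)
    also have "(\<Sum>k<n. c k * (2 * of_real pi * \<i> * of_real (real k) * circ (real k * u)))
        = (2 * of_real pi * \<i>) * D u"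
      unfolding D_def sum_distrib_left by (intro sum.cong) (simp_all add: mult_ac)
    finally show ?thesis .
  qed
  have Dc: "continuous_on A D" for A unfolding D_def by (intro continuous_intros)
  have Dm [measurable]: "D \<in> borel_measurable borel" using Dc by (rule borel_measurable_continuous_onI)
  define H where "H u = indicator {s..x} u *\<^sub>R ((2 * of_real pi * \<i>) * D u)" for u
  have Hm [measurable]: "H \<in> borel_measurable borel" unfolding H_def by measurable
  have "(LBINT u. H u) = P x - P s"
    unfolding H_def
  proof (rule integral_FTC_Icc [OF xy(1) der])
    show "continuous_on {s..x} (\<lambda>u. (2 * of_real pi * \<i>) * D u)"
      by (intro continuous_on_mult continuous_on_const Dc)
  qed
  then have "norm (P x - P s) \<le> (LBINT u. norm (H u))"
    using integral_norm_bound [of lborel H] by simp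
  also have "\<dots> \<le> 2 * pi * V"
  proof -
    have "(\<integral>\<^sup>+u. ennreal (norm (H u)) \<partial>lborel)
       \<le> (\<integral>\<^sup>+u. ennreal (2 * pi) * (ennreal (norm (D u)) * indicator {s..t} u) \<partial>lborel)"
    proof (rule nn_integral_mono)
      fix u
      show "ennreal (norm (H u)) \<le> ennreal (2 * pi) * (ennreal (norm (D u)) * indicator {s..t} u)"
      proof (cases "u \<in> {s..x}")
        case True
        then have "u \<in> {s..t}" using xy by auto
        moreover have "norm (H u) = 2 * pi * norm (D u)" using True by (simp add: H_def norm_mult)
        ultimately show ?thesis by (simp add: ennreal_mult)
      qed (simp add: H_def)
    qed
    also have "\<dots> = ennreal (2 * pi) * (\<integral>\<^sup>+u\<in>{s..t}. ennreal (norm (D u)) \<partial>lborel)"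
      by (rule nn_integral_cmult) measurable
    also have "\<dots> \<le> ennreal (2 * pi) * ennreal V"
      using V(1) unfolding D_def by (rule mult_left_mono) simp
    also have "\<dots> = ennreal (2 * pi * V)" using V(2) by (simp add: ennreal_mult)
    finally have "enn2real (\<integral>\<^sup>+u. ennreal (norm (H u)) \<partial>lborel) \<le> 2 * pi * V"
      using V(2) by (intro enn2real_leI) auto
    then show ?thesis by (subst integral_eq_nn_integral) auto
  qed
  finally show ?thesis by (simp add: P_def)
qed

text \<open>On an interval shorter than \<open>2 ^ - (m + 2)\<close>, \<open>f\<close> is compared with the partial sum at the scale
  of the interval; both this partial sum and \<open>p m\<close> are nearly constant there.\<close>

lemma local_oscillation_le:
  fixes c :: "nat \<Rightarrow> complex" and f :: "real \<Rightarrow> complex" and \<sigma> :: real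
  defines "p \<equiv> \<lambda>j x. \<Sum>k<2 ^ j. c k * circ (of_nat k * x)"
  assumes [measurable]: "f \<in> borel_measurable borel"
    and \<sigma>: "\<sigma> \<ge> 0" and st: "s < t"
    and high: "\<And>j (i::int). j \<ge> m \<Longrightarrow>
      (\<integral>\<^sup>+x\<in>{of_int i / 2 ^ (j + 2)..(of_int i + 1) / 2 ^ (j + 2)}. ennreal (norm (f x - p j x)) \<partial>lborel)
        \<le> ennreal (\<sigma> / 2 ^ (j + 2))"
    and low: "\<And>j (i::int). j \<ge> m \<Longrightarrow>
      (\<integral>\<^sup>+x\<in>{of_int i / 2 ^ (j + 2)..(of_int i + 1) / 2 ^ (j + 2)}.
          ennreal (norm (\<Sum>k<2 ^ j. of_nat k * c k * circ (of_nat k * x))) \<partial>lborel) \<le> ennreal \<sigma>"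
  shows "\<exists>d. (\<integral>\<^sup>+x\<in>{s..t}. ennreal (norm (f x - p m x - d)) \<partial>lborel) \<le> ennreal (60 * \<sigma> * (t - s))"
proof -
  have [measurable]: "p j \<in> borel_measurable borel" for j unfolding p_def by measurable
  have high': "(\<integral>\<^sup>+x\<in>{s..t}. ennreal (norm (f x - p j x)) \<partial>lborel) \<le> ennreal (3 * \<sigma> * (t - s))"
    if "j \<ge> m" "1 \<le> 2 ^ (j + 2) * (t - s)" for j
  proof -
    have "(\<integral>\<^sup>+x\<in>{s..t}. ennreal (norm (f x - p j x)) \<partial>lborel)
        \<le> ennreal ((2 ^ (j + 2) * (t - s) + 2) * (\<sigma> / 2 ^ (j + 2)))"
      by (rule nn_integral_cover_grid [OF _ _ _ _ high]) (use \<sigma> st that in auto)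
    \<comment> \<open>The two extra cells of the covering are absorbed, since here
      \<open>2 \<le> 2 * (2 ^ (j + 2) * (t - s))\<close>.\<close>
    also have "\<dots> \<le> ennreal ((3 * (2 ^ (j + 2) * (t - s))) * (\<sigma> / 2 ^ (j + 2)))"
    proof (intro ennreal_leI mult_right_mono)
      show "2 ^ (j + 2) * (t - s) + 2 \<le> 3 * (2 ^ (j + 2) * (t - s))" using that(2) by linarith
    qed (use \<sigma> in auto)
    also have "(3 * (2 ^ (j + 2) * (t - s))) * (\<sigma> / 2 ^ (j + 2)) = 3 * \<sigma> * (t - s)"
      by simp
    finally show ?thesis .
  qed
  have low': "norm (p j x - p j s) \<le> 2 * pi * ((2 ^ (j + 2) * (t - s) + 2) * \<sigma>)"
    if "j \<ge> m" "x \<in> {s..t}" for j x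
    unfolding p_def
  proof (rule norm_trig_polynomial_diff_le [where t = t])
    show "(\<integral>\<^sup>+u\<in>{s..t}. ennreal (norm (\<Sum>k<2 ^ j. of_nat k * c k * circ (of_nat k * u))) \<partial>lborel)
        \<le> ennreal ((2 ^ (j + 2) * (t - s) + 2) * \<sigma>)"
      by (rule nn_integral_cover_grid [OF _ _ _ _ low]) (use \<sigma> st that in auto)
  qed (use that \<sigma> st in auto)
  show ?thesis
  proof (cases "1 \<le> 2 ^ (m + 2) * (t - s)")
    case True
    have "(\<integral>\<^sup>+x\<in>{s..t}. ennreal (norm (f x - p m x)) \<partial>lborel) \<le> ennreal (3 * \<sigma> * (t - s))"
      by (rule high' [OF order_refl True])
    also have "\<dots> \<le> ennreal (60 * \<sigma> * (t - s))"
      using \<sigma> st by (intro ennreal_leI mult_right_mono) auto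
    finally show ?thesis by (intro exI [of _ 0]) simp
  next
    case False
    \<comment> \<open>\<open>J\<close> is the coarsest scale whose cells are no longer than the
      interval. Minimality gives \<open>1 \<le> 2 ^ (J + 2) * (t - s) \<le> 2\<close>, so boundedly
      many of its cells cover the interval.\<close>
    define J where "J = (LEAST j. 1 \<le> 2 ^ (j + 2) * (t - s))"
    have "\<exists>j. 1 \<le> 2 ^ (j + 2) * (t - s)"
    proof -
      obtain j where "1 / (t - s) < 2 ^ j" using real_arch_pow [of 2 "1 / (t - s)"] by auto
      then have "1 \<le> 2 ^ j * (t - s)" using st by (simp add: field_simps)
      also have "\<dots> \<le> 2 ^ (j + 2) * (t - s)" using st by (intro mult_right_mono power_increasing) auto
      finally show ?thesis by blast
    qed
    then have J1: "1 \<le> 2 ^ (J + 2) * (t - s)" unfolding J_def by (rule LeastI_ex)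
    have "m < J"
    proof (rule ccontr)
      assume "\<not> m < J"
      then have "2 ^ (J + 2) * (t - s) \<le> 2 ^ (m + 2) * (t - s)"
        using st by (intro mult_right_mono power_increasing) auto
      then show False using J1 False by simp
    qed
    then obtain j where j: "J = Suc j" "j \<ge> m" by (metis Suc_le_D Suc_leI Suc_le_mono)
    have "\<not> 1 \<le> 2 ^ (j + 2) * (t - s)" using not_less_Least [of j "\<lambda>j. 1 \<le> 2 ^ (j + 2) * (t - s)"] j(1)
      by (simp add: J_def)
    moreover have "2 ^ (J + 2) * (t - s) = 2 * (2 ^ (j + 2) * (t - s))" using j(1) by simp
    ultimately have J2: "2 ^ (J + 2) * (t - s) \<le> 2" by linarith
    \<comment> \<open>The value of \<open>p J - p m\<close> at the left endpoint, so that
      \<open>f - p m - d\<close> is \<open>f - p J\<close> plus two increments from this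
      endpoint.\<close>
    define d where "d = p J s - p m s"
    have "(\<integral>\<^sup>+x\<in>{s..t}. ennreal (norm (f x - p m x - d)) \<partial>lborel)
        \<le> (\<integral>\<^sup>+x. ennreal (norm (f x - p J x)) * indicator {s..t} x + ennreal (14 * pi * \<sigma>) * indicator {s..t} x \<partial>lborel)"
    proof (rule nn_integral_mono)
      fix x :: real
      show "ennreal (norm (f x - p m x - d)) * indicator {s..t} x
         \<le> ennreal (norm (f x - p J x)) * indicator {s..t} x + ennreal (14 * pi * \<sigma>) * indicator {s..t} x"
      proof (cases "x \<in> {s..t}")
        case True
        have "norm (p J x - p J s) \<le> 2 * pi * ((2 ^ (J + 2) * (t - s) + 2) * \<sigma>)"
          by (rule low') (use True j in auto)
        also have "\<dots> \<le> 2 * pi * (4 * \<sigma>)"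
        proof -
          have "2 ^ (J + 2) * (t - s) + 2 \<le> 4" using J2 by linarith
          then show ?thesis using \<sigma> by (intro mult_left_mono mult_right_mono) simp_all
        qed
        finally have 1: "norm (p J x - p J s) \<le> 2 * pi * (4 * \<sigma>)" .
        have "norm (p m x - p m s) \<le> 2 * pi * ((2 ^ (m + 2) * (t - s) + 2) * \<sigma>)"
          by (rule low') (use True in auto)
        also have "\<dots> \<le> 2 * pi * (3 * \<sigma>)"
        proof -
          have "2 ^ (m + 2) * (t - s) + 2 \<le> 3" using False by linarith
          then show ?thesis using \<sigma> by (intro mult_left_mono mult_right_mono) simp_all
        qed
        finally have 2: "norm (p m x - p m s) \<le> 2 * pi * (3 * \<sigma>)" .
        have eq: "f x - p m x - d = (f x - p J x) + ((p J x - p J s) - (p m x - p m s))" by (simp add: d_def)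
        have "norm (f x - p m x - d) \<le> norm (f x - p J x) + norm ((p J x - p J s) - (p m x - p m s))"
          unfolding eq by (rule norm_triangle_ineq)
        moreover have "norm ((p J x - p J s) - (p m x - p m s)) \<le> norm (p J x - p J s) + norm (p m x - p m s)"
          by (rule norm_triangle_ineq4)
        ultimately have "norm (f x - p m x - d) \<le> norm (f x - p J x) + 14 * pi * \<sigma>" using 1 2 by linarith
        then have "ennreal (norm (f x - p m x - d)) \<le> ennreal (norm (f x - p J x) + 14 * pi * \<sigma>)"
          by (rule ennreal_leI)
        also have "\<dots> = ennreal (norm (f x - p J x)) + ennreal (14 * pi * \<sigma>)"
          using \<sigma> by (intro ennreal_plus) auto
        finally show ?thesis using True by simp
      qed simp
    qed
    also have "\<dots> = (\<integral>\<^sup>+x\<in>{s..t}. ennreal (norm (f x - p J x)) \<partial>lborel) + ennreal (14 * pi * \<sigma>) * ennreal (t - s)"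
      using st by (subst nn_integral_add) (auto simp: nn_integral_cmult_indicator)
    also have "\<dots> \<le> ennreal (3 * \<sigma> * (t - s)) + ennreal (14 * pi * \<sigma>) * ennreal (t - s)"
      using j J1 by (intro add_right_mono high') auto
    also have "\<dots> = ennreal ((3 + 14 * pi) * \<sigma> * (t - s))"
    proof -
      have "ennreal (3 * \<sigma> * (t - s)) + ennreal (14 * pi * \<sigma>) * ennreal (t - s)
          = ennreal (3 * \<sigma> * (t - s) + 14 * pi * \<sigma> * (t - s))"
        using \<sigma> st by (simp add: ennreal_mult)
      then show ?thesis by (simp only: distrib_right)
    qed
    \<comment> \<open>The cell counts 4 at scale \<open>J\<close> and 3 at scale \<open>m\<close>
      add up to \<open>2 * pi * 7 * \<sigma>\<close>; \<open>3 + 14 * pi\<close> is below 60 because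
      \<open>pi < 4\<close>.\<close>
    also have "\<dots> \<le> ennreal (60 * \<sigma> * (t - s))"
      using \<sigma> st pi_less_4 by (intro ennreal_leI mult_right_mono) auto
    finally show ?thesis by blast
  qed
qed

text \<open>For the series without its terms below \<open>2 ^ m\<close>,
  \<open>local_oscillation_le\<close> uses only scales \<open>j \<ge> m\<close>, so the oscillation
  norm is at most 120 times a bound on \<open>s j\<close> for these \<open>j\<close>. The choice
  \<open>m = 0\<close> gives finiteness, large \<open>m\<close> gives approximation by
  polynomials.\<close>

lemma VMOA_power_seriesI:
  fixes c :: "nat \<Rightarrow> complex" and s :: "nat \<Rightarrow> real"
  defines "f \<equiv> \<lambda>x. \<Sum>n. c n * circ x ^ n"
  assumes c0: "c 0 = 0" and l2: "summable (\<lambda>n. (norm (c n))\<^sup>2)"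
    and conv: "AE x in lborel. summable (\<lambda>n. c n * circ x ^ n)"
    and s0: "\<And>j. s j \<ge> 0" and slim: "s \<longlonglongrightarrow> 0"
    and high: "\<And>j (i::int).
      (\<integral>\<^sup>+x\<in>{of_int i / 2 ^ (j + 2)..(of_int i + 1) / 2 ^ (j + 2)}.
          ennreal (norm (f x - (\<Sum>k<2 ^ j. c k * circ (of_nat k * x)))) \<partial>lborel)
        \<le> ennreal (s j / 2 ^ (j + 2))"
    and low: "\<And>j (i::int).
      (\<integral>\<^sup>+x\<in>{of_int i / 2 ^ (j + 2)..(of_int i + 1) / 2 ^ (j + 2)}.
          ennreal (norm (\<Sum>k<2 ^ j. of_nat k * c k * circ (of_nat k * x))) \<partial>lborel) \<le> ennreal (s j)"
  shows "(\<lambda>z. \<Sum>n. c n * z ^ n) \<in> VMOA"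
proof -
  define F where "F z = (\<Sum>n. c n * z ^ n)" for z
  define P where "P m = (\<Sum>k<2 ^ m. monom (c k) k)" for m :: nat
  define p where "p m x = (\<Sum>k<2 ^ m. c k * circ (of_nat k * x))" for m :: nat and x
  have P: "poly (P m) (circ x) = p m x" for m x
    by (simp add: P_def p_def poly_sum poly_monom circ_mult_nat)
  have H: "F \<in> hardy1" unfolding F_def by (rule hardy1_power_series [OF l2])
  then have cont: "continuous_on (ball 0 1) F"
    by (auto simp: hardy1_def holomorphic_on_imp_continuous_on)
  have [measurable]: "f \<in> borel_measurable borel"
    unfolding f_def by (rule borel_measurable_suminf) measurable
  have bv: "AE x in lborel. boundary_value (\<lambda>z. F z - poly (P m) z) (circ x) = f x - p m x" for m
    using conv
  proof eventually_elim
    case (elim x)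
    have "((\<lambda>r. \<Sum>n. c n * circ x ^ n * of_real r ^ n) \<longlongrightarrow> f x) (at_left (1::real))"
      unfolding f_def by (rule Abel_radial_limit [OF elim])
    then have "((\<lambda>r. F (of_real r * circ x)) \<longlongrightarrow> f x) (at_left (1::real))"
      by (simp add: F_def power_mult_distrib mult_ac)
    moreover have "((\<lambda>r. poly (P m) (of_real r * circ x)) \<longlongrightarrow> poly (P m) (of_real 1 * circ x)) (at_left (1::real))"
      by (intro tendsto_intros)
    ultimately have "((\<lambda>r. F (of_real r * circ x) - poly (P m) (of_real r * circ x)) \<longlongrightarrow> f x - p m x) (at_left (1::real))"
      by (intro tendsto_diff) (simp_all add: P)
    then show ?case unfolding boundary_value_def by (intro tendsto_Lim) auto
  qed
  \<comment> \<open>120 is the constant 60 of \<open>local_oscillation_le\<close>, doubled by the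
    passage from the constant \<open>d\<close> to the arc mean.\<close>
  have bound: "bmo_norm (\<lambda>z. F z - poly (P m) z) \<le> ennreal (120 * \<sigma>)"
    if \<sigma>: "\<sigma> \<ge> 0" "\<And>j. j \<ge> m \<Longrightarrow> s j \<le> \<sigma>" for m \<sigma>
  proof -
    have "mean_osc (\<lambda>z. F z - poly (P m) z) a b \<le> 120 * \<sigma>" if ab: "a < b" for a b
    proof -
      have "\<exists>d. (\<integral>\<^sup>+x\<in>{a..b}. ennreal (norm (f x - (\<Sum>k<2 ^ m. c k * circ (of_nat k * x)) - d)) \<partial>lborel)
          \<le> ennreal (60 * \<sigma> * (b - a))"
      proof (rule local_oscillation_le)
        fix j and i :: int assume j: "j \<ge> m"
        show "(\<integral>\<^sup>+x\<in>{of_int i / 2 ^ (j + 2)..(of_int i + 1) / 2 ^ (j + 2)}.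
            ennreal (norm (f x - (\<Sum>k<2 ^ j. c k * circ (of_nat k * x)))) \<partial>lborel) \<le> ennreal (\<sigma> / 2 ^ (j + 2))"
          using \<sigma>(2) [OF j] by (intro order_trans [OF high] ennreal_leI divide_right_mono) auto
        show "(\<integral>\<^sup>+x\<in>{of_int i / 2 ^ (j + 2)..(of_int i + 1) / 2 ^ (j + 2)}.
            ennreal (norm (\<Sum>k<2 ^ j. of_nat k * c k * circ (of_nat k * x))) \<partial>lborel) \<le> ennreal \<sigma>"
          using \<sigma>(2) [OF j] by (intro order_trans [OF low] ennreal_leI) auto
      qed (use \<sigma> ab in auto)
      then obtain d where d: "(\<integral>\<^sup>+x\<in>{a..b}. ennreal (norm (f x - p m x - d)) \<partial>lborel) \<le> ennreal (60 * \<sigma> * (b - a))"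
        unfolding p_def by blast
      have "mean_osc (\<lambda>z. F z - poly (P m) z) a b \<le> 2 * (60 * \<sigma>)"
      proof (rule mean_osc_le)
        show "(\<lambda>x. boundary_value (\<lambda>z. F z - poly (P m) z) (circ x)) \<in> borel_measurable borel"
          by (intro borel_measurable_boundary_value continuous_intros cont)
        have "(\<integral>\<^sup>+x\<in>{a..b}. ennreal (norm (boundary_value (\<lambda>z. F z - poly (P m) z) (circ x) - d)) \<partial>lborel)
          = (\<integral>\<^sup>+x\<in>{a..b}. ennreal (norm (f x - p m x - d)) \<partial>lborel)"
          by (rule nn_integral_cong_AE, use bv [of m] in eventually_elim) simp
        then show "(\<integral>\<^sup>+x\<in>{a..b}. ennreal (norm (boundary_value (\<lambda>z. F z - poly (P m) z) (circ x) - d)) \<partial>lborel)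
          \<le> ennreal (60 * \<sigma> * (b - a))" using d by simp
      qed (use ab \<sigma> in auto)
      then show ?thesis by simp
    qed
    then show ?thesis
      unfolding bmo_norm_def by (intro SUP_least) (auto intro: ennreal_leI)
  qed
  have "bmo_norm F < \<infinity>"
  proof -
    have "Bseq s" using slim by (intro convergent_imp_Bseq convergentI)
    then obtain K where "K > 0" "\<And>j. \<bar>s j\<bar> \<le> K" unfolding Bseq_def by auto
    then have "bmo_norm (\<lambda>z. F z - poly (P 0) z) \<le> ennreal (120 * K)"
      by (intro bound) (auto simp: abs_le_iff)
    \<comment> \<open>\<open>P 0\<close> is the constant polynomial \<open>c 0\<close>; its
      vanishing turns the bound for \<open>m = 0\<close> into one for \<open>F\<close>
      itself.\<close>
    moreover have "P 0 = 0" by (simp add: P_def c0)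
    ultimately show ?thesis by (auto intro: le_less_trans)
  qed
  moreover have "\<exists>p. bmo_norm (\<lambda>z. F z - poly p z) < \<epsilon>" if "\<epsilon> > 0" for \<epsilon> :: ennreal
  proof -
    \<comment> \<open>\<open>\<epsilon>\<close> may be infinite; density supplies a finite positive
      number below it.\<close>
    obtain e where e: "0 < e" "e < \<epsilon>" using dense [OF \<open>\<epsilon> > 0\<close>] by blast
    then obtain r where r: "e = ennreal r" "r > 0"
      by (cases e) (auto simp: ennreal_less_zero_iff)
    have "eventually (\<lambda>j. s j < r / 120) sequentially"
      using slim r by (intro order_tendstoD(2)) auto
    then obtain m where m: "\<And>j. j \<ge> m \<Longrightarrow> s j \<le> r / 120"
      unfolding eventually_sequentially by (meson less_imp_le)
    then have "bmo_norm (\<lambda>z. F z - poly (P m) z) \<le> ennreal (120 * (r / 120))"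
      using r by (intro bound) auto
    then show ?thesis using e r by (auto intro: le_less_trans)
  qed
  ultimately have "F \<in> VMOA" using H by (auto simp: VMOA_def BMOA_def)
  then show ?thesis by (simp add: F_def [abs_def])
qed

subsection \<open>Dyadic blocks\<close>

lemma power4_le_exp: "(4::real) ^ j \<le> exp (2 * real j)"
proof -
  have "(2::real) \<le> exp 1" using exp_ge_add_one_self [of 1] by simp
  then have "(2::real) ^ (2 * j) \<le> exp 1 ^ (2 * j)" by (intro power_mono) auto
  moreover have "(2::real) ^ (2 * j) = 4 ^ j" by (simp add: power_mult)
  moreover have "exp (1::real) ^ (2 * j) = exp (2 * real j)"
    using exp_of_nat_mult [of "2 * j" "1::real"] by simp
  ultimately show ?thesis by simp
qed

text \<open>The union bound in summed form: weights \<open>(1 / 4) ^ j\<close> against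
  \<open>4 * 2 ^ j\<close> variables leave the convergent series of \<open>4 * (1 / 2) ^ j\<close>,
  so the weighted sum \<open>Z\<close> is almost surely finite. Each \<open>Y j i\<close> is then at
  most \<open>4 ^ j * Z\<close>, and \<open>4 ^ j \<le> exp (2 * j)\<close> accounts for the
  \<open>2 * j\<close> in the exponent.\<close>

lemma (in prob_space) AE_exponential_bound:
  fixes Y :: "nat \<Rightarrow> nat \<Rightarrow> 'a \<Rightarrow> ennreal"
  assumes [measurable]: "\<And>j i. Y j i \<in> borel_measurable M"
    and Y: "\<And>j i. (\<integral>\<^sup>+\<omega>. Y j i \<omega> \<partial>M) \<le> 1"
  shows "AE \<omega> in M. \<exists>z\<ge>1. \<forall>j. \<forall>i<2 ^ (j + 2). Y j i \<omega> < ennreal (exp (z + 2 * real j))"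
proof -
  define Z where "Z \<omega> = (\<Sum>j. \<Sum>i<2 ^ (j + 2). ennreal ((1 / 4) ^ j) * Y j i \<omega>)" for \<omega>
  have [measurable]: "Z \<in> borel_measurable M" unfolding Z_def by measurable
  have "(\<integral>\<^sup>+\<omega>. Z \<omega> \<partial>M) = (\<Sum>j. \<Sum>i<2 ^ (j + 2). ennreal ((1 / 4) ^ j) * (\<integral>\<^sup>+\<omega>. Y j i \<omega> \<partial>M))"
    unfolding Z_def by (simp add: nn_integral_suminf nn_integral_sum nn_integral_cmult)
  also have "\<dots> \<le> (\<Sum>j. ennreal (4 * (1 / 2) ^ j))"
  proof (rule suminf_le)
    fix j
    have "(\<Sum>i<2 ^ (j + 2). ennreal ((1 / 4) ^ j) * (\<integral>\<^sup>+\<omega>. Y j i \<omega> \<partial>M)) \<le> (\<Sum>i<(2::nat) ^ (j + 2). ennreal ((1 / 4) ^ j) * 1)"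
      by (intro sum_mono mult_left_mono Y) auto
    also have "\<dots> = ennreal (\<Sum>i<(2::nat) ^ (j + 2). (1 / 4) ^ j)"
      by (subst sum_ennreal [symmetric]) auto
    also have "(\<Sum>i<(2::nat) ^ (j + 2). (1 / 4) ^ j) = (4 * (1 / 2) ^ j :: real)"
    proof -
      have "(2::real) ^ j * (1 / 4) ^ j = (1 / 2) ^ j" by (simp flip: power_mult_distrib)
      then show ?thesis by simp
    qed
    finally show "(\<Sum>i<2 ^ (j + 2). ennreal ((1 / 4) ^ j) * (\<integral>\<^sup>+\<omega>. Y j i \<omega> \<partial>M)) \<le> ennreal (4 * (1 / 2) ^ j)" .
  qed auto
  also have "\<dots> = ennreal (\<Sum>j. 4 * (1 / 2) ^ j)"
    by (rule suminf_ennreal2) (auto intro!: summable_mult summable_geometric)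
  finally have "(\<integral>\<^sup>+\<omega>. Z \<omega> \<partial>M) \<noteq> \<infinity>" by (auto simp: top_unique)
  then have "AE \<omega> in M. Z \<omega> \<noteq> \<infinity>" by (intro nn_integral_PInf_AE) auto
  then show ?thesis
  proof eventually_elim
    case (elim \<omega>)
    then obtain r where r: "Z \<omega> = ennreal r" "r \<ge> 0" by (cases "Z \<omega>") auto
    define z where "z = 1 + r"
    have rz: "r < exp z" using exp_ge_add_one_self [of z] by (simp add: z_def)
    have "Y j i \<omega> < ennreal (exp (z + 2 * real j))" if i: "i < 2 ^ (j + 2)" for j i
    proof -
      have "ennreal ((1 / 4) ^ j) * Y j i \<omega> \<le> (\<Sum>i<2 ^ (j + 2). ennreal ((1 / 4) ^ j) * Y j i \<omega>)"
        using i by (intro member_le_sum) auto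
      also have "\<dots> \<le> Z \<omega>"
        unfolding Z_def using sum_le_suminf [of "\<lambda>j. \<Sum>i<2 ^ (j + 2). ennreal ((1 / 4) ^ j) * Y j i \<omega>" "{j}"] by auto
      finally have *: "ennreal ((1 / 4) ^ j) * Y j i \<omega> \<le> ennreal r" using r by simp
      have "Y j i \<omega> = ennreal (4 ^ j * (1 / 4) ^ j) * Y j i \<omega>"
        by (simp flip: power_mult_distrib)
      also have "\<dots> = ennreal (4 ^ j) * (ennreal ((1 / 4) ^ j) * Y j i \<omega>)"
        by (simp add: ennreal_mult mult.assoc)
      also have "\<dots> \<le> ennreal (4 ^ j) * ennreal r" using * by (intro mult_left_mono) auto
      also have "\<dots> = ennreal (4 ^ j * r)" using r by (simp add: ennreal_mult)
      also have "\<dots> < ennreal (exp (z + 2 * real j))"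
      proof (rule ennreal_lessI)
        have "4 ^ j * r < 4 ^ j * exp z" using rz by simp
        also have "\<dots> \<le> exp (2 * real j) * exp z" by (intro mult_right_mono power4_le_exp) auto
        finally show "4 ^ j * r < exp (z + 2 * real j)" by (simp add: exp_add mult.commute)
      qed simp
      finally show ?thesis .
    qed
    then show ?case using r by (intro exI [of _ z]) (auto simp: z_def)
  qed
qed

text \<open>Once \<open>v j\<close> is below \<open>e / 4\<close>, the recursion contracts towards
  the fixed point \<open>e / 2\<close> of \<open>u / 2 + e / 4\<close>.\<close>

lemma contraction_tendsto_zero:
  fixes u v :: "nat \<Rightarrow> real"
  assumes u: "\<And>j. u j \<ge> 0" and v: "v \<longlonglongrightarrow> 0" and rec: "eventually (\<lambda>j. u (Suc j) \<le> u j / 2 + v j) sequentially"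
  shows "u \<longlonglongrightarrow> 0"
proof (rule LIMSEQ_I)
  fix e :: real assume "e > 0"
  have "eventually (\<lambda>j. v j < e / 4) sequentially"
    using v by (rule order_tendstoD(2)) (use \<open>e > 0\<close> in simp)
  with rec have "eventually (\<lambda>j. u (Suc j) \<le> u j / 2 + e / 4) sequentially"
    by eventually_elim simp
  then obtain N where N: "\<And>j. j \<ge> N \<Longrightarrow> u (Suc j) \<le> u j / 2 + e / 4"
    unfolding eventually_sequentially by blast
  have bd: "u (N + i) \<le> u N * (1 / 2) ^ i + e / 2" for i
  proof (induction i)
    case 0
    then show ?case using \<open>e > 0\<close> by simp
  next
    case (Suc i)
    then show ?case using N [of "N + i"] by simp
  qed
  have "(\<lambda>i. u N * (1 / 2) ^ i + e / 2) \<longlonglongrightarrow> u N * 0 + e / 2"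
    by (intro tendsto_intros LIMSEQ_power_zero) simp
  then have "eventually (\<lambda>i. u N * (1 / 2) ^ i + e / 2 < e) sequentially"
    by (rule order_tendstoD(2)) (use \<open>e > 0\<close> in simp)
  then obtain K where K: "\<And>i. i \<ge> K \<Longrightarrow> u N * (1 / 2) ^ i + e / 2 < e"
    unfolding eventually_sequentially by blast
  have "norm (u n - 0) < e" if "n \<ge> N + K" for n
  proof -
    have "K \<le> n - N" "N + (n - N) = n" using that by auto
    then show ?thesis using bd [of "n - N"] K [of "n - N"] u [of n] by simp
  qed
  then show "\<exists>no. \<forall>n\<ge>no. norm (u n - 0) < e" by blast
qed

text \<open>The terms with index from \<open>j div 2\<close> to \<open>j - 1\<close> are at least
  \<open>j / 2\<close> in number and each at least \<open>x j\<close>, so \<open>j * x j\<close> is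
  at most twice a tail of the series.\<close>

lemma decseq_summable_times_index:
  fixes x :: "nat \<Rightarrow> real"
  assumes "decseq x" "summable x" "\<And>j. x j \<ge> 0"
  shows "(\<lambda>j. real j * x j) \<longlonglongrightarrow> 0"
proof (rule tendsto_sandwich [of "\<lambda>_. 0"])
  have "(\<lambda>i. \<Sum>n. x (n + i)) \<longlonglongrightarrow> 0" using assms(2) by (rule suminf_exist_split2)
  moreover have "filterlim (\<lambda>j::nat. j div 2) at_top sequentially"
    unfolding filterlim_at_top
  proof
    fix Z :: nat
    show "eventually (\<lambda>j. Z \<le> j div 2) sequentially"
      using eventually_ge_at_top [of "2 * Z"] by eventually_elim auto
  qed
  ultimately have "(\<lambda>j. \<Sum>n. x (n + j div 2)) \<longlonglongrightarrow> 0" by (rule filterlim_compose)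
  then show "(\<lambda>j. 2 * (\<Sum>n. x (n + j div 2))) \<longlonglongrightarrow> 0"
    using tendsto_mult_right_zero by blast
  have "real j * x j \<le> 2 * (\<Sum>n. x (n + j div 2))" for j
  proof -
    have "real (j - j div 2) * x j = (\<Sum>n<j - j div 2. x j)" by simp
    also have "\<dots> \<le> (\<Sum>n<j - j div 2. x (n + j div 2))"
      by (intro sum_mono decseqD [OF assms(1)]) auto
    also have "\<dots> \<le> (\<Sum>n. x (n + j div 2))"
      using assms summable_iff_shift [of x "j div 2"] by (intro sum_le_suminf) auto
    finally have "real (j - j div 2) * x j \<le> (\<Sum>n. x (n + j div 2))" .
    moreover have "real j * x j \<le> 2 * (real (j - j div 2) * x j)"
      using assms(3) [of j] by (simp add: mult.assoc [symmetric] mult_right_mono of_nat_diff)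
    ultimately show ?thesis by linarith
  qed
  then show "eventually (\<lambda>j. real j * x j \<le> 2 * (\<Sum>n. x (n + j div 2))) sequentially" by simp
qed (use assms in auto)

section \<open>Variances of dyadic blocks, windows and scales\<close>

lemma lessThan_double_power:
  "{..<(2::nat) ^ Suc K} = {..<2 ^ K} \<union> {2 ^ K..2 ^ (K + 1) - 1}"
proof -
  have "{..<2 * m} = {..<m} \<union> {m..2 * m - 1}" if "m \<ge> 1" for m :: nat
    using that by auto
  from this [of "2 ^ K"] show ?thesis by simp
qed

lemma sum_dyadic_blocks:
  fixes w :: "nat \<Rightarrow> real"
  shows "(\<Sum>n<2 ^ K. w n) = w 0 + (\<Sum>k<K. \<Sum>n=2 ^ k..2 ^ (k + 1) - 1. w n)"
proof (induction K)
  case (Suc K)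
  have "(\<Sum>n<2 ^ Suc K. w n) = (\<Sum>n<2 ^ K. w n) + (\<Sum>n=2 ^ K..2 ^ (K + 1) - 1. w n)"
    unfolding lessThan_double_power by (intro sum.union_disjoint) auto
  then show ?case using Suc by simp
qed simp

lemma dyadic_sigma_square: "(dyadic_sigma a k)\<^sup>2 = (\<Sum>n=2 ^ k..2 ^ (k + 1) - 1. (a n)\<^sup>2)"
  unfolding dyadic_sigma_def by (simp add: sum_nonneg)

lemma summable_squares_of_dyadic:
  assumes "summable (\<lambda>k. (dyadic_sigma a k)\<^sup>2)"
  shows "summable (\<lambda>n. (a n)\<^sup>2)"
proof (rule summableI_nonneg_bounded)
  fix N :: nat
  have "N < 2 ^ N" by (rule less_exp)
  then have "(\<Sum>n<N. (a n)\<^sup>2) \<le> (\<Sum>n<2 ^ N. (a n)\<^sup>2)"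
    by (intro sum_mono2) auto
  also have "\<dots> = (a 0)\<^sup>2 + (\<Sum>k<N. (dyadic_sigma a k)\<^sup>2)"
    by (simp only: sum_dyadic_blocks dyadic_sigma_square)
  also have "\<dots> \<le> (a 0)\<^sup>2 + (\<Sum>k. (dyadic_sigma a k)\<^sup>2)"
    using assms by (intro add_left_mono sum_le_suminf) auto
  finally show "(\<Sum>n<N. (a n)\<^sup>2) \<le> (a 0)\<^sup>2 + (\<Sum>k. (dyadic_sigma a k)\<^sup>2)" .
qed auto

text \<open>A window of length \<open>2 ^ j\<close> beyond \<open>2 ^ j\<close> meets at most two consecutive dyadic blocks.\<close>

lemma dyadic_window_sum_le:
  assumes "decseq (dyadic_sigma a)"
  shows "(\<Sum>k\<in>window (2 ^ j) n l. (if k < 2 ^ j then 0 else a k)\<^sup>2) \<le> 2 * (dyadic_sigma a j)\<^sup>2"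
proof -
  have nn: "dyadic_sigma a k \<ge> 0" for k by (simp add: dyadic_sigma_def sum_nonneg)
  define W where "W = {k \<in> window (2 ^ j) n l. 2 ^ j \<le> k}"
  have finW: "finite W" by (simp add: W_def)
  have eq: "(\<Sum>k\<in>window (2 ^ j) n l. (if k < 2 ^ j then 0 else a k)\<^sup>2) = (\<Sum>k\<in>W. (a k)\<^sup>2)"
    unfolding W_def by (rule sum.mono_neutral_cong_right) auto
  show ?thesis
  proof (cases "W = {}")
    case False
    \<comment> \<open>The smallest index lies in some block \<open>q \<ge> j\<close>; a window of
      length \<open>2 ^ j \<le> 2 ^ q\<close> starting there cannot reach past block
      \<open>q + 1\<close>.\<close>
    define k0 where "k0 = Min W"
    have k0: "k0 \<in> W" using False finW by (simp add: k0_def)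
    then have "k0 \<ge> 2 ^ j" "k0 > 0" by (auto simp: W_def intro: less_le_trans [of _ "2 ^ j"])
    obtain q where q: "2 ^ q \<le> k0" "k0 < 2 ^ (q + 1)"
      using ex_power_ivl1 [of 2 k0] \<open>k0 > 0\<close> by auto
    have "(2::nat) ^ j < 2 ^ (q + 1)" using q \<open>k0 \<ge> 2 ^ j\<close> by linarith
    then have "j < q + 1" by (rule power_less_imp_less_exp [rotated]) simp
    then have jq: "j \<le> q" by simp
    have "W \<subseteq> {2 ^ q..2 ^ (q + 1) - 1} \<union> {2 ^ (q + 1)..2 ^ (q + 1 + 1) - 1}"
    proof
      fix k assume k: "k \<in> W"
      have "k0 \<le> k" using k finW by (simp add: k0_def)
      moreover have "k < k0 + 2 ^ j" using k k0 by (auto simp: W_def window_def)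
      moreover have "(2::nat) ^ j \<le> 2 ^ q" using jq by (intro power_increasing) auto
      ultimately have "2 ^ q \<le> k" "k < 2 ^ (q + 1) + 2 ^ q" using q by linarith+
      then show "k \<in> {2 ^ q..2 ^ (q + 1) - 1} \<union> {2 ^ (q + 1)..2 ^ (q + 1 + 1) - 1}" by auto
    qed
    then have "(\<Sum>k\<in>W. (a k)\<^sup>2) \<le> (\<Sum>k\<in>{2 ^ q..2 ^ (q + 1) - 1} \<union> {2 ^ (q + 1)..2 ^ (q + 1 + 1) - 1}. (a k)\<^sup>2)"
      by (intro sum_mono2) auto
    also have "\<dots> \<le> (dyadic_sigma a q)\<^sup>2 + (dyadic_sigma a (q + 1))\<^sup>2"
      unfolding dyadic_sigma_square by (subst sum_Un) (auto intro!: sum_nonneg)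
    also have "\<dots> \<le> (dyadic_sigma a j)\<^sup>2 + (dyadic_sigma a j)\<^sup>2"
      using jq by (intro add_mono power_mono decseqD [OF assms] nn) auto
    finally show ?thesis using eq by simp
  qed (use eq in simp)
qed

text \<open>Up to the factor \<open>(2 * pi)\<^sup>2\<close>, the total variance of the derivative
  of the partial sum below \<open>2 ^ j\<close>, with the derivative measured in units of
  \<open>2 ^ j\<close>.\<close>

definition low_energy :: "(nat \<Rightarrow> real) \<Rightarrow> nat \<Rightarrow> real" where
  "low_energy a j = (\<Sum>k<2 ^ j. (real k / 2 ^ j * a k)\<^sup>2)"

lemma low_energy_nonneg: "low_energy a j \<ge> 0"
  by (simp add: low_energy_def sum_nonneg)

text \<open>Passing to the next scale halves every old weight, hence quarters the old energy, and
  the new block enters with weights at most 1.\<close>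

lemma low_energy_Suc_le: "low_energy a (Suc j) \<le> low_energy a j / 4 + (dyadic_sigma a j)\<^sup>2"
proof -
  have "low_energy a (Suc j) = (\<Sum>k<2 ^ j. (real k / 2 ^ Suc j * a k)\<^sup>2) + (\<Sum>k=2 ^ j..2 ^ (j + 1) - 1. (real k / 2 ^ Suc j * a k)\<^sup>2)"
    unfolding low_energy_def lessThan_double_power by (intro sum.union_disjoint) auto
  also have "(\<Sum>k<2 ^ j. (real k / 2 ^ Suc j * a k)\<^sup>2) = low_energy a j / 4"
    unfolding low_energy_def sum_divide_distrib by (simp add: power_mult_distrib power_divide mult.commute)
  also have "(\<Sum>k=2 ^ j..2 ^ (j + 1) - 1. (real k / 2 ^ Suc j * a k)\<^sup>2) \<le> (\<Sum>k=2 ^ j..2 ^ (j + 1) - 1. (a k)\<^sup>2)"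
  proof (rule sum_mono)
    fix k :: nat assume k: "k \<in> {2 ^ j..2 ^ (j + 1) - 1}"
    then have "k \<le> 2 ^ Suc j" by auto
    then have "real k \<le> 2 ^ Suc j" by (metis of_nat_le_iff of_nat_numeral of_nat_power)
    then have "(real k / 2 ^ Suc j)\<^sup>2 \<le> 1" by (simp add: power_le_one)
    then have "(real k / 2 ^ Suc j)\<^sup>2 * (a k)\<^sup>2 \<le> 1 * (a k)\<^sup>2" by (intro mult_right_mono) auto
    then show "(real k / 2 ^ Suc j * a k)\<^sup>2 \<le> (a k)\<^sup>2" by (simp only: power_mult_distrib mult_1)
  qed
  finally show ?thesis by (simp add: dyadic_sigma_square)
qed

text \<open>The contraction of \<open>low_energy_Suc_le\<close> is strong enough to survive the
  factor \<open>j\<close>: \<open>(j + 1) / 4 \<le> j / 2\<close> for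
  \<open>j \<ge> 1\<close>.\<close>

lemma low_energy_times_index:
  assumes "(\<lambda>j. real j * (dyadic_sigma a j)\<^sup>2) \<longlonglongrightarrow> 0" "(\<lambda>j. (dyadic_sigma a j)\<^sup>2) \<longlonglongrightarrow> 0"
  shows "(\<lambda>j. real j * low_energy a j) \<longlonglongrightarrow> 0"
proof (rule contraction_tendsto_zero)
  show "(\<lambda>j. real j * (dyadic_sigma a j)\<^sup>2 + (dyadic_sigma a j)\<^sup>2) \<longlonglongrightarrow> 0"
    using tendsto_add [OF assms] by simp
  have "real (Suc j) * low_energy a (Suc j) \<le> real j * low_energy a j / 2 + (real j * (dyadic_sigma a j)\<^sup>2 + (dyadic_sigma a j)\<^sup>2)"
    if "j \<ge> 1" for j
  proof -
    have "real (Suc j) * low_energy a (Suc j) \<le> real (Suc j) * (low_energy a j / 4 + (dyadic_sigma a j)\<^sup>2)"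
      by (intro mult_left_mono low_energy_Suc_le) auto
    moreover have "real (Suc j) * low_energy a j \<le> 2 * real j * low_energy a j"
      using that low_energy_nonneg [of a j] by (intro mult_right_mono) auto
    moreover have "real (Suc j) * (low_energy a j / 4 + (dyadic_sigma a j)\<^sup>2)
        = real (Suc j) * low_energy a j / 4 + (real j * (dyadic_sigma a j)\<^sup>2 + (dyadic_sigma a j)\<^sup>2)"
      by (simp add: field_simps)
    ultimately show ?thesis by linarith
  qed
  then show "eventually (\<lambda>j. real (Suc j) * low_energy a (Suc j)
      \<le> real j * low_energy a j / 2 + (real j * (dyadic_sigma a j)\<^sup>2 + (dyadic_sigma a j)\<^sup>2)) sequentially"
    unfolding eventually_sequentially by blast
qed (simp add: low_energy_nonneg)

text \<open>At scale \<open>2 ^ - j\<close> the exponential moments are taken with parameter \<open>1 / window_scale a j\<close>; the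
  summand \<open>1 / (j + 1)\<^sup>2\<close> only prevents division by zero.\<close>

definition window_scale :: "(nat \<Rightarrow> real) \<Rightarrow> nat \<Rightarrow> real" where
  "window_scale a j = 4 * (dyadic_sigma a j)\<^sup>2 + 2 * low_energy a j + 1 / (real j + 1)\<^sup>2"

definition high_energy :: "(nat \<Rightarrow> real) \<Rightarrow> nat \<Rightarrow> real" where
  "high_energy a j = (\<Sum>n. (a n)\<^sup>2) - (\<Sum>n<2 ^ j. (a n)\<^sup>2)"

lemma window_scale_pos: "window_scale a j > 0"
proof -
  have "1 / (real j + 1)\<^sup>2 > 0" by simp
  moreover have "4 * (dyadic_sigma a j)\<^sup>2 + 2 * low_energy a j \<ge> 0" using low_energy_nonneg by simp
  ultimately show ?thesis unfolding window_scale_def by linarith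
qed

subsection \<open>Random power series\<close>

text \<open>The density is even and Lebesgue measure is invariant under negation, so odd real
  functions of \<open>X\<close> have expectation 0; this is applied to \<open>Re\<close> and
  \<open>Im\<close>.\<close>

lemma std_complex_gaussian_mean_zero:
  assumes "std_complex_gaussian M X" "integrable M X"
  shows "integral\<^sup>L M X = 0"
proof -
  have D: "distributed M lborel X (\<lambda>z. ennreal (1 / pi * exp (- (norm z)\<^sup>2)))"
    using assms(1) by (simp add: std_complex_gaussian_def)
  have neg: "distr lborel borel uminus = (lborel :: complex measure)"
    using lborel_affine [of "-1" "0 :: complex"] by (simp add: density_1)
  have odd: "integral\<^sup>L M (\<lambda>\<omega>. g (X \<omega>)) = 0"
    if [measurable]: "g \<in> borel_measurable borel" and g: "\<And>z. g (- z) = - g z" for g :: "complex \<Rightarrow> real"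
  proof -
    let ?h = "\<lambda>z. 1 / pi * exp (- (norm z)\<^sup>2) * g z"
    have eq: "integral\<^sup>L M (\<lambda>\<omega>. g (X \<omega>)) = integral\<^sup>L lborel ?h"
      using D by (intro distributed_integral [symmetric]) auto
    have "integral\<^sup>L lborel ?h = integral\<^sup>L (distr lborel borel uminus) ?h"
      by (simp only: neg)
    also have "\<dots> = integral\<^sup>L lborel (\<lambda>z. ?h (- z))"
      by (rule integral_distr) auto
    also have "\<dots> = - integral\<^sup>L lborel ?h"
      by (simp only: g norm_minus_cancel mult_minus_right Bochner_Integration.integral_minus)
    finally show ?thesis using eq by simp
  qed
  have "Re (integral\<^sup>L M X) = 0" "Im (integral\<^sup>L M X) = 0"
    using odd [of Re] odd [of Im] integral_Re [OF assms(2)] integral_Im [OF assms(2)] by auto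
  then show ?thesis by (simp add: complex_eq_iff)
qed

text \<open>The average \<open>Q\<close> of the overview. By Parseval it is \<open>1 / N\<close>
  times the integral over a period of the squared modulus of the polynomial times the Dirichlet
  kernel centred at \<open>x\<close>.\<close>

definition window_energy :: "nat \<Rightarrow> nat \<Rightarrow> (nat \<Rightarrow> complex) \<Rightarrow> real \<Rightarrow> real" where
  "window_energy N n b x = 1 / N * (\<Sum>l<n + N. (norm (\<Sum>k\<in>window N n l. b k * circ (real k * x)))\<^sup>2)"

lemma window_energy_add_int: "window_energy N n b (x + of_int m) = window_energy N n b x"
proof -
  have "circ (real k * (x + of_int m)) = circ (real k * x)" for k
    using circ_of_int [of "int k * m"] by (simp add: distrib_left circ_add)
  then show ?thesis by (simp add: window_energy_def)
qed

text \<open>The case \<open>N = 2 ^ j\<close> of \<open>local_integral_le_window_squares\<close>,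
  with \<open>x\<close> the centre of the cell. Its right-hand side is \<open>4 / N\<close> times
  the window energy, and the cell has length \<open>1 / (4 * N)\<close>, whence the constant
  16.\<close>

lemma dyadic_cell_le_window_energy:
  fixes b :: "nat \<Rightarrow> complex" and i :: int
  shows "(\<integral>\<^sup>+t\<in>{of_int i / 2 ^ (j + 2)..(of_int i + 1) / 2 ^ (j + 2)}. ennreal ((norm (\<Sum>k<n. b k * circ (of_nat k * t)))\<^sup>2) \<partial>lborel)
    \<le> ennreal (16 * window_energy (2 ^ j) n b ((of_int i + 1 / 2) / 2 ^ (j + 2)) * ((of_int i + 1) / 2 ^ (j + 2) - of_int i / 2 ^ (j + 2)))"
proof -
  define x where "x = (of_int i + 1 / 2) / (2 ^ (j + 2) :: real)"
  have "of_int i / 2 ^ (j + 2) = x - 1 / (8 * real (2 ^ j))" "(of_int i + 1) / 2 ^ (j + 2) = x + 1 / (8 * real (2 ^ j))"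
    by (simp_all add: x_def field_simps)
  moreover have "(4::real) / real ((2 ^ j)\<^sup>2) * E = 16 * (1 / real (2 ^ j) * E) * (x + 1 / (8 * real (2 ^ j)) - (x - 1 / (8 * real (2 ^ j))))" for E
    by (simp add: field_simps power2_eq_square)
  ultimately show ?thesis
    using local_integral_le_window_squares [where N = "2 ^ j" and x = x and n = n and b = b] unfolding x_def [symmetric] window_energy_def by (simp add: power2_eq_square)
qed

text \<open>The unimodular factors \<open>circ (k * x)\<close> join the coefficients without
  changing variances, so the bound is the same for all \<open>x\<close>. Subtracting
  \<open>2 * \<mu> * T\<close> normalises the moment to at most 1, as
  \<open>AE_exponential_bound\<close> requires.\<close>

lemma (in prob_space) window_energy_exp_moment:
  fixes \<xi> :: "nat \<Rightarrow> 'a \<Rightarrow> complex" and \<beta> :: "nat \<Rightarrow> real"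
  assumes ind: "indep_vars (\<lambda>_. borel) \<xi> UNIV"
    and gauss: "\<And>n. std_complex_gaussian M (\<xi> n)"
    and N: "N \<ge> 1" and \<mu>: "\<mu> \<ge> 0"
    and small: "\<And>l. \<mu> * (\<Sum>k\<in>window N n l. (\<beta> k)\<^sup>2) \<le> 1 / 2"
    and T: "(\<Sum>k<n. (\<beta> k)\<^sup>2) \<le> T"
  shows "(\<integral>\<^sup>+\<omega>. ennreal (exp (\<mu> * window_energy N n (\<lambda>k. of_real (\<beta> k) * \<xi> k \<omega>) x - 2 * \<mu> * T)) \<partial>M) \<le> 1"
proof -
  have [measurable]: "\<xi> n \<in> borel_measurable M" for n
    using std_complex_gaussian_borel_measurable gauss by blast
  have eq: "\<mu> * window_energy N n (\<lambda>k. of_real (\<beta> k) * \<xi> k \<omega>) x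
      = \<mu> / N * (\<Sum>l<n + N. (norm (\<Sum>k\<in>window N n l. (of_real (\<beta> k) * circ (real k * x)) * \<xi> k \<omega>))\<^sup>2)" for \<omega>
    by (simp add: window_energy_def mult_ac)
  have "(\<integral>\<^sup>+\<omega>. ennreal (exp (\<mu> * window_energy N n (\<lambda>k. of_real (\<beta> k) * \<xi> k \<omega>) x)) \<partial>M)
      \<le> ennreal (exp (2 * \<mu> * (\<Sum>k<n. (norm (of_real (\<beta> k) * circ (real k * x)))\<^sup>2)))"
    unfolding eq by (rule nn_integral_exp_window_squares [OF ind gauss N \<mu>]) (use small in \<open>simp add: norm_mult\<close>)
  also have "\<dots> \<le> ennreal (exp (2 * \<mu> * T))"
    using T \<mu> by (intro ennreal_leI) (simp add: norm_mult mult_left_mono)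
  finally have *: "(\<integral>\<^sup>+\<omega>. ennreal (exp (\<mu> * window_energy N n (\<lambda>k. of_real (\<beta> k) * \<xi> k \<omega>) x)) \<partial>M) \<le> ennreal (exp (2 * \<mu> * T))" .
  have "(\<integral>\<^sup>+\<omega>. ennreal (exp (\<mu> * window_energy N n (\<lambda>k. of_real (\<beta> k) * \<xi> k \<omega>) x - 2 * \<mu> * T)) \<partial>M)
     = (\<integral>\<^sup>+\<omega>. ennreal (exp (- (2 * \<mu> * T))) * ennreal (exp (\<mu> * window_energy N n (\<lambda>k. of_real (\<beta> k) * \<xi> k \<omega>) x)) \<partial>M)"
    by (intro nn_integral_cong) (simp add: ennreal_mult [symmetric] exp_add [symmetric])
  also have "\<dots> = ennreal (exp (- (2 * \<mu> * T))) * (\<integral>\<^sup>+\<omega>. ennreal (exp (\<mu> * window_energy N n (\<lambda>k. of_real (\<beta> k) * \<xi> k \<omega>) x)) \<partial>M)"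
    unfolding window_energy_def by (rule nn_integral_cmult) measurable
  also have "\<dots> \<le> ennreal (exp (- (2 * \<mu> * T))) * ennreal (exp (2 * \<mu> * T))"
    by (intro mult_left_mono *) auto
  also have "\<dots> = 1" by (simp add: ennreal_mult [symmetric] exp_add [symmetric])
  finally show ?thesis .
qed

context prob_space
begin

context
  fixes \<xi> :: "nat \<Rightarrow> 'a \<Rightarrow> complex" and a :: "nat \<Rightarrow> real"
  assumes ind: "indep_vars (\<lambda>_. borel) \<xi> UNIV"
    and gauss: "\<And>n. std_complex_gaussian M (\<xi> n)"
begin

text \<open>The exact value is 1, but any constant serves. The bound comes from
  \<open>y \<le> 2 * exp (y / 2)\<close> and the exponential moment with parameter 1 / 2, which
  equals 2.\<close>

lemma gaussian_second_moment:
  "(\<integral>\<^sup>+\<omega>. ennreal ((norm (\<xi> n \<omega>))\<^sup>2) \<partial>M) \<le> 4"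
proof -
  have [measurable]: "\<xi> k \<in> borel_measurable M" for k
    using std_complex_gaussian_borel_measurable gauss by blast
  have "(\<integral>\<^sup>+\<omega>. ennreal ((norm (\<xi> n \<omega>))\<^sup>2) \<partial>M) \<le> (\<integral>\<^sup>+\<omega>. 2 * ennreal (exp (1 / 2 * (norm (\<Sum>k\<in>{n}. 1 * \<xi> k \<omega>))\<^sup>2)) \<partial>M)"
  proof (rule nn_integral_mono)
    fix \<omega>
    have "y \<le> 2 * exp (1 / 2 * y)" for y :: real
    proof -
      have "1 + 1 / 2 * y \<le> exp (1 / 2 * y)" by (rule exp_ge_add_one_self)
      then show ?thesis by linarith
    qed
    from this [of "(norm (\<xi> n \<omega>))\<^sup>2"]
    have "ennreal ((norm (\<xi> n \<omega>))\<^sup>2) \<le> ennreal (2 * exp (1 / 2 * (norm (\<xi> n \<omega>))\<^sup>2))" by (rule ennreal_leI)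
    then show "ennreal ((norm (\<xi> n \<omega>))\<^sup>2) \<le> 2 * ennreal (exp (1 / 2 * (norm (\<Sum>k\<in>{n}. 1 * \<xi> k \<omega>))\<^sup>2))"
      by (simp add: ennreal_mult)
  qed
  also have "\<dots> = 2 * (\<integral>\<^sup>+\<omega>. ennreal (exp (1 / 2 * (norm (\<Sum>k\<in>{n}. 1 * \<xi> k \<omega>))\<^sup>2)) \<partial>M)"
    by (rule nn_integral_cmult) measurable
  also have "\<dots> = 2 * ennreal (1 / (1 - 1 / 2 * (\<Sum>k\<in>{n}. (norm (1::complex))\<^sup>2)))"
    by (subst nn_integral_exp_gaussian_square [OF ind gauss, where b = "\<lambda>_. 1"]) auto
  also have "\<dots> = 4"
    by (simp add: ennreal_numeral [symmetric] ennreal_mult [symmetric] del: ennreal_numeral)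
  finally show ?thesis .
qed

lemma AE_square_summable:
  assumes "summable (\<lambda>n. (a n)\<^sup>2)"
  shows "AE \<omega> in M. summable (\<lambda>n. (norm (of_real (a n) * \<xi> n \<omega>))\<^sup>2)"
proof -
  have [measurable]: "\<xi> n \<in> borel_measurable M" for n
    using std_complex_gaussian_borel_measurable gauss by blast
  have "(\<integral>\<^sup>+\<omega>. (\<Sum>n. ennreal ((norm (of_real (a n) * \<xi> n \<omega>))\<^sup>2)) \<partial>M)
      = (\<Sum>n. \<integral>\<^sup>+\<omega>. ennreal ((a n)\<^sup>2) * ennreal ((norm (\<xi> n \<omega>))\<^sup>2) \<partial>M)"
    by (subst nn_integral_suminf) (auto simp: norm_mult power_mult_distrib ennreal_mult)
  also have "\<dots> \<le> (\<Sum>n. ennreal (4 * (a n)\<^sup>2))"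
  proof (rule suminf_le)
    fix n
    have "(\<integral>\<^sup>+\<omega>. ennreal ((a n)\<^sup>2) * ennreal ((norm (\<xi> n \<omega>))\<^sup>2) \<partial>M) = ennreal ((a n)\<^sup>2) * (\<integral>\<^sup>+\<omega>. ennreal ((norm (\<xi> n \<omega>))\<^sup>2) \<partial>M)"
      by (rule nn_integral_cmult) measurable
    also have "\<dots> \<le> ennreal ((a n)\<^sup>2) * 4" by (intro mult_left_mono gaussian_second_moment) auto
    also have "\<dots> = ennreal (4 * (a n)\<^sup>2)" by (simp add: ennreal_mult mult.commute)
    finally show "(\<integral>\<^sup>+\<omega>. ennreal ((a n)\<^sup>2) * ennreal ((norm (\<xi> n \<omega>))\<^sup>2) \<partial>M) \<le> ennreal (4 * (a n)\<^sup>2)" .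
  qed auto
  also have "\<dots> = ennreal (\<Sum>n. 4 * (a n)\<^sup>2)"
    using assms by (intro suminf_ennreal2 summable_mult) auto
  finally have "(\<integral>\<^sup>+\<omega>. (\<Sum>n. ennreal ((norm (of_real (a n) * \<xi> n \<omega>))\<^sup>2)) \<partial>M) \<noteq> \<infinity>"
    by (auto simp: top_unique)
  then have "AE \<omega> in M. (\<Sum>n. ennreal ((norm (of_real (a n) * \<xi> n \<omega>))\<^sup>2)) \<noteq> \<infinity>"
    by (intro nn_integral_PInf_AE) measurable
  then show ?thesis
    by eventually_elim (intro summable_suminf_not_top, auto)
qed

text \<open>Kolmogorov's theorem applies at each fixed \<open>x\<close>, with an exceptional null
  set depending on \<open>x\<close>; Fubini exchanges the two almost-everywhere quantifiers.\<close>

lemma AE_summable_on_circle: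
  assumes l2: "summable (\<lambda>n. (a n)\<^sup>2)"
  shows "AE \<omega> in M. AE x in lborel. summable (\<lambda>n. of_real (a n) * \<xi> n \<omega> * circ x ^ n)"
proof -
  have m [measurable]: "\<xi> n \<in> borel_measurable M" for n
    using std_complex_gaussian_borel_measurable gauss by blast
  have sqi: "integrable M (\<lambda>\<omega>. (norm (\<xi> n \<omega>))\<^sup>2)" for n
    using gaussian_second_moment [of n] by (intro integrableI_bounded) (auto intro: le_less_trans)
  have Esq: "expectation (\<lambda>\<omega>. (norm (\<xi> n \<omega>))\<^sup>2) \<le> 4" for n
  proof -
    have "ennreal (expectation (\<lambda>\<omega>. (norm (\<xi> n \<omega>))\<^sup>2)) \<le> ennreal 4"
      using gaussian_second_moment [of n] nn_integral_eq_integral [OF sqi, of n] by simp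
    then show ?thesis by (subst (asm) ennreal_le_iff) auto
  qed
  have int: "integrable M (\<xi> n)" for n
    using m sqi by (rule integrable_of_square_integrable)
  have "AE \<omega> in M. summable (\<lambda>n. of_real (a n) * \<xi> n \<omega> * circ x ^ n)" for x
  proof (rule kolmogorov_one_series)
    show "indep_vars (\<lambda>_. borel) (\<lambda>n \<omega>. of_real (a n) * \<xi> n \<omega> * circ x ^ n) UNIV"
      by (rule indep_vars_compose2 [OF ind, of "\<lambda>n z. of_real (a n) * z * circ x ^ n"]) simp
    have eq: "(norm (of_real (a n) * \<xi> n \<omega> * circ x ^ n))\<^sup>2 = (a n)\<^sup>2 * (norm (\<xi> n \<omega>))\<^sup>2" for n \<omega>
      by (simp add: norm_mult norm_power power_mult_distrib)
    show "integrable M (\<lambda>\<omega>. (norm (of_real (a n) * \<xi> n \<omega> * circ x ^ n))\<^sup>2)" for n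
      unfolding eq using sqi by simp
    show "expectation (\<lambda>\<omega>. of_real (a n) * \<xi> n \<omega> * circ x ^ n) = 0" for n
      using std_complex_gaussian_mean_zero [OF gauss int] by simp
    show "summable (\<lambda>n. expectation (\<lambda>\<omega>. (norm (of_real (a n) * \<xi> n \<omega> * circ x ^ n))\<^sup>2))"
      unfolding eq
    proof (rule summable_comparison_test' [where N = 0])
      show "summable (\<lambda>n. 4 * (a n)\<^sup>2)" using l2 by (rule summable_mult)
      show "norm (expectation (\<lambda>\<omega>. (a n)\<^sup>2 * (norm (\<xi> n \<omega>))\<^sup>2)) \<le> 4 * (a n)\<^sup>2" for n
        using mult_left_mono [OF Esq [of n], of "(a n)\<^sup>2"] by (simp add: mult.commute)
    qed
  qed
  then have "AE x in lborel. AE \<omega> in M. summable (\<lambda>n. of_real (a n) * \<xi> n \<omega> * circ x ^ n)" by simp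
  moreover interpret pair_sigma_finite M "lborel :: real measure" ..
  \<comment> \<open>Joint measurability of the convergence set, needed for the exchange, follows by
    writing convergence as the Cauchy property.\<close>
  have "{z \<in> space (M \<Otimes>\<^sub>M lborel). summable (\<lambda>n. of_real (a n) * \<xi> n (fst z) * circ (snd z) ^ n)} \<in> sets (M \<Otimes>\<^sub>M (lborel :: real measure))"
  proof -
    have [measurable]: "snd \<in> borel_measurable (M \<Otimes>\<^sub>M (lborel :: real measure))"
      using measurable_snd [of M "lborel :: real measure"] by simp
    show ?thesis
      unfolding summable_iff_convergent Cauchy_convergent_iff [symmetric] by measurable
  qed
  note AE_commute [OF this]
  ultimately show ?thesis by simp
qed

text \<open>Exponential moments with parameter \<open>1 / window_scale a j\<close> and the union
  bound give an energy of at most twice the total variance plus \<open>z + 2 * j\<close> times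
  \<open>window_scale a j\<close>. \<open>T\<close> contains both total variances, so that one bound
  serves the high and the low part.\<close>

lemma AE_window_energy_bounds:
  assumes l2: "summable (\<lambda>n. (a n)\<^sup>2)" and dec: "decseq (dyadic_sigma a)"
  defines "T \<equiv> \<lambda>z j. 2 * (high_energy a j + low_energy a j) + (z + 2 * real j) * window_scale a j"
  shows "AE \<omega> in M. \<exists>z\<ge>1. \<forall>j. \<forall>i<2 ^ (j + 2).
    (\<exists>\<^sub>F n in sequentially. window_energy (2 ^ j) n (\<lambda>k. of_real (if k < 2 ^ j then 0 else a k) * \<xi> k \<omega>)
        ((real i + 1 / 2) / 2 ^ (j + 2)) \<le> T z j)
    \<and> window_energy (2 ^ j) (2 ^ j) (\<lambda>k. of_real (real k / 2 ^ j * a k) * \<xi> k \<omega>)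
        ((real i + 1 / 2) / 2 ^ (j + 2)) \<le> T z j"
proof -
  have m [measurable]: "\<xi> n \<in> borel_measurable M" for n
    using std_complex_gaussian_borel_measurable gauss by blast
  define x where "x j i = (real i + 1 / 2) / 2 ^ (j + 2)" for j i :: nat
  define \<mu> where "\<mu> j = 1 / window_scale a j" for j
  define \<beta> where "\<beta> j k = (if k < 2 ^ j then 0 else a k)" for j k :: nat
  define \<gamma> where "\<gamma> j k = real k / 2 ^ j * a k" for j k :: nat
  define H where "H j i n \<omega> = window_energy (2 ^ j) n (\<lambda>k. of_real (\<beta> j k) * \<xi> k \<omega>) (x j i)" for j i n \<omega>
  define L where "L j i \<omega> = window_energy (2 ^ j) (2 ^ j) (\<lambda>k. of_real (\<gamma> j k) * \<xi> k \<omega>) (x j i)" for j i \<omega>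
  have [measurable]: "H j i n \<in> borel_measurable M" "L j i \<in> borel_measurable M" for j i n
    unfolding H_def L_def window_energy_def by measurable
  have \<mu>0: "\<mu> j > 0" for j using window_scale_pos [of a] by (simp add: \<mu>_def)
  have \<mu>d: "\<mu> j * window_scale a j = 1" for j using window_scale_pos [of a j] by (simp add: \<mu>_def)
  \<comment> \<open>The constants 4 and 2 in \<open>window_scale\<close> are made for this: twice
    any window variance, at most \<open>2 * (dyadic_sigma a j)\<^sup>2\<close> or
    \<open>low_energy a j\<close>, is bounded by the scale.\<close>
  have half: "\<mu> j * y \<le> 1 / 2" if "2 * y \<le> window_scale a j" for y j
  proof -
    have "\<mu> j * (2 * y) \<le> \<mu> j * window_scale a j" using that \<mu>0 [of j] by (intro mult_left_mono) auto
    then show ?thesis using \<mu>d [of j] by simp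
  qed
  have scale_ge: "4 * (dyadic_sigma a j)\<^sup>2 \<le> window_scale a j" "2 * low_energy a j \<le> window_scale a j" for j
    using low_energy_nonneg [of a j] zero_le_power2 [of "dyadic_sigma a j"] unfolding window_scale_def by auto
  \<comment> \<open>The liminf over truncations gives one variable per cell for the union bound, and
    Fatou keeps its expectation at most 1.\<close>
  define YH where "YH j i \<omega> = liminf (\<lambda>n. ennreal (exp (\<mu> j * H j i n \<omega> - 2 * \<mu> j * high_energy a j)))" for j i \<omega>
  define YL where "YL j i \<omega> = ennreal (exp (\<mu> j * L j i \<omega> - 2 * \<mu> j * low_energy a j))" for j i \<omega>
  have [measurable]: "YH j i \<in> borel_measurable M" "YL j i \<in> borel_measurable M" for j i
    unfolding YH_def YL_def by measurable
  have momH: "(\<integral>\<^sup>+\<omega>. ennreal (exp (\<mu> j * H j i n \<omega> - 2 * \<mu> j * high_energy a j)) \<partial>M) \<le> 1" for j i n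
    unfolding H_def
  proof (rule window_energy_exp_moment [OF ind gauss])
    show "\<mu> j * (\<Sum>k\<in>window (2 ^ j) n l. (\<beta> j k)\<^sup>2) \<le> 1 / 2" for l
      using dyadic_window_sum_le [OF dec, of j n l] scale_ge(1) [of j] unfolding \<beta>_def by (intro half) linarith
    show "(\<Sum>k<n. (\<beta> j k)\<^sup>2) \<le> high_energy a j"
    proof -
      have "(\<Sum>k<n. (\<beta> j k)\<^sup>2) = (\<Sum>k<n. if \<not> k < 2 ^ j then (a k)\<^sup>2 else 0)"
        by (intro sum.cong) (auto simp: \<beta>_def)
      also have "\<dots> = (\<Sum>k\<in>{k\<in>{..<n}. \<not> k < 2 ^ j}. (a k)\<^sup>2)"
        by (simp only: sum.inter_filter finite_lessThan)
      finally have "(\<Sum>k<n. (\<beta> j k)\<^sup>2) + (\<Sum>k<2 ^ j. (a k)\<^sup>2)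
          = (\<Sum>k\<in>{k\<in>{..<n}. \<not> k < 2 ^ j}. (a k)\<^sup>2) + (\<Sum>k<2 ^ j. (a k)\<^sup>2)" by simp
      also have "\<dots> = (\<Sum>k\<in>{k\<in>{..<n}. \<not> k < 2 ^ j} \<union> {..<2 ^ j}. (a k)\<^sup>2)"
        by (rule sum.union_disjoint [symmetric]) auto
      also have "\<dots> \<le> (\<Sum>n. (a n)\<^sup>2)"
        by (rule sum_le_suminf [OF l2]) auto
      finally show ?thesis unfolding high_energy_def by simp
    qed
  qed (use \<mu>0 less_imp_le in auto)
  have momYH: "(\<integral>\<^sup>+\<omega>. YH j i \<omega> \<partial>M) \<le> 1" for j i
  proof -
    have "(\<integral>\<^sup>+\<omega>. YH j i \<omega> \<partial>M) \<le> liminf (\<lambda>n. \<integral>\<^sup>+\<omega>. ennreal (exp (\<mu> j * H j i n \<omega> - 2 * \<mu> j * high_energy a j)) \<partial>M)"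
      unfolding YH_def by (rule nn_integral_liminf) measurable
    also have "\<dots> \<le> liminf (\<lambda>n::nat. 1)" by (intro Liminf_mono always_eventually allI momH)
    also have "\<dots> = 1" by (simp add: Liminf_const)
    finally show ?thesis .
  qed
  have momYL: "(\<integral>\<^sup>+\<omega>. YL j i \<omega> \<partial>M) \<le> 1" for j i
    unfolding YL_def L_def
  proof (rule window_energy_exp_moment [OF ind gauss])
    show "\<mu> j * (\<Sum>k\<in>window (2 ^ j) (2 ^ j) l. (\<gamma> j k)\<^sup>2) \<le> 1 / 2" for l
    proof (rule half)
      have "(\<Sum>k\<in>window (2 ^ j) (2 ^ j) l. (\<gamma> j k)\<^sup>2) \<le> (\<Sum>k<2 ^ j. (\<gamma> j k)\<^sup>2)"
        by (intro sum_mono2) (auto simp: window_def)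
      also have "\<dots> = low_energy a j" by (simp add: low_energy_def \<gamma>_def)
      finally show "2 * (\<Sum>k\<in>window (2 ^ j) (2 ^ j) l. (\<gamma> j k)\<^sup>2) \<le> window_scale a j"
        using scale_ge(2) [of j] by linarith
    qed
    show "(\<Sum>k<2 ^ j. (\<gamma> j k)\<^sup>2) \<le> low_energy a j" by (simp add: low_energy_def \<gamma>_def)
  qed (use \<mu>0 less_imp_le in auto)
  have high0: "high_energy a j \<ge> 0" for j
    unfolding high_energy_def using sum_le_suminf [OF l2, of "{..<2 ^ j}"] by simp
  have T_bound: "E \<le> T z j"
    if "exp (\<mu> j * E - 2 * \<mu> j * e) \<le> exp (z + 2 * real j)" "e \<le> high_energy a j + low_energy a j" for E e z j
  proof -
    have "\<mu> j * E \<le> 2 * \<mu> j * e + (z + 2 * real j)" using that(1) by simp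
    also have "\<dots> \<le> 2 * \<mu> j * (high_energy a j + low_energy a j) + (z + 2 * real j)"
      using that(2) \<mu>0 [of j] by (simp add: mult_left_mono)
    also have "z + 2 * real j = \<mu> j * ((z + 2 * real j) * window_scale a j)"
      using \<mu>d [of j] by (simp add: mult.left_commute)
    finally have "\<mu> j * E \<le> \<mu> j * T z j" by (simp add: T_def algebra_simps)
    then show ?thesis using \<mu>0 [of j] by simp
  qed
  have "AE \<omega> in M. \<exists>z\<ge>1. \<forall>j. \<forall>i<2 ^ (j + 2). YH j i \<omega> < ennreal (exp (z + 2 * real j))"
    by (rule AE_exponential_bound [OF _ momYH]) measurable
  moreover have "AE \<omega> in M. \<exists>z\<ge>1. \<forall>j. \<forall>i<2 ^ (j + 2). YL j i \<omega> < ennreal (exp (z + 2 * real j))"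
    by (rule AE_exponential_bound [OF _ momYL]) measurable
  ultimately show ?thesis
  proof eventually_elim
    case (elim \<omega>)
    then obtain z1 z2 where z1: "z1 \<ge> 1" "\<And>j i. i < 2 ^ (j + 2) \<Longrightarrow> YH j i \<omega> < ennreal (exp (z1 + 2 * real j))"
      and z2: "z2 \<ge> 1" "\<And>j i. i < 2 ^ (j + 2) \<Longrightarrow> YL j i \<omega> < ennreal (exp (z2 + 2 * real j))"
      by blast
    define z where "z = max z1 z2"
    have "(\<exists>\<^sub>F n in sequentially. H j i n \<omega> \<le> T z j) \<and> L j i \<omega> \<le> T z j" if i: "i < 2 ^ (j + 2)" for j i
    proof
      show "\<exists>\<^sub>F n in sequentially. H j i n \<omega> \<le> T z j"
      proof (rule ccontr)
        \<comment> \<open>If the energy exceeded \<open>T z j\<close> for all large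
          \<open>n\<close>, the liminf \<open>YH j i \<omega>\<close> would be at least
          \<open>exp (z + 2 * j)\<close>.\<close>
        assume "\<not> (\<exists>\<^sub>F n in sequentially. H j i n \<omega> \<le> T z j)"
        then have "eventually (\<lambda>n. \<not> H j i n \<omega> \<le> T z j) sequentially" by (simp add: frequently_def)
        then have "eventually (\<lambda>n. ennreal (exp (z + 2 * real j)) \<le> ennreal (exp (\<mu> j * H j i n \<omega> - 2 * \<mu> j * high_energy a j))) sequentially"
        proof eventually_elim
          case (elim n)
          have "\<not> exp (\<mu> j * H j i n \<omega> - 2 * \<mu> j * high_energy a j) \<le> exp (z + 2 * real j)"
            using T_bound [of j "H j i n \<omega>" "high_energy a j" z] elim low_energy_nonneg [of a j] by auto
          then show ?case by (intro ennreal_leI) simp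
        qed
        then have "ennreal (exp (z + 2 * real j)) \<le> YH j i \<omega>"
          unfolding YH_def by (rule Liminf_bounded)
        moreover have "YH j i \<omega> < ennreal (exp (z + 2 * real j))"
          using z1(2) [OF i] by (rule less_le_trans) (auto simp: z_def intro: ennreal_leI)
        ultimately show False by simp
      qed
      have "ennreal (exp (\<mu> j * L j i \<omega> - 2 * \<mu> j * low_energy a j)) \<le> ennreal (exp (z + 2 * real j))"
        using less_imp_le [OF z2(2) [OF i]] unfolding YL_def by (rule order_trans) (auto simp: z_def intro: ennreal_leI)
      then have "exp (\<mu> j * L j i \<omega> - 2 * \<mu> j * low_energy a j) \<le> exp (z + 2 * real j)"
        by (subst (asm) ennreal_le_iff) auto
      then show "L j i \<omega> \<le> T z j" using high0 [of j] by (intro T_bound) auto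
    qed
    then show ?case using z1(1) unfolding H_def L_def x_def \<beta>_def \<gamma>_def
      by (intro exI [of _ z]) (auto simp: z_def)
  qed
qed

end

end

section \<open>Passage to the limit and conclusion for almost every sample\<close>

lemma window_scale_times_index:
  assumes "decseq (dyadic_sigma a)" "summable (\<lambda>k. (dyadic_sigma a k)\<^sup>2)"
  shows "(\<lambda>j. (z + 2 * real j) * window_scale a j) \<longlonglongrightarrow> 0"
proof -
  have nn: "dyadic_sigma a k \<ge> 0" for k by (simp add: dyadic_sigma_def sum_nonneg)
  have "decseq (\<lambda>k. (dyadic_sigma a k)\<^sup>2)"
    using assms(1) nn by (auto simp: decseq_def intro: power_mono)
  then have s1: "(\<lambda>j. real j * (dyadic_sigma a j)\<^sup>2) \<longlonglongrightarrow> 0"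
    by (rule decseq_summable_times_index) (use assms in auto)
  have s2: "(\<lambda>j. (dyadic_sigma a j)\<^sup>2) \<longlonglongrightarrow> 0"
    using assms(2) by (rule summable_LIMSEQ_zero)
  have e1: "(\<lambda>j. real j * low_energy a j) \<longlonglongrightarrow> 0"
    by (rule low_energy_times_index [OF s1 s2])
  have e2: "low_energy a \<longlonglongrightarrow> 0"
  proof (rule tendsto_sandwich [OF _ _ tendsto_const e1])
    show "eventually (\<lambda>j. low_energy a j \<le> real j * low_energy a j) sequentially"
      using eventually_ge_at_top [of 1]
    proof eventually_elim
      case (elim j)
      then show ?case using mult_right_mono [of 1 "real j" "low_energy a j"] low_energy_nonneg [of a j] by simp
    qed
  qed (simp add: low_energy_nonneg)
  \<comment> \<open>The correction in \<open>window_scale\<close> carries a square so that it still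
    tends to 0 after multiplication by \<open>j\<close>.\<close>
  have i2: "(\<lambda>j. 1 / (real j + 1)\<^sup>2) \<longlonglongrightarrow> 0" and i1: "(\<lambda>j. real j / (real j + 1)\<^sup>2) \<longlonglongrightarrow> 0"
    by real_asymp+
  have "(\<lambda>j. z * (4 * (dyadic_sigma a j)\<^sup>2 + 2 * low_energy a j + 1 / (real j + 1)\<^sup>2)
      + 2 * (4 * (real j * (dyadic_sigma a j)\<^sup>2) + 2 * (real j * low_energy a j) + real j / (real j + 1)\<^sup>2))
     \<longlonglongrightarrow> z * (4 * 0 + 2 * 0 + 0) + 2 * (4 * 0 + 2 * 0 + 0)"
    by (intro tendsto_intros s1 s2 e1 e2 i1 i2)
  then show ?thesis by (simp add: window_scale_def algebra_simps add_divide_distrib)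
qed

lemma high_low_energy_tendsto_zero:
  assumes "decseq (dyadic_sigma a)" "summable (\<lambda>k. (dyadic_sigma a k)\<^sup>2)"
  shows "high_energy a \<longlonglongrightarrow> 0" "low_energy a \<longlonglongrightarrow> 0"
proof -
  have l2: "summable (\<lambda>n. (a n)\<^sup>2)" using assms(2) by (rule summable_squares_of_dyadic)
  have "(\<lambda>N. \<Sum>n<N. (a n)\<^sup>2) \<longlonglongrightarrow> (\<Sum>n. (a n)\<^sup>2)" using l2 by (rule summable_LIMSEQ)
  then have "((\<lambda>N. \<Sum>n<N. (a n)\<^sup>2) \<circ> (\<lambda>j. 2 ^ j)) \<longlonglongrightarrow> (\<Sum>n. (a n)\<^sup>2)"
    by (rule LIMSEQ_subseq_LIMSEQ) (auto simp: strict_mono_def)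
  then have "(\<lambda>j. (\<Sum>n. (a n)\<^sup>2) - (\<Sum>n<2 ^ j. (a n)\<^sup>2)) \<longlonglongrightarrow> (\<Sum>n. (a n)\<^sup>2) - (\<Sum>n. (a n)\<^sup>2)"
    by (intro tendsto_intros) (simp add: comp_def)
  then show "high_energy a \<longlonglongrightarrow> 0" unfolding high_energy_def [abs_def] by simp
  show "low_energy a \<longlonglongrightarrow> 0"
  proof (rule tendsto_sandwich [OF _ _ tendsto_const window_scale_times_index [OF assms, of 1]])
    show "eventually (\<lambda>j. low_energy a j \<le> (1 + 2 * real j) * window_scale a j) sequentially"
    proof (rule always_eventually, rule allI)
      fix j
      have "low_energy a j \<le> window_scale a j"
        using low_energy_nonneg [of a j] unfolding window_scale_def by auto
      also have "\<dots> \<le> (1 + 2 * real j) * window_scale a j"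
        using window_scale_pos [of a j] by simp
      finally show "low_energy a j \<le> (1 + 2 * real j) * window_scale a j" .
    qed
  qed (simp add: low_energy_nonneg)
qed

text \<open>By periodicity every cell of the line reduces to one of the \<open>2 ^ (j + 2)\<close>
  cells of a period, for which the almost sure bounds are available.\<close>

lemma dyadic_cell_mod:
  fixes i :: int
  obtains i' :: nat and m :: int where "i' < 2 ^ (j + 2)"
    "(of_int i + 1 / 2) / 2 ^ (j + 2) = (real i' + 1 / 2) / 2 ^ (j + 2) + of_int m"
proof
  let ?M = "2 ^ (j + 2) :: int"
  show "nat (i mod ?M) < 2 ^ (j + 2)"
    by (simp add: nat_less_iff)
  have "i = i mod ?M + ?M * (i div ?M)" by simp
  then have "(of_int i :: real) = of_int (i mod ?M) + of_int ?M * of_int (i div ?M)"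
    by (metis of_int_add of_int_mult)
  then show "(of_int i + 1 / 2) / 2 ^ (j + 2) = (real (nat (i mod ?M)) + 1 / 2) / 2 ^ (j + 2) + of_int (i div ?M)"
    by (simp add: field_simps)
qed

text \<open>On each cell the mean square is at most \<open>16 * T j\<close>, so by Cauchy-Schwarz
  the mean is at most \<open>s j = sqrt (16 * T j)\<close>. For the high part this passes to the
  limit of the truncations.\<close>

lemma VMOA_of_window_energy_bounds:
  fixes c :: "nat \<Rightarrow> complex" and T :: "nat \<Rightarrow> real"
  assumes c0: "c 0 = 0" and l2: "summable (\<lambda>n. (norm (c n))\<^sup>2)"
    and conv: "AE x in lborel. summable (\<lambda>n. c n * circ x ^ n)"
    and T0: "\<And>j. T j > 0" and Tlim: "T \<longlonglongrightarrow> 0"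
    and high: "\<And>j i. i < 2 ^ (j + 2) \<Longrightarrow>
      \<exists>\<^sub>F n in sequentially. window_energy (2 ^ j) n (\<lambda>k. if k < 2 ^ j then 0 else c k) ((real i + 1 / 2) / 2 ^ (j + 2)) \<le> T j"
    and low: "\<And>j i. i < 2 ^ (j + 2) \<Longrightarrow>
      window_energy (2 ^ j) (2 ^ j) (\<lambda>k. of_real (real k / 2 ^ j) * c k) ((real i + 1 / 2) / 2 ^ (j + 2)) \<le> T j"
  shows "(\<lambda>z. \<Sum>n. c n * z ^ n) \<in> VMOA"
proof (rule VMOA_power_seriesI [OF c0 l2 conv])
  define s where "s j = sqrt (16 * T j)" for j
  have s0: "s j > 0" "(s j)\<^sup>2 = 16 * T j" for j using T0 [of j] by (simp_all add: s_def)
  show "s j \<ge> 0" for j using s0 less_imp_le by blast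
  show "s \<longlonglongrightarrow> 0"
  proof -
    have "(\<lambda>j. sqrt (16 * T j)) \<longlonglongrightarrow> sqrt (16 * 0)" by (intro tendsto_intros Tlim)
    then show ?thesis by (simp add: s_def [abs_def])
  qed
  define f where "f x = (\<Sum>n. c n * circ x ^ n)" for x
  define p where "p j x = (\<Sum>k<2 ^ j. c k * circ (of_nat k * x))" for j :: nat and x
  have [measurable]: "f \<in> borel_measurable borel" "p j \<in> borel_measurable borel" for j
    unfolding f_def p_def by measurable
  fix j and i :: int
  define A B where "A = of_int i / (2 ^ (j + 2) :: real)" and "B = (of_int i + 1) / (2 ^ (j + 2) :: real)"
  have AB: "B - A = 1 / 2 ^ (j + 2)" by (simp add: A_def B_def diff_divide_distrib [symmetric])
  then have AB': "A \<le> B" by (smt (verit) divide_pos_pos zero_less_power)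
  obtain i' :: nat and m :: int where i': "i' < 2 ^ (j + 2)"
    "(of_int i + 1 / 2) / 2 ^ (j + 2) = (real i' + 1 / 2) / 2 ^ (j + 2) + of_int m"
    by (rule dyadic_cell_mod)
  have cell: "(\<integral>\<^sup>+t\<in>{A..B}. ennreal ((norm (\<Sum>k<n. b k * circ (of_nat k * t)))\<^sup>2) \<partial>lborel) \<le> ennreal ((s j)\<^sup>2 * (B - A))"
    if "window_energy (2 ^ j) n b ((real i' + 1 / 2) / 2 ^ (j + 2)) \<le> T j" for n b
  proof -
    have "(\<integral>\<^sup>+t\<in>{A..B}. ennreal ((norm (\<Sum>k<n. b k * circ (of_nat k * t)))\<^sup>2) \<partial>lborel)
        \<le> ennreal (16 * window_energy (2 ^ j) n b ((real i' + 1 / 2) / 2 ^ (j + 2)) * (B - A))"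
      using dyadic_cell_le_window_energy [where i = i and j = j and n = n and b = b] unfolding i'(2) window_energy_add_int A_def B_def .
    also have "\<dots> \<le> ennreal (16 * T j * (B - A))"
      using that AB' by (intro ennreal_leI mult_right_mono) auto
    finally show ?thesis by (simp add: s0)
  qed
  have hi: "(\<integral>\<^sup>+x\<in>{A..B}. ennreal (norm (f x - p j x)) \<partial>lborel) \<le> ennreal (s j * (B - A))"
  proof (rule nn_integral_le_of_square)
    define g where "g n x = (\<Sum>k<n. (if k < 2 ^ j then 0 else c k) * circ (of_nat k * x))" for n :: nat and x
    have [measurable]: "g n \<in> borel_measurable borel" for n unfolding g_def by measurable
    show "(\<integral>\<^sup>+x\<in>{A..B}. ennreal ((norm (f x - p j x))\<^sup>2) \<partial>lborel) \<le> ennreal ((s j)\<^sup>2 * (B - A))"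
    proof (rule nn_integral_square_limit_le [where g = g])
      show "AE x in lborel. (\<lambda>n. g n x) \<longlonglongrightarrow> f x - p j x"
        using conv
      proof eventually_elim
        case (elim x)
        have "(\<lambda>k. c k * circ x ^ k) sums f x" unfolding f_def using elim by (rule summable_sums)
        moreover have "(\<lambda>k. if k \<in> {..<2 ^ j} then c k * circ x ^ k else 0) sums p j x"
          unfolding p_def circ_mult_nat by (rule sums_If_finite_set) simp
        ultimately have "(\<lambda>k. c k * circ x ^ k - (if k \<in> {..<2 ^ j} then c k * circ x ^ k else 0)) sums (f x - p j x)"
          by (rule sums_diff)
        also have "(\<lambda>k. c k * circ x ^ k - (if k \<in> {..<2 ^ j} then c k * circ x ^ k else 0))
            = (\<lambda>k. (if k < 2 ^ j then 0 else c k) * circ (of_nat k * x))"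
          by (auto simp: circ_mult_nat)
        finally show ?case unfolding sums_def g_def .
      qed
      show "\<exists>\<^sub>F n in sequentially. (\<integral>\<^sup>+x\<in>{A..B}. ennreal ((norm (g n x))\<^sup>2) \<partial>lborel) \<le> ennreal ((s j)\<^sup>2 * (B - A))"
        unfolding g_def using high [OF i'(1)] by (rule frequently_elim1) (rule cell)
    qed auto
  qed (use s0 AB' in auto)
  show "(\<integral>\<^sup>+x\<in>{of_int i / 2 ^ (j + 2)..(of_int i + 1) / 2 ^ (j + 2)}.
      ennreal (norm ((\<Sum>n. c n * circ x ^ n) - (\<Sum>k<2 ^ j. c k * circ (of_nat k * x)))) \<partial>lborel) \<le> ennreal (s j / 2 ^ (j + 2))"
    using hi unfolding AB by (simp add: f_def p_def A_def B_def)
  \<comment> \<open>The derivative sum is \<open>2 ^ j * q\<close>; integrated over a cell of length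
    \<open>1 / 2 ^ (j + 2)\<close> it is at most \<open>s j / 4\<close>.\<close>
  define q where "q x = (\<Sum>k<2 ^ j. of_real (real k / 2 ^ j) * c k * circ (of_nat k * x))" for x
  have [measurable]: "q \<in> borel_measurable borel" unfolding q_def by measurable
  have q_le: "(\<integral>\<^sup>+x\<in>{A..B}. ennreal (norm (q x)) \<partial>lborel) \<le> ennreal (s j * (B - A))"
  proof (rule nn_integral_le_of_square)
    show "(\<integral>\<^sup>+x\<in>{A..B}. ennreal ((norm (q x))\<^sup>2) \<partial>lborel) \<le> ennreal ((s j)\<^sup>2 * (B - A))"
      unfolding q_def by (rule cell [OF low [OF i'(1)]])
  qed (use s0 AB' in auto)
  have "norm (\<Sum>k<2 ^ j. of_nat k * c k * circ (of_nat k * x)) = 2 ^ j * norm (q x)" for x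
  proof -
    have "(\<Sum>k<2 ^ j. of_nat k * c k * circ (of_nat k * x)) = 2 ^ j * q x"
      unfolding q_def sum_distrib_left by (intro sum.cong) auto
    then show ?thesis by (simp add: norm_mult norm_power)
  qed
  then have "(\<integral>\<^sup>+x\<in>{A..B}. ennreal (norm (\<Sum>k<2 ^ j. of_nat k * c k * circ (of_nat k * x))) \<partial>lborel)
      = ennreal (2 ^ j) * (\<integral>\<^sup>+x\<in>{A..B}. ennreal (norm (q x)) \<partial>lborel)"
    by (simp only:) (subst nn_integral_cmult [symmetric], auto simp: ennreal_mult mult.assoc)
  also have "\<dots> \<le> ennreal (2 ^ j) * ennreal (s j * (B - A))"
    by (intro mult_left_mono q_le) auto
  also have "\<dots> = ennreal (2 ^ j * (s j * (B - A)))"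
    using s0 [of j] AB' by (subst ennreal_mult) auto
  also have "\<dots> \<le> ennreal (s j)"
    unfolding AB using s0 [of j] by (intro ennreal_leI) (simp add: field_simps)
  finally show "(\<integral>\<^sup>+x\<in>{of_int i / 2 ^ (j + 2)..(of_int i + 1) / 2 ^ (j + 2)}.
      ennreal (norm (\<Sum>k<2 ^ j. of_nat k * c k * circ (of_nat k * x))) \<partial>lborel) \<le> ennreal (s j)"
    unfolding A_def B_def .
qed

theorem theorem1p1:
  fixes M :: "'w measure" and a :: "nat \<Rightarrow> real" and \<xi> :: "nat \<Rightarrow> 'w \<Rightarrow> complex"
  assumes "prob_space M"
    and "\<And>n. a n \<ge> 0" and "a 0 = 0"
    and "prob_space.indep_vars M (\<lambda>_. borel) \<xi> UNIV"
    and "\<And>n. std_complex_gaussian M (\<xi> n)"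
    and "dyadic_regular a"
    and "summable (\<lambda>k. (dyadic_sigma a k)\<^sup>2)"
  shows "AE \<omega> in M. gaussian_series a \<xi> \<omega> \<in> VMOA"
proof -
  interpret prob_space M by fact
  have dec: "decseq (dyadic_sigma a)" using assms(6) by (simp add: dyadic_regular_def)
  have l2: "summable (\<lambda>n. (a n)\<^sup>2)" using assms(7) by (rule summable_squares_of_dyadic)
  from AE_square_summable [OF assms(4,5) l2] AE_summable_on_circle [OF assms(4,5) l2]
    AE_window_energy_bounds [OF assms(4,5) l2 dec]
  show ?thesis
  proof eventually_elim
    case (elim \<omega>)
    from elim(3) obtain z where z: "z \<ge> 1" and E: "\<And>j i. i < 2 ^ (j + 2) \<Longrightarrow>
      (\<exists>\<^sub>F n in sequentially. window_energy (2 ^ j) n (\<lambda>k. of_real (if k < 2 ^ j then 0 else a k) * \<xi> k \<omega>)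
          ((real i + 1 / 2) / 2 ^ (j + 2)) \<le> 2 * (high_energy a j + low_energy a j) + (z + 2 * real j) * window_scale a j)
      \<and> window_energy (2 ^ j) (2 ^ j) (\<lambda>k. of_real (real k / 2 ^ j * a k) * \<xi> k \<omega>)
          ((real i + 1 / 2) / 2 ^ (j + 2)) \<le> 2 * (high_energy a j + low_energy a j) + (z + 2 * real j) * window_scale a j"
      by blast
    have "(\<lambda>z. \<Sum>n. of_real (a n) * \<xi> n \<omega> * z ^ n) \<in> VMOA"
    proof (rule VMOA_of_window_energy_bounds
        [where T = "\<lambda>j. 2 * (high_energy a j + low_energy a j) + (z + 2 * real j) * window_scale a j"])
      show "0 < 2 * (high_energy a j + low_energy a j) + (z + 2 * real j) * window_scale a j" for j
      proof -
        \<comment> \<open>Strict positivity comes from this term, through \<open>z \<ge> 1\<close>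
          and the correction in \<open>window_scale\<close>; the energies may vanish.\<close>
        have "(z + 2 * real j) * window_scale a j > 0" using z window_scale_pos by (intro mult_pos_pos) auto
        moreover have "high_energy a j \<ge> 0"
          unfolding high_energy_def using sum_le_suminf [OF l2, of "{..<2 ^ j}"] by simp
        ultimately show ?thesis using low_energy_nonneg [of a j] by (intro add_nonneg_pos) auto
      qed
      have "(\<lambda>j. 2 * (high_energy a j + low_energy a j) + (z + 2 * real j) * window_scale a j) \<longlonglongrightarrow> 2 * (0 + 0) + 0"
        by (intro tendsto_intros high_low_energy_tendsto_zero window_scale_times_index dec assms(7))
      then show "(\<lambda>j. 2 * (high_energy a j + low_energy a j) + (z + 2 * real j) * window_scale a j) \<longlonglongrightarrow> 0" by simp
      fix j i :: nat assume i: "i < 2 ^ (j + 2)"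
      have "(\<lambda>k. of_real (if k < 2 ^ j then 0 else a k) * \<xi> k \<omega>) = (\<lambda>k. if k < 2 ^ j then 0 else of_real (a k) * \<xi> k \<omega>)"
        by auto
      then show "\<exists>\<^sub>F n in sequentially. window_energy (2 ^ j) n (\<lambda>k. if k < 2 ^ j then 0 else of_real (a k) * \<xi> k \<omega>)
          ((real i + 1 / 2) / 2 ^ (j + 2)) \<le> 2 * (high_energy a j + low_energy a j) + (z + 2 * real j) * window_scale a j"
        using E [OF i] by simp
      show "window_energy (2 ^ j) (2 ^ j) (\<lambda>k. of_real (real k / 2 ^ j) * (of_real (a k) * \<xi> k \<omega>))
          ((real i + 1 / 2) / 2 ^ (j + 2)) \<le> 2 * (high_energy a j + low_energy a j) + (z + 2 * real j) * window_scale a j"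
        using E [OF i] by (simp add: mult.assoc)
    qed (use elim assms(3) in auto)
    then show ?case by (simp add: gaussian_series_def [abs_def])
  qed
qed

end
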